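(* Let $A=(a_1,\ldots,a_n)$ and $B=(b_1,\ldots,b_n)$ be two sequences of points. Then the discrete Fréchet gap with one-sided shortcuts $d_{FG}^S(A,B)$ and the discrete Fréchet ratio with one-sided shortcuts $d_{FR}^S(A,B)$ can be computed in $O(n^2\log^2 n)$ time.
   Context: $d(a_i,b_j)$ denotes the Euclidean distance between $a_i$ and $b_j$. Let $G$ be the directed graph whose vertices are the positions $(a_i,b_j)$, $1\le i,j\le n$, and whose edges are $((a_i,b_j),(a_{i+1},b_j))$, $((a_i,b_j),(a_i,b_{j+1}))$ and $((a_i,b_j),(a_{i+1},b_{j+1}))$, whenever the indices are in $\{1,\ldots,n\}$. Let $f$ be an indicator function from positions to $\{0,1\}$; a position is valid if $f$ equals $1$ on it. A position $(a_i,b_j)$ is s-reachable w.r.t. $f$ if there is a path $P$ in $G$ from $(a_1,b_1)$ to $(a_i,b_j)$ such that $f(a_1,b_1)=1$, $f(a_i,b_j)=1$, and for each $b_l$ with $1<l<j$ there is a position $(a_k,b_l)\in P$ with $f(a_k,b_l)=1$. For $0\le s\le t$, let $f_{[s,t]}(a_i,b_j)=1$ if $s\le d(a_i,b_j)\le t$, and $f_{[s,t]}(a_i,b_j)=0$ otherwise. It is assumed that the indicator function can be evaluated at any position in constant time. The range $[s,t]$ is a feasible range with one-sided shortcuts if $(a_n,b_n)$ is s-reachable w.r.t. $f_{[s,t]}$. The discrete Fréchet gap with one-sided shortcuts $d_{FG}^S(A,B)$ is the smallest $\delta=t-s\ge 0$ for which $[s,t]$ is a feasible range with one-sided shortcuts.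 The discrete Fréchet ratio with one-sided shortcuts $d_{FR}^S(A,B)$ is the smallest $\delta=t/s$ for which $[s,t]$ is a feasible range with one-sided shortcuts. *)

theory Defs
  imports
    "HOL-Analysis.Analysis"
    "HOL-Library.Landau_Symbols"
    "Graph_Theory.Graph_Theory"
begin

section \<open>Discrete Frechet gap and ratio with one-sided shortcuts\<close>

text \<open>
  A sequence of \<open>n\<close> points is a function on \<open>nat\<close> of which only the values at \<open>1, \<dots>, n\<close>
  matter. The position \<open>(a\<^sub>i, b\<^sub>j)\<close> is represented by the index pair \<open>(i, j)\<close>, so that repeated
  points still give different positions.
\<close>

type_synonym position = "nat \<times> nat"

definition position_graph :: "nat \<Rightarrow> position pair_pre_digraph" where
  "position_graph n = \<lparr> pverts = {1..n} \<times> {1..n},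
     parcs = {((i, j), (i', j')) | i j i' j'.
       {i, j, i', j'} \<subseteq> {1..n} \<and>
       ((i', j') = (i + 1, j) \<or> (i', j') = (i, j + 1) \<or> (i', j') = (i + 1, j + 1))} \<rparr>"

definition s_reachable :: "nat \<Rightarrow> (position \<Rightarrow> nat) \<Rightarrow> position \<Rightarrow> bool" where
  "s_reachable n f = (\<lambda>(i, j). \<exists>P. vpath P (with_proj (position_graph n)) \<and>
     hd P = (1, 1) \<and> last P = (i, j) \<and> f (1, 1) = 1 \<and> f (i, j) = 1 \<and>
     (\<forall>l. 1 < l \<and> l < j \<longrightarrow> (\<exists>k. (k, l) \<in> set P \<and> f (k, l) = 1)))"

definition range_indicator ::
    "(nat \<Rightarrow> 'a::metric_space) \<Rightarrow> (nat \<Rightarrow> 'a) \<Rightarrow> real \<Rightarrow> real \<Rightarrow> position \<Rightarrow> nat" where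
  "range_indicator a b s t = (\<lambda>(i, j). if s \<le> dist (a i) (b j) \<and> dist (a i) (b j) \<le> t then 1 else 0)"

definition feasible_range ::
    "nat \<Rightarrow> (nat \<Rightarrow> 'a::metric_space) \<Rightarrow> (nat \<Rightarrow> 'a) \<Rightarrow> real \<Rightarrow> real \<Rightarrow> bool" where
  "feasible_range n a b s t \<longleftrightarrow>
     0 \<le> s \<and> s \<le> t \<and> s_reachable n (range_indicator a b s t) (n, n)"

definition is_frechet_gap ::
    "nat \<Rightarrow> (nat \<Rightarrow> 'a::metric_space) \<Rightarrow> (nat \<Rightarrow> 'a) \<Rightarrow> real \<Rightarrow> bool" where
  "is_frechet_gap n a b \<delta> \<longleftrightarrow>
     (\<exists>s t. feasible_range n a b s t \<and> \<delta> = t - s) \<and>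
     (\<forall>s t. feasible_range n a b s t \<longrightarrow> \<delta> \<le> t - s)"

text \<open>
  The quotient \<open>t / s\<close> is meaningless for \<open>s = 0\<close> (in HOL it would be \<open>0\<close>), so the ratio ranges
  over the feasible ranges with \<open>s > 0\<close>. If \<open>a\<^sub>1 = b\<^sub>1\<close>, for instance, there are none, and no
  \<open>\<delta>\<close> is the ratio.
\<close>

definition is_frechet_ratio ::
    "nat \<Rightarrow> (nat \<Rightarrow> 'a::metric_space) \<Rightarrow> (nat \<Rightarrow> 'a) \<Rightarrow> real \<Rightarrow> bool" where
  "is_frechet_ratio n a b \<delta> \<longleftrightarrow>
     (\<exists>s t. feasible_range n a b s t \<and> 0 < s \<and> \<delta> = t / s) \<and>
     (\<forall>s t. feasible_range n a b s t \<and> 0 < s \<longrightarrow> \<delta> \<le> t / s)"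


section \<open>Real RAM programs and their running time\<close>

text \<open>
  The store consists of integer arrays (first component) and real arrays (second component), both
  addressed by an array number and a cell number; a scalar variable is a fixed cell of an array. The
  array number is part of the program text, so a program uses finitely many arrays. Real cells
  hold arbitrary reals, and a real influences integers and addresses only through comparisons (no
  rounding).
\<close>

type_synonym store = "(nat \<Rightarrow> nat \<Rightarrow> nat) \<times> (nat \<Rightarrow> nat \<Rightarrow> real)"

datatype nexp =
    NConst nat
  | NCell nat nexp
  | NPlus nexp nexp
  | NMinus nexp nexp
  | NTimes nexp nexp
  | NDiv nexp nexp

datatype rexp =
    RConst rat
  | RCell nat nexp
  | RPlus rexp rexp
  | RMinus rexp rexp
  | RTimes rexp rexp
  | RDivide rexp rexp
  | RSqrt rexp

datatype bexp =
    NLess nexp nexp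
  | RLess rexp rexp
  | BNot bexp
  | BAnd bexp bexp

datatype program =
    Skip
  | NAssign nat nexp nexp
  | RAssign nat nexp rexp
  | Seq program program
  | Cond bexp program program
  | Loop bexp program

fun nval :: "store \<Rightarrow> nexp \<Rightarrow> nat" where
  "nval \<sigma> (NConst c) = c"
| "nval \<sigma> (NCell x e) = fst \<sigma> x (nval \<sigma> e)"
| "nval \<sigma> (NPlus e e') = nval \<sigma> e + nval \<sigma> e'"
| "nval \<sigma> (NMinus e e') = nval \<sigma> e - nval \<sigma> e'"
| "nval \<sigma> (NTimes e e') = nval \<sigma> e * nval \<sigma> e'"
| "nval \<sigma> (NDiv e e') = nval \<sigma> e div nval \<sigma> e'"

fun rval :: "store \<Rightarrow> rexp \<Rightarrow> real" where
  "rval \<sigma> (RConst q) = of_rat q"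
| "rval \<sigma> (RCell x e) = snd \<sigma> x (nval \<sigma> e)"
| "rval \<sigma> (RPlus e e') = rval \<sigma> e + rval \<sigma> e'"
| "rval \<sigma> (RMinus e e') = rval \<sigma> e - rval \<sigma> e'"
| "rval \<sigma> (RTimes e e') = rval \<sigma> e * rval \<sigma> e'"
| "rval \<sigma> (RDivide e e') = rval \<sigma> e / rval \<sigma> e'"
| "rval \<sigma> (RSqrt e) = sqrt (rval \<sigma> e)"

fun bval :: "store \<Rightarrow> bexp \<Rightarrow> bool" where
  "bval \<sigma> (NLess e e') \<longleftrightarrow> nval \<sigma> e < nval \<sigma> e'"
| "bval \<sigma> (RLess e e') \<longleftrightarrow> rval \<sigma> e < rval \<sigma> e'"
| "bval \<sigma> (BNot c) \<longleftrightarrow> \<not> bval \<sigma> c"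
| "bval \<sigma> (BAnd c c') \<longleftrightarrow> bval \<sigma> c \<and> bval \<sigma> c'"

text \<open>
  Unit-cost integer arithmetic is only a realistic measure for integers of logarithmic length.
  The following predicates say that every integer, and hence every address, that occurs in the
  evaluation of an expression is at most \<open>W\<close>; execution gets stuck where this fails.
\<close>

fun nfits :: "nat \<Rightarrow> store \<Rightarrow> nexp \<Rightarrow> bool" where
  "nfits W \<sigma> (NConst c) \<longleftrightarrow> c \<le> W"
| "nfits W \<sigma> (NCell x e) \<longleftrightarrow> nfits W \<sigma> e \<and> nval \<sigma> (NCell x e) \<le> W"
| "nfits W \<sigma> (NPlus e e') \<longleftrightarrow> nfits W \<sigma> e \<and> nfits W \<sigma> e' \<and> nval \<sigma> (NPlus e e') \<le> W"
| "nfits W \<sigma> (NMinus e e') \<longleftrightarrow> nfits W \<sigma> e \<and> nfits W \<sigma> e' \<and> nval \<sigma> (NMinus e e') \<le> W"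
| "nfits W \<sigma> (NTimes e e') \<longleftrightarrow> nfits W \<sigma> e \<and> nfits W \<sigma> e' \<and> nval \<sigma> (NTimes e e') \<le> W"
| "nfits W \<sigma> (NDiv e e') \<longleftrightarrow> nfits W \<sigma> e \<and> nfits W \<sigma> e' \<and> nval \<sigma> (NDiv e e') \<le> W"

fun rfits :: "nat \<Rightarrow> store \<Rightarrow> rexp \<Rightarrow> bool" where
  "rfits W \<sigma> (RConst q) \<longleftrightarrow> True"
| "rfits W \<sigma> (RCell x e) \<longleftrightarrow> nfits W \<sigma> e"
| "rfits W \<sigma> (RPlus e e') \<longleftrightarrow> rfits W \<sigma> e \<and> rfits W \<sigma> e'"
| "rfits W \<sigma> (RMinus e e') \<longleftrightarrow> rfits W \<sigma> e \<and> rfits W \<sigma> e'"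
| "rfits W \<sigma> (RTimes e e') \<longleftrightarrow> rfits W \<sigma> e \<and> rfits W \<sigma> e'"
| "rfits W \<sigma> (RDivide e e') \<longleftrightarrow> rfits W \<sigma> e \<and> rfits W \<sigma> e'"
| "rfits W \<sigma> (RSqrt e) \<longleftrightarrow> rfits W \<sigma> e"

fun bfits :: "nat \<Rightarrow> store \<Rightarrow> bexp \<Rightarrow> bool" where
  "bfits W \<sigma> (NLess e e') \<longleftrightarrow> nfits W \<sigma> e \<and> nfits W \<sigma> e'"
| "bfits W \<sigma> (RLess e e') \<longleftrightarrow> rfits W \<sigma> e \<and> rfits W \<sigma> e'"
| "bfits W \<sigma> (BNot c) \<longleftrightarrow> bfits W \<sigma> c"
| "bfits W \<sigma> (BAnd c c') \<longleftrightarrow> bfits W \<sigma> c \<and> bfits W \<sigma> c'"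

fun ncost :: "nexp \<Rightarrow> nat" where
  "ncost (NConst c) = 1"
| "ncost (NCell x e) = 1 + ncost e"
| "ncost (NPlus e e') = 1 + ncost e + ncost e'"
| "ncost (NMinus e e') = 1 + ncost e + ncost e'"
| "ncost (NTimes e e') = 1 + ncost e + ncost e'"
| "ncost (NDiv e e') = 1 + ncost e + ncost e'"

fun rcost :: "rexp \<Rightarrow> nat" where
  "rcost (RConst q) = 1"
| "rcost (RCell x e) = 1 + ncost e"
| "rcost (RPlus e e') = 1 + rcost e + rcost e'"
| "rcost (RMinus e e') = 1 + rcost e + rcost e'"
| "rcost (RTimes e e') = 1 + rcost e + rcost e'"
| "rcost (RDivide e e') = 1 + rcost e + rcost e'"
| "rcost (RSqrt e) = 1 + rcost e"

fun bcost :: "bexp \<Rightarrow> nat" where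
  "bcost (NLess e e') = 1 + ncost e + ncost e'"
| "bcost (RLess e e') = 1 + rcost e + rcost e'"
| "bcost (BNot c) = 1 + bcost c"
| "bcost (BAnd c c') = 1 + bcost c + bcost c'"

definition nupdate :: "store \<Rightarrow> nat \<Rightarrow> nat \<Rightarrow> nat \<Rightarrow> store" where
  "nupdate \<sigma> x i v = ((fst \<sigma>)(x := (fst \<sigma> x)(i := v)), snd \<sigma>)"

definition rupdate :: "store \<Rightarrow> nat \<Rightarrow> nat \<Rightarrow> real \<Rightarrow> store" where
  "rupdate \<sigma> x i v = (fst \<sigma>, (snd \<sigma>)(x := (snd \<sigma> x)(i := v)))"

text \<open>
  \<open>exec W p \<sigma> \<tau> \<sigma>'\<close>: with integers bounded by \<open>W\<close>, the program \<open>p\<close> started in \<open>\<sigma>\<close> terminates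
  in \<open>\<sigma>'\<close> after \<open>\<tau>\<close> elementary steps.
\<close>

inductive exec :: "nat \<Rightarrow> program \<Rightarrow> store \<Rightarrow> nat \<Rightarrow> store \<Rightarrow> bool" for W where
  exec_Skip: "exec W Skip \<sigma> 1 \<sigma>"
| exec_NAssign: "nfits W \<sigma> i \<Longrightarrow> nfits W \<sigma> e \<Longrightarrow>
    exec W (NAssign x i e) \<sigma> (1 + ncost i + ncost e) (nupdate \<sigma> x (nval \<sigma> i) (nval \<sigma> e))"
| exec_RAssign: "nfits W \<sigma> i \<Longrightarrow> rfits W \<sigma> e \<Longrightarrow>
    exec W (RAssign x i e) \<sigma> (1 + ncost i + rcost e) (rupdate \<sigma> x (nval \<sigma> i) (rval \<sigma> e))"
| exec_Seq: "exec W p \<sigma> \<tau> \<sigma>' \<Longrightarrow> exec W q \<sigma>' \<tau>' \<sigma>'' \<Longrightarrow>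
    exec W (Seq p q) \<sigma> (\<tau> + \<tau>') \<sigma>''"
| exec_Cond_True: "bfits W \<sigma> c \<Longrightarrow> bval \<sigma> c \<Longrightarrow> exec W p \<sigma> \<tau> \<sigma>' \<Longrightarrow>
    exec W (Cond c p q) \<sigma> (1 + bcost c + \<tau>) \<sigma>'"
| exec_Cond_False: "bfits W \<sigma> c \<Longrightarrow> \<not> bval \<sigma> c \<Longrightarrow> exec W q \<sigma> \<tau> \<sigma>' \<Longrightarrow>
    exec W (Cond c p q) \<sigma> (1 + bcost c + \<tau>) \<sigma>'"
| exec_Loop_True: "bfits W \<sigma> c \<Longrightarrow> bval \<sigma> c \<Longrightarrow> exec W p \<sigma> \<tau> \<sigma>' \<Longrightarrow>
    exec W (Loop c p) \<sigma>' \<tau>' \<sigma>'' \<Longrightarrow> exec W (Loop c p) \<sigma> (1 + bcost c + \<tau> + \<tau>') \<sigma>''"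
| exec_Loop_False: "bfits W \<sigma> c \<Longrightarrow> \<not> bval \<sigma> c \<Longrightarrow>
    exec W (Loop c p) \<sigma> (1 + bcost c) \<sigma>"

inductive_cases exec_SkipE: "exec W Skip \<sigma> \<tau> \<sigma>'"
inductive_cases exec_NAssignE: "exec W (NAssign x i e) \<sigma> \<tau> \<sigma>'"
inductive_cases exec_RAssignE: "exec W (RAssign x i e) \<sigma> \<tau> \<sigma>'"
inductive_cases exec_SeqE: "exec W (Seq p q) \<sigma> \<tau> \<sigma>'"
inductive_cases exec_CondE: "exec W (Cond c p q) \<sigma> \<tau> \<sigma>'"
inductive_cases exec_LoopE: "exec W (Loop c p) \<sigma> \<tau> \<sigma>'"

lemma exec_deterministic:
  assumes "exec W p \<sigma> \<tau>1 \<sigma>1" and "exec W p \<sigma> \<tau>2 \<sigma>2"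
  shows "\<tau>1 = \<tau>2 \<and> \<sigma>1 = \<sigma>2"
  using assms
proof (induction arbitrary: \<tau>2 \<sigma>2 rule: exec.induct)
  case (exec_Skip \<sigma>)
  from exec_Skip.prems show ?case by (rule exec_SkipE) simp
next
  case (exec_NAssign \<sigma> i e x)
  from exec_NAssign.prems show ?case by (rule exec_NAssignE) simp
next
  case (exec_RAssign \<sigma> i e x)
  from exec_RAssign.prems show ?case by (rule exec_RAssignE) simp
next
  case (exec_Seq p \<sigma> \<tau> \<sigma>' q \<tau>' \<sigma>'')
  from exec_Seq.prems show ?case by (rule exec_SeqE) (use exec_Seq.IH in metis)
next
  case (exec_Cond_True \<sigma> c p \<tau> \<sigma>' q)
  from exec_Cond_True.prems show ?case
    by (rule exec_CondE) (use exec_Cond_True in \<open>metis plus_1_eq_Suc add_Suc\<close>)+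
next
  case (exec_Cond_False \<sigma> c q \<tau> \<sigma>' p)
  from exec_Cond_False.prems show ?case
    by (rule exec_CondE) (use exec_Cond_False in \<open>metis plus_1_eq_Suc add_Suc\<close>)+
next
  case (exec_Loop_True \<sigma> c p \<tau> \<sigma>' \<tau>' \<sigma>'')
  from exec_Loop_True.prems show ?case
    by (rule exec_LoopE) (use exec_Loop_True.hyps(1,2) exec_Loop_True.IH in \<open>metis plus_1_eq_Suc add_Suc\<close>)+
next
  case (exec_Loop_False \<sigma> c p)
  from exec_Loop_False.prems show ?case
    by (rule exec_LoopE) (use exec_Loop_False.hyps in simp_all)
qed

text \<open>
  Points are given by their coordinates with respect to an enumeration \<open>bs\<close> of the orthonormal
  basis. Integer cell \<open>(0, 0)\<close> contains \<open>n\<close>; real arrays \<open>0\<close> and \<open>1\<close> contain the coordinates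
  of \<open>a\<^sub>1, \<dots>, a\<^sub>n\<close> and of \<open>b\<^sub>1, \<dots>, b\<^sub>n\<close>, point after point. All other cells are \<open>0\<close>.
\<close>

definition coordinates :: "'a::euclidean_space list \<Rightarrow> nat \<Rightarrow> (nat \<Rightarrow> 'a) \<Rightarrow> nat \<Rightarrow> real" where
  "coordinates bs n a m =
     (if m < n * length bs then a (m div length bs + 1) \<bullet> bs ! (m mod length bs) else 0)"

definition input_store ::
    "'a::euclidean_space list \<Rightarrow> nat \<Rightarrow> (nat \<Rightarrow> 'a) \<Rightarrow> (nat \<Rightarrow> 'a) \<Rightarrow> store" where
  "input_store bs n a b =
     ((\<lambda>x m. if x = 0 \<and> m = 0 then n else 0),
      (\<lambda>x m. if x = 0 then coordinates bs n a m else if x = 1 then coordinates bs n b m else 0))"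

text \<open>
  A program reports \<open>None\<close> by leaving \<open>0\<close> in integer cell \<open>(0, 0)\<close>; otherwise real cell \<open>(0, 0)\<close>
  is the result.
\<close>

definition output_of :: "store \<Rightarrow> real option" where
  "output_of \<sigma> = (if fst \<sigma> 0 0 = 0 then None else Some (snd \<sigma> 0 0))"

text \<open>
  The problem is given by the relation \<open>spec n a b r\<close> between the input and the admissible result
  \<open>r\<close>. Integers are restricted to words of \<open>k * log 2 (n + 1)\<close> bits, with \<open>k\<close> constant.
\<close>

definition computable_in_time ::
    "'a::euclidean_space list \<Rightarrow>
     (nat \<Rightarrow> (nat \<Rightarrow> 'a) \<Rightarrow> (nat \<Rightarrow> 'a) \<Rightarrow> real option \<Rightarrow> bool) \<Rightarrow> (nat \<Rightarrow> real) \<Rightarrow> bool" where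
  "computable_in_time bs spec g \<longleftrightarrow>
     (\<exists>p k T. (\<lambda>n. real (T n)) \<in> O(g) \<and>
        (\<forall>n\<ge>1. \<forall>a b. \<exists>\<tau> \<sigma>. exec ((n + 1) ^ k) p (input_store bs n a b) \<tau> \<sigma> \<and>
           \<tau> \<le> T n \<and> spec n a b (output_of \<sigma>)))"

end

theory Submission
  imports Defs
begin

text \<open>
  Row by row, the smallest admissible index is the best choice, so s-reachability is decided by a
  greedy walk: from a valid position go to the next point of \<open>B\<close>, from an invalid one to the next
  point of \<open>A\<close>. An optimal range has distances as its end points, and the candidates are the
  windows \<open>[p, q)\<close> of ranks in the sorted list of the \<open>m = n\<^sup>2\<close> distances; two pointers visit at
  most \<open>2 m\<close> of them. During the next \<open>K\<close> steps only the positions whose ranks are within \<open>K\<close>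
  of \<open>p\<close> or \<open>q\<close> can change their validity, so the walk graph can be contracted to these at most
  \<open>2 K\<close> positions. This is done on \<open>J = O(log m)\<close> levels with \<open>K = 2\<^sup>j - 1\<close>: every \<open>2\<^sup>j\<close> steps
  the graph of level \<open>j\<close> is recomputed from that of level \<open>j + 1\<close>, in time \<open>O(2\<^sup>j)\<close>, and the graph
  of level \<open>0\<close> has no positions left and answers the query. The total time is \<open>O(m log m)\<close>.
\<close>


section \<open>Hoare logic with running times\<close>

text \<open>One greedy walk costs \<open>O(m)\<close>, so running it for each window separately
  would take \<open>O(m * m)\<close>. The sequence of windows is not known beforehand, because the
  answer for one window decides which pointer moves next. A graph meant for \<open>K\<close> moves
  must therefore be right for every combination of \<open>p'\<close> in \<open>{p..p + K}\<close>
  and \<open>q'\<close> in \<open>{q..q + K}\<close>; this is where two blocks of \<open>K\<close>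
  ranks come from. Any other node is valid in all these windows or in none, so the walk can leave it
  in one way only and it can be bypassed. All successors have larger numbers, so a single descending
  pass finds for each node the first one that is kept. A graph of level \<open>j\<close> answers
  \<open>2 ^ j\<close> queries, between which lie \<open>2 ^ j - 1\<close> moves; hence the value of
  \<open>K\<close>. Rebuilding every graph from the full grid would cost \<open>O(m)\<close> each
  time; starting from the next higher level keeps the cost proportional to the number of queries
  served. Ranks rather than distances delimit the windows, so that equal distances do not enlarge
  the blocks.\<close>

definition runs :: "nat \<Rightarrow> program \<Rightarrow> store \<Rightarrow> nat \<Rightarrow> (store \<Rightarrow> bool) \<Rightarrow> bool" where
  "runs W p \<sigma> t Q \<longleftrightarrow> (\<exists>\<tau> \<sigma>'. exec W p \<sigma> \<tau> \<sigma>' \<and> \<tau> \<le> t \<and> Q \<sigma>')"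

text \<open>Stores are pairs; splitting quantifiers over them only obstructs automation.\<close>

declare split_paired_Ex [simp del] split_paired_All [simp del]

lemma runsI: "exec W p \<sigma> \<tau> \<sigma>' \<Longrightarrow> \<tau> \<le> t \<Longrightarrow> Q \<sigma>' \<Longrightarrow> runs W p \<sigma> t Q"
  unfolding runs_def by blast

lemma runsE:
  assumes "runs W p \<sigma> t Q"
  obtains \<tau> \<sigma>' where "exec W p \<sigma> \<tau> \<sigma>'" and "\<tau> \<le> t" and "Q \<sigma>'"
  using assms unfolding runs_def by blast

lemma runs_mono: "runs W p \<sigma> t Q \<Longrightarrow> t \<le> t' \<Longrightarrow> (\<And>\<sigma>'. Q \<sigma>' \<Longrightarrow> Q' \<sigma>') \<Longrightarrow> runs W p \<sigma> t' Q'"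
  unfolding runs_def by (meson order_trans)

lemma runs_Skip [simp]: "runs W Skip \<sigma> t Q \<longleftrightarrow> 1 \<le> t \<and> Q \<sigma>"
  by (auto elim!: runsE exec_SkipE intro: runsI[OF exec_Skip])

lemma runs_NAssign [simp]:
  "runs W (NAssign x i e) \<sigma> t Q \<longleftrightarrow> nfits W \<sigma> i \<and> nfits W \<sigma> e \<and> 1 + ncost i + ncost e \<le> t \<and>
     Q (nupdate \<sigma> x (nval \<sigma> i) (nval \<sigma> e))"
    (is "?L \<longleftrightarrow> ?A")
proof
  assume ?L
  then obtain \<tau> \<sigma>' where 1: "exec W (NAssign x i e) \<sigma> \<tau> \<sigma>'" "\<tau> \<le> t" "Q \<sigma>'" by (rule runsE)
  from 1(1) show ?A by (rule exec_NAssignE) (use 1(2,3) in simp)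
next
  assume ?A
  then show ?L by (intro runsI[OF exec_NAssign]) simp_all
qed

lemma runs_RAssign [simp]:
  "runs W (RAssign x i e) \<sigma> t Q \<longleftrightarrow> nfits W \<sigma> i \<and> rfits W \<sigma> e \<and> 1 + ncost i + rcost e \<le> t \<and>
     Q (rupdate \<sigma> x (nval \<sigma> i) (rval \<sigma> e))"
    (is "?L \<longleftrightarrow> ?A")
proof
  assume ?L
  then obtain \<tau> \<sigma>' where 1: "exec W (RAssign x i e) \<sigma> \<tau> \<sigma>'" "\<tau> \<le> t" "Q \<sigma>'" by (rule runsE)
  from 1(1) show ?A by (rule exec_RAssignE) (use 1(2,3) in simp)
next
  assume ?A
  then show ?L by (intro runsI[OF exec_RAssign]) simp_all
qed

lemma runs_Seq:
  assumes "runs W p \<sigma> u R" and "\<And>\<sigma>'. R \<sigma>' \<Longrightarrow> runs W q \<sigma>' v Q" and "u + v \<le> t"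
  shows "runs W (Seq p q) \<sigma> t Q"
proof -
  obtain \<tau> \<sigma>' where 1: "exec W p \<sigma> \<tau> \<sigma>'" "\<tau> \<le> u" "R \<sigma>'"
    using assms(1) unfolding runs_def by blast
  obtain \<tau>' \<sigma>'' where 2: "exec W q \<sigma>' \<tau>' \<sigma>''" "\<tau>' \<le> v" "Q \<sigma>''"
    using assms(2)[OF 1(3)] unfolding runs_def by blast
  show ?thesis
    unfolding runs_def using exec_Seq[OF 1(1) 2(1)] 1(2) 2(2,3) assms(3)
    by (intro exI[of _ "\<tau> + \<tau>'"] exI[of _ \<sigma>'']) simp
qed

lemma runs_Seq_exact: "runs W p \<sigma> u (\<lambda>s. s = \<sigma>') \<Longrightarrow> runs W q \<sigma>' v Q \<Longrightarrow> u + v \<le> t \<Longrightarrow> runs W (Seq p q) \<sigma> t Q"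
  by (rule runs_Seq[where R = "\<lambda>s. s = \<sigma>'"]) simp_all

lemma runs_SeqE:
  assumes "runs W (Seq p q) \<sigma> t Q"
  obtains u v \<sigma>' where "runs W p \<sigma> u (\<lambda>s. s = \<sigma>')" and "runs W q \<sigma>' v Q" and "u + v \<le> t"
proof -
  obtain \<tau> \<sigma>'' where 1: "exec W (Seq p q) \<sigma> \<tau> \<sigma>''" "\<tau> \<le> t" "Q \<sigma>''"
    using assms by (rule runsE)
  from 1(1) show ?thesis
  proof (rule exec_SeqE)
    fix u \<sigma>' v
    assume 2: "\<tau> = u + v" "exec W p \<sigma> u \<sigma>'" "exec W q \<sigma>' v \<sigma>''"
    show ?thesis
      by (rule that[OF runsI[OF 2(2)] runsI[where \<tau> = v, OF 2(3)]]) (use 1 2 in simp_all)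
  qed
qed

lemma runs_later:
  assumes "runs W q \<sigma> v Q" "u + v \<le> t" "c \<le> u" shows "runs W q \<sigma> (t - c) Q"
  using assms by (elim runs_mono) auto

text \<open>An equivalence, so that straight-line code is evaluated symbolically: the store becomes
  a term of updates and \<open>t\<close> the remaining budget. The truncated difference is guarded
  by the cost being at most \<open>t\<close>.\<close>

lemma runs_Seq_NAssign [simp]:
  "runs W (Seq (NAssign x i e) q) \<sigma> t Q \<longleftrightarrow>
     nfits W \<sigma> i \<and> nfits W \<sigma> e \<and> 1 + ncost i + ncost e \<le> t \<and>
     runs W q (nupdate \<sigma> x (nval \<sigma> i) (nval \<sigma> e)) (t - (1 + ncost i + ncost e)) Q"
    (is "?L \<longleftrightarrow> ?A")
proof
  assume ?L
  then show ?A by (rule runs_SeqE) (auto intro: runs_later)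
next
  assume ?A
  then show ?L
    by (intro runs_Seq_exact[where u = "1 + ncost i + ncost e" and v = "t - (1 + ncost i + ncost e)"
      and \<sigma>' = "nupdate \<sigma> x (nval \<sigma> i) (nval \<sigma> e)"]) simp_all
qed

lemma runs_Seq_RAssign [simp]:
  "runs W (Seq (RAssign x i e) q) \<sigma> t Q \<longleftrightarrow>
     nfits W \<sigma> i \<and> rfits W \<sigma> e \<and> 1 + ncost i + rcost e \<le> t \<and>
     runs W q (rupdate \<sigma> x (nval \<sigma> i) (rval \<sigma> e)) (t - (1 + ncost i + rcost e)) Q"
    (is "?L \<longleftrightarrow> ?A")
proof
  assume ?L
  then show ?A by (rule runs_SeqE) (auto intro: runs_later)
next
  assume ?A
  then show ?L
    by (intro runs_Seq_exact[where u = "1 + ncost i + rcost e" and v = "t - (1 + ncost i + rcost e)"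
      and \<sigma>' = "rupdate \<sigma> x (nval \<sigma> i) (rval \<sigma> e)"]) simp_all
qed

text \<open>Right association brings the first assignment of a nested sequence to the front, where
  the two preceding rules apply.\<close>

lemma runs_Seq_Seq [simp]: "runs W (Seq (Seq p q) r) \<sigma> t Q \<longleftrightarrow> runs W (Seq p (Seq q r)) \<sigma> t Q"
    (is "?L \<longleftrightarrow> ?A")
proof
  assume ?L
  then show ?A
  proof (rule runs_SeqE)
    fix u v \<sigma>' assume 1: "runs W (Seq p q) \<sigma> u (\<lambda>s. s = \<sigma>')" "runs W r \<sigma>' v Q" "u + v \<le> t"
    from 1(1) show ?A
    proof (rule runs_SeqE)
      fix v' w \<sigma>'' assume 2: "runs W p \<sigma> v' (\<lambda>s. s = \<sigma>'')" "runs W q \<sigma>'' w (\<lambda>s. s = \<sigma>')" "v' + w \<le> u"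
      show ?A
        by (rule runs_Seq_exact[OF 2(1) runs_Seq_exact[OF 2(2) 1(2) order_refl]]) (use 1(3) 2(3) in simp)
    qed
  qed
next
  assume ?A
  then show ?L
  proof (rule runs_SeqE)
    fix u w \<sigma>' assume 1: "runs W p \<sigma> u (\<lambda>s. s = \<sigma>')" "runs W (Seq q r) \<sigma>' w Q" "u + w \<le> t"
    from 1(2) show ?L
    proof (rule runs_SeqE)
      fix v v' \<sigma>'' assume 2: "runs W q \<sigma>' v (\<lambda>s. s = \<sigma>'')" "runs W r \<sigma>'' v' Q" "v + v' \<le> w"
      show ?L
        by (rule runs_Seq_exact[OF runs_Seq_exact[OF 1(1) 2(1) order_refl] 2(2)]) (use 1(3) 2(3) in simp)
    qed
  qed
qed

lemma runs_Cond [simp]: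
  "runs W (Cond c p q) \<sigma> t Q \<longleftrightarrow> bfits W \<sigma> c \<and> 1 + bcost c \<le> t \<and>
     runs W (if bval \<sigma> c then p else q) \<sigma> (t - (1 + bcost c)) Q" (is "?L \<longleftrightarrow> ?A")
proof
  assume ?L
  then obtain \<tau> \<sigma>' where 1: "exec W (Cond c p q) \<sigma> \<tau> \<sigma>'" "\<tau> \<le> t" "Q \<sigma>'" by (rule runsE)
  from 1(1) show ?A
  proof (rule exec_CondE)
    fix u assume "\<tau> = Suc (bcost c + u)" "bfits W \<sigma> c" "bval \<sigma> c" "exec W p \<sigma> u \<sigma>'"
    then show ?A using runsI[of W p \<sigma> u \<sigma>' "t - (1 + bcost c)" Q] 1 by simp
  next
    fix u assume "\<tau> = Suc (bcost c + u)" "bfits W \<sigma> c" "\<not> bval \<sigma> c" "exec W q \<sigma> u \<sigma>'"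
    then show ?A using runsI[of W q \<sigma> u \<sigma>' "t - (1 + bcost c)" Q] 1 by simp
  qed
next
  assume A: ?A
  then obtain \<tau> \<sigma>' where 1: "exec W (if bval \<sigma> c then p else q) \<sigma> \<tau> \<sigma>'"
    "\<tau> \<le> t - (1 + bcost c)" "Q \<sigma>'" by (elim conjE runsE)
  have "exec W (Cond c p q) \<sigma> (1 + bcost c + \<tau>) \<sigma>'"
    using A 1(1) exec_Cond_True[of W \<sigma> c p \<tau> \<sigma>'] exec_Cond_False[of W \<sigma> c q \<tau> \<sigma>']
    by (cases "bval \<sigma> c") simp_all
  then show ?L by (rule runsI) (use A 1 in auto)
qed

text \<open>
  The natural number in the invariant is a potential that pays for the remaining iterations and
  thus also proves termination.
\<close>

lemma runs_Loop:
  assumes I: "I t \<sigma>"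
    and fits: "\<And>t \<sigma>. I t \<sigma> \<Longrightarrow> bfits W \<sigma> c"
    and step: "\<And>t \<sigma>. I t \<sigma> \<Longrightarrow> bval \<sigma> c \<Longrightarrow>
      \<exists>u t'. runs W p \<sigma> u (I t') \<and> 1 + bcost c + u + t' \<le> t"
    and exit: "\<And>t \<sigma>. I t \<sigma> \<Longrightarrow> \<not> bval \<sigma> c \<Longrightarrow> 1 + bcost c \<le> t \<and> Q \<sigma>"
  shows "runs W (Loop c p) \<sigma> t Q"
  using I
proof (induction t arbitrary: \<sigma> rule: less_induct)
  case (less t)
  show ?case
  proof (cases "bval \<sigma> c")
    case True
    then obtain u t' where ut: "runs W p \<sigma> u (I t')" "1 + bcost c + u + t' \<le> t"
      using step[OF less.prems] by blast
    then obtain \<tau> \<sigma>' where 1: "exec W p \<sigma> \<tau> \<sigma>'" "\<tau> \<le> u" "I t' \<sigma>'" unfolding runs_def by blast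
    then obtain \<tau>' \<sigma>'' where 2: "exec W (Loop c p) \<sigma>' \<tau>' \<sigma>''" "\<tau>' \<le> t'" "Q \<sigma>''"
      using less.IH[of t' \<sigma>'] ut(2) unfolding runs_def by auto
    have "exec W (Loop c p) \<sigma> (1 + bcost c + \<tau> + \<tau>') \<sigma>''"
      by (rule exec_Loop_True[OF fits[OF less.prems] True 1(1) 2(1)])
    moreover have "1 + bcost c + \<tau> + \<tau>' \<le> t" using 1 2 ut by linarith
    ultimately show ?thesis using 2(3) unfolding runs_def by blast
  next
    case False
    then show ?thesis
      using exit[OF less.prems] exec_Loop_False[OF fits[OF less.prems]] unfolding runs_def by blast
  qed
qed

lemma fst_nupdate [simp]: "fst (nupdate \<sigma> x i v) = (fst \<sigma>)(x := (fst \<sigma> x)(i := v))"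
  and snd_nupdate [simp]: "snd (nupdate \<sigma> x i v) = snd \<sigma>"
  and fst_rupdate [simp]: "fst (rupdate \<sigma> x i r) = fst \<sigma>"
  and snd_rupdate [simp]: "snd (rupdate \<sigma> x i r) = (snd \<sigma>)(x := (snd \<sigma> x)(i := r))"
  by (simp_all add: nupdate_def rupdate_def)


section \<open>Greedy walks decide s-reachability\<close>

text \<open>Node \<open>x\<close> encodes the position \<open>position_of n x\<close>;
  \<open>n * n\<close> and \<open>n * n + 1\<close> are the outcomes success and failure. Once a row
  has a valid position, the walk keeps the index in \<open>A\<close> and enters the next row. In the
  last row only the final position matters, so the walk just moves on.\<close>

definition next_valid :: "nat \<Rightarrow> nat \<Rightarrow> nat" where
  "next_valid n x = (if x = n * n - 1 then n * n else if n * (n - 1) \<le> x then x + 1 else x + n)"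

text \<open>Failure has three causes: the start and the end must themselves be valid, and a row
  before the last one must not run out of indices. Inside the last row the step is the same as in
  \<open>next_valid\<close>, because validity is irrelevant there before the end.\<close>

definition next_invalid :: "nat \<Rightarrow> nat \<Rightarrow> nat" where
  "next_invalid n x = (if x = 0 \<or> x = n * n - 1 then n * n + 1 else if n * (n - 1) \<le> x then x + 1
     else if x mod n = n - 1 then n * n + 1 else x + 1)"

definition position_of :: "nat \<Rightarrow> nat \<Rightarrow> position" where
  "position_of n x = (x mod n + 1, x div n + 1)"

lemma next_valid_bounds: "x < n * n \<Longrightarrow> x < next_valid n x \<and> next_valid n x \<le> n * n + 1"
proof -
  assume x: "x < n * n"
  have "x + n \<le> n * n" if "x < n * (n - 1)"
    using that by (cases n) (auto simp: algebra_simps)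
  with x show ?thesis by (cases n) (auto simp: next_valid_def not_le)
qed

lemma next_invalid_bounds: "x < n * n \<Longrightarrow> x < next_invalid n x \<and> next_invalid n x \<le> n * n + 1"
  by (auto simp: next_invalid_def)

function walk :: "nat \<Rightarrow> (nat \<Rightarrow> bool) \<Rightarrow> nat \<Rightarrow> nat" where
  "walk n f x = (if n * n \<le> x then x else walk n f (if f x then next_valid n x else next_invalid n x))"
  by auto
termination
proof (relation "Wellfounded.measure (\<lambda>(n, f, x). n * n - x)")
  show "((n, f, if f x then next_valid n x else next_invalid n x), n, f, x)
      \<in> Wellfounded.measure (\<lambda>(n, f, x). n * n - x)" if "\<not> n * n \<le> x" for n f x
    using that next_valid_bounds[of x n] next_invalid_bounds[of x n] by auto
qed simp

declare walk.simps [simp del]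

lemma walk_terminal: "n * n \<le> x \<Longrightarrow> walk n f x = x"
  by (simp add: walk.simps)

lemma walk_step: "x < n * n \<Longrightarrow> walk n f x = walk n f (if f x then next_valid n x else next_invalid n x)"
  by (subst walk.simps) simp

lemma pverts_position_graph [simp]: "pverts (position_graph n) = {1..n} \<times> {1..n}"
  by (simp add: position_graph_def)

lemma parcs_position_graph:
  "((i, j), (i', j')) \<in> parcs (position_graph n) \<longleftrightarrow> {i, j, i', j'} \<subseteq> {1..n} \<and>
       ((i', j') = (i + 1, j) \<or> (i', j') = (i, j + 1) \<or> (i', j') = (i + 1, j + 1))"
  by (auto simp: position_graph_def)

lemma div_last_row:
  fixes n x :: nat
  assumes "x < n * n"
  shows "n * (n - 1) \<le> x \<longleftrightarrow> x div n = n - 1" and "x = n * n - 1 \<longleftrightarrow> x div n = n - 1 \<and> x mod n = n - 1"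
proof -
  have n: "0 < n" using assms by (cases n) auto
  have x: "x = n * (x div n) + x mod n" by simp
  have less: "x div n < n" using assms by (simp add: less_mult_imp_div_less)
  show 1: "n * (n - 1) \<le> x \<longleftrightarrow> x div n = n - 1"
    using less n by (metis Suc_pred' div_le_mono le_antisym less_Suc_eq_le nonzero_mult_div_cancel_left not_gr_zero
        times_div_less_eq_dividend)
  have sq: "n * n - 1 = n * (n - 1) + (n - 1)"
    using n by (cases n) simp_all
  show "x = n * n - 1 \<longleftrightarrow> x div n = n - 1 \<and> x mod n = n - 1"
    using n x by (metis sq 1 div_mult_self4 div_less mod_mult_self4 mod_less diff_less add_0_left
        less_numeral_extra(1) mult.commute add.commute div_mult_self2 gr_implies_not0 mod_mult_self2)
qed

lemma div_mod_Suc_same_row: "(x::nat) mod n + 1 < n \<Longrightarrow> (x + 1) div n = x div n \<and> (x + 1) mod n = x mod n + 1"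
  by (simp add: div_Suc mod_Suc)

lemma next_valid_arc:
  assumes "x < n * n" "x \<noteq> n * n - 1"
  shows "next_valid n x < n * n"
    and "(position_of n x, position_of n (next_valid n x)) \<in> arcs_ends (with_proj (position_graph n))"
proof -
  have n: "0 < n" using assms by (cases n) auto
  have d: "x div n < n" "x mod n < n" using assms n by (simp_all add: less_mult_imp_div_less)
  have "x + n < n * n" if "x div n \<noteq> n - 1"
  proof -
    have "(x + n) div n < n" using d n that by simp
    then show ?thesis using n by (metis div_less_iff_less_mult)
  qed
  moreover have "Suc (x mod n) \<le> n" by (rule Suc_leI[OF d(2)])
  moreover have "x mod n + 1 < n" if "x div n = n - 1"
    using that d assms div_last_row(2)[OF assms(1)] by linarith
  ultimately show "next_valid n x < n * n"
      "(position_of n x, position_of n (next_valid n x)) \<in> arcs_ends (with_proj (position_graph n))"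
    using assms d n div_last_row[OF assms(1)] div_mod_Suc_same_row[of x n]
    by (auto simp: next_valid_def parcs_position_graph position_of_def Suc_le_eq)
qed

lemma next_invalid_arc:
  assumes "x < n * n" "next_invalid n x < n * n"
  shows "(position_of n x, position_of n (next_invalid n x)) \<in> arcs_ends (with_proj (position_graph n))"
    and "next_invalid n x div n = x div n"
proof -
  have n: "0 < n" using assms by (cases n) auto
  have d: "x div n < n" "x mod n < n" using assms n by (simp_all add: less_mult_imp_div_less)
  have "next_invalid n x = x + 1" and "x mod n \<noteq> n - 1"
    using assms(2) div_last_row[OF assms(1)] by (auto simp: next_invalid_def split: if_splits)
  moreover from this have "x mod n + 1 < n" using d by linarith
  ultimately show "(position_of n x, position_of n (next_invalid n x)) \<in> arcs_ends (with_proj (position_graph n))"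
      "next_invalid n x div n = x div n"
    using d div_mod_Suc_same_row[of x n]
    by (auto simp: parcs_position_graph position_of_def)
qed

text \<open>Arcs never decrease an index and change at least one. This makes every walk a
  \<open>vpath\<close> and orders the positions that a path has in successive rows.\<close>

lemma vwalk_position_graph_monotone:
  assumes "vwalk P (with_proj (position_graph n))"
  shows "sorted_wrt (\<lambda>u v. fst u \<le> fst v \<and> snd u \<le> snd v \<and> u \<noteq> v) P"
  using assms
proof (induction P rule: vwalk_arcs.induct)
  case (3 x y xs)
  then have yxs: "vwalk (y # xs) (with_proj (position_graph n))" by (auto simp: vwalk_def)
  have "fst x \<le> fst y \<and> snd x \<le> snd y \<and> x \<noteq> y"
    using 3(2) unfolding vwalk_def
    by (cases x, cases y) (auto simp: parcs_position_graph)
  with 3(1)[OF yxs] show ?case by (fastforce simp: prod_eq_iff)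
qed auto

text \<open>The trajectory of the walk is the path: each of its steps inside the grid is an arc, and
  a row before the last is left only from a valid position.\<close>

lemma walk_path:
  assumes "x < n * n" "walk n f x = n * n"
  shows "\<exists>P. vwalk P (with_proj (position_graph n)) \<and> hd P = position_of n x \<and> last P = (n, n) \<and>
    f (n * n - 1) \<and> (\<forall>l\<in>{x div n..<n - 1}. \<exists>k<n. (k + 1, l + 1) \<in> set P \<and> f (l * n + k))"
  using assms
proof (induction "n * n - x" arbitrary: x rule: less_induct)
  case less
  have n: "0 < n" using less.prems by (cases n) auto
  have d: "x div n < n" "x mod n < n" using less.prems n by (simp_all add: less_mult_imp_div_less)
  define y where "y = (if f x then next_valid n x else next_invalid n x)"
  have y: "x < y" "walk n f y = n * n"
    using less.prems walk_step[of x n f] next_valid_bounds[of x n] next_invalid_bounds[of x n]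
    by (auto simp: y_def)
  show ?case
  proof (cases "x = n * n - 1")
    case True
    have "f x"
    proof (rule ccontr)
      assume "\<not> f x"
      then have "y = n * n + 1" using True by (simp add: y_def next_invalid_def)
      then show False using y(2) by (simp add: walk_terminal)
    qed
    then show ?thesis
      using True div_last_row[OF less.prems(1)] n
      by (intro exI[of _ "[position_of n x]"]) (auto simp: vwalk_def position_of_def)
  next
    case False
    have ylt: "y < n * n"
    proof (rule ccontr)
      assume "\<not> y < n * n"
      then have "y = n * n" using y walk_terminal[of n y f] by simp
      then show False
        using False less.prems next_valid_arc(1)[of x n]
        by (auto simp: y_def next_invalid_def split: if_splits)
    qed
    have arc: "(position_of n x, position_of n y) \<in> arcs_ends (with_proj (position_graph n))"
      using ylt False less.prems next_valid_arc[of x n] next_invalid_arc[of x n] by (auto simp: y_def)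
    have closer: "n * n - y < n * n - x" using y(1) ylt by linarith
    obtain P where P: "vwalk P (with_proj (position_graph n))" "hd P = position_of n y" "last P = (n, n)"
      "f (n * n - 1)" "\<And>l. l\<in>{y div n..<n - 1} \<Longrightarrow> \<exists>k<n. (k + 1, l + 1) \<in> set P \<and> f (l * n + k)"
      using less.hyps[OF closer ylt y(2)] by blast
    have P0: "P \<noteq> []" using P(1) by auto
    have x: "position_of n x \<in> {1..n} \<times> {1..n}" using d by (auto simp: position_of_def Suc_le_eq)
    have walk: "vwalk (position_of n x # P) (with_proj (position_graph n))"
      using P(1,2) arc x by (intro vwalk_consI) auto
    have "\<exists>k<n. (k + 1, l + 1) \<in> set (position_of n x # P) \<and> f (l * n + k)" if l: "l \<in> {x div n..<n - 1}" for l
    proof (cases "l \<in> {y div n..<n - 1}")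
      case True
      then show ?thesis using P(5) by fastforce
    next
      case False
      \<comment> \<open>The present step leaves this row, which it would not do from an invalid
        position.\<close>
      then have "l < y div n" "\<not> n * (n - 1) \<le> x" using l div_last_row[OF less.prems(1)] by auto
      then have "f x" "l = x div n"
        using l next_invalid_arc(2)[of x n] less.prems ylt n
        by (auto simp: y_def next_valid_def split: if_splits)
      then show ?thesis using d by (intro exI[of _ "x mod n"]) (auto simp: position_of_def)
    qed
    with walk P P0 show ?thesis by (intro exI[of _ "position_of n x # P"]) auto
  qed
qed

text \<open>The greedy argument: \<open>h\<close> selects a valid position in every row, with
  nondecreasing indices. The walk is never to the right of \<open>h\<close> in its current row,
  because it leaves the row at \<open>h\<close> at the latest, and going down preserves this; so it
  cannot run out of a row.\<close>

lemma walk_chain: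
  assumes "x < n * n" and "x = 0 \<Longrightarrow> f 0"
    and "\<And>l. l \<in> {x div n..<n} \<Longrightarrow> h l < n \<and> f (l * n + h l)"
    and "\<And>l. l \<in> {x div n..<n - 1} \<Longrightarrow> h l \<le> h (Suc l)"
    and "h (n - 1) = n - 1" and "x mod n \<le> h (x div n)"
  shows "walk n f x = n * n"
  using assms
proof (induction "n * n - x" arbitrary: x rule: less_induct)
  case less
  have n: "0 < n" using less.prems by (cases n) auto
  have d: "x div n < n" "x mod n < n" using less.prems n by (simp_all add: less_mult_imp_div_less)
  have x: "x = x div n * n + x mod n" by simp
  show ?case
  proof (cases "x = n * n - 1")
    case True
    then have "f x" using less.prems(3)[of "n - 1"] less.prems(5) div_last_row[OF less.prems(1)] n x
      by (metis atLeastLessThan_iff d(1) order_refl)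
    then show ?thesis
      unfolding walk_step[OF less.prems(1)] using True by (simp add: next_valid_def walk_terminal)
  next
    case False
    show ?thesis
    proof (cases "f x \<and> x div n \<noteq> n - 1")
      case True
      then have eq: "walk n f x = walk n f (x + n)"
        using less.prems(1) False div_last_row[OF less.prems(1)] by (simp add: walk_step[OF less.prems(1)] next_valid_def)
      have lt: "x + n < n * n"
        using next_valid_arc(1)[OF less.prems(1) False] True div_last_row[OF less.prems(1)] False
        by (simp add: next_valid_def)
      have dm: "(x + n) div n = Suc (x div n)" "(x + n) mod n = x mod n" using n by simp_all
      have "x mod n \<le> h (Suc (x div n))"
        using less.prems(4)[of "x div n"] less.prems(6) d True by force
      then have le: "(x + n) mod n \<le> h ((x + n) div n)" by (simp only: dm)
      show ?thesis
        unfolding eq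
      proof (rule less.hyps[OF _ lt _ _ _ less.prems(5) le])
        show "n * n - (x + n) < n * n - x" using lt n by linarith
        show "x + n = 0 \<Longrightarrow> f 0" using n by simp
        show "h l < n \<and> f (l * n + h l)" if "l \<in> {(x + n) div n..<n}" for l
          by (rule less.prems(3)) (use that n in \<open>auto simp: dm\<close>)
        show "h l \<le> h (Suc l)" if "l \<in> {(x + n) div n..<n - 1}" for l
          by (rule less.prems(4)) (use that n in \<open>auto simp: dm\<close>)
      qed
    next
      case False2: False
      have lt: "x mod n + 1 < n"
      proof (cases "x div n = n - 1")
        case True
        then show ?thesis using d div_last_row(2)[OF less.prems(1)] False by linarith
      next
        case False
        then have "\<not> f x" using False2 by simp
        then have "x mod n \<noteq> h (x div n)" using less.prems(3)[of "x div n"] d x by force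
        then show ?thesis using less.prems(3)[of "x div n"] less.prems(6) d by force
      qed
      have le: "x mod n + 1 \<le> h (x div n)"
      proof (cases "x div n = n - 1")
        case True
        then show ?thesis using lt less.prems(5) by simp
      next
        case False
        then have "\<not> f x" using False2 by simp
        then have "x mod n \<noteq> h (x div n)" using less.prems(3)[of "x div n"] d x by force
        then show ?thesis using less.prems(6) by simp
      qed
      have eq: "walk n f x = walk n f (x + 1)"
      proof (cases "f x")
        case True
        then show ?thesis
          using less.prems(1) False False2 div_last_row[OF less.prems(1)] by (simp add: walk_step[OF less.prems(1)] next_valid_def)
      next
        case fx: False
        then have "x \<noteq> 0" using less.prems(2) by (cases "x = 0") auto
        then show ?thesis using fx less.prems(1) False lt by (simp add: walk_step[OF less.prems(1)] next_invalid_def)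
      qed
      have x1: "x + 1 < n * n" using less.prems(1) False by linarith
      note dm = div_mod_Suc_same_row[OF lt]
      then have le: "(x + 1) mod n \<le> h ((x + 1) div n)" using le by metis
      show ?thesis
        unfolding eq
      proof (rule less.hyps[OF _ x1 _ _ _ less.prems(5) le])
        show "n * n - (x + 1) < n * n - x" using x1 by linarith
        show "h l < n \<and> f (l * n + h l)" if "l \<in> {(x + 1) div n..<n}" for l
          by (rule less.prems(3)) (use that in \<open>simp only: dm\<close>)
        show "h l \<le> h (Suc l)" if "l \<in> {(x + 1) div n..<n - 1}" for l
          by (rule less.prems(4)) (use that in \<open>simp only: dm\<close>)
      qed simp
    qed
  qed
qed

lemma s_reachable_iff_walk:
  assumes "1 \<le> n"
  shows "s_reachable n g (n, n) \<longleftrightarrow> walk n (\<lambda>x. g (position_of n x) = 1) 0 = n * n"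
    (is "_ \<longleftrightarrow> walk n ?f 0 = _")
proof
  assume w: "walk n ?f 0 = n * n"
  have 0: "(0::nat) < n * n" using assms by simp
  have "?f 0"
    using w by (rule contrapos_pp) (use 0 in \<open>simp add: walk_step[OF 0] next_invalid_def walk_terminal\<close>)
  moreover obtain P where P: "vwalk P (with_proj (position_graph n))" "hd P = position_of n 0" "last P = (n, n)"
      "?f (n * n - 1)" "\<And>l. l \<in> {0 div n..<n - 1} \<Longrightarrow> \<exists>k<n. (k + 1, l + 1) \<in> set P \<and> ?f (l * n + k)"
    using walk_path[OF 0 w] by blast
  moreover have "position_of n (n * n - 1) = (n, n)" "position_of n 0 = (1, 1)"
    using div_last_row(2)[of "n * n - 1" n] 0 assms by (simp_all add: position_of_def)
  moreover have "distinct P"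
    using vwalk_position_graph_monotone[OF P(1)] by (simp add: distinct_conv_nth sorted_wrt_iff_nth_less)
      (metis linorder_neqE_nat)
  moreover have "\<exists>k. (k, l) \<in> set P \<and> g (k, l) = 1" if "1 < l" "l < n" for l
  proof -
    have "l - 1 \<in> {0 div n..<n - 1}" "l - 1 + 1 = l" using that by auto
    then obtain k where "k < n" "(k + 1, l) \<in> set P" "g (position_of n ((l - 1) * n + k)) = 1"
      using P(5)[of "l - 1"] by metis
    moreover have "position_of n ((l - 1) * n + k) = (k + 1, l)"
      using \<open>k < n\<close> that by (simp add: position_of_def)
    ultimately show ?thesis by metis
  qed
  ultimately show "s_reachable n g (n, n)"
    unfolding s_reachable_def vpath_def by auto
next
  assume "s_reachable n g (n, n)"
  then obtain P where P: "vwalk P (with_proj (position_graph n))" "hd P = (1, 1)" "last P = (n, n)"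
      "g (1, 1) = 1" "g (n, n) = 1" "\<And>l. 1 < l \<Longrightarrow> l < n \<Longrightarrow> \<exists>k. (k, l) \<in> set P \<and> g (k, l) = 1"
    unfolding s_reachable_def vpath_def by auto
  have P0: "P \<noteq> []" and sub: "set P \<subseteq> {1..n} \<times> {1..n}" using P(1) by (auto simp: vwalk_def)
  have ends: "(1, 1) \<in> set P" "(n, n) \<in> set P" using P(2,3) P0 by (metis hd_in_set, metis last_in_set)
  \<comment> \<open>The definition asks for no witness in the first and the last row; there the
    valid end points of \<open>P\<close> serve.\<close>
  have "\<forall>l. 1 \<le> l \<and> l \<le> n \<longrightarrow> (\<exists>k. (k, l) \<in> set P \<and> g (k, l) = 1 \<and> (l = n \<longrightarrow> k = n))"
    using P(4-6) ends by (metis le_neq_implies_less)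
  then obtain h where h: "\<And>l. 1 \<le> l \<Longrightarrow> l \<le> n \<Longrightarrow> (h l, l) \<in> set P \<and> g (h l, l) = 1 \<and> (l = n \<longrightarrow> h l = n)"
    by metis
  have mono: "h l \<le> h (Suc l)" if "1 \<le> l" "Suc l \<le> n" for l
  proof -
    have "(h l, l) \<in> set P" "(h (Suc l), Suc l) \<in> set P" using h that by auto
    then obtain i j where ij: "i < length P" "j < length P" "P ! i = (h l, l)" "P ! j = (h (Suc l), Suc l)"
      by (metis in_set_conv_nth)
    have sorted: "fst (P ! i) \<le> fst (P ! j) \<and> snd (P ! i) \<le> snd (P ! j)" if "i < j" "j < length P" for i j
      using vwalk_position_graph_monotone[OF P(1)] that by (simp add: sorted_wrt_iff_nth_less)
    have "i < j" using sorted[of j i] ij by (metis linorder_neqE_nat Suc_n_not_le_n snd_conv n_not_Suc_n)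
    then show ?thesis using sorted[of i j] ij by simp
  qed
  have pos: "position_of n (l * n + (h (Suc l) - 1)) = (h (Suc l), Suc l)" "1 \<le> h (Suc l)" "h (Suc l) \<le> n"
    if "l < n" for l
  proof -
    show "1 \<le> h (Suc l)" "h (Suc l) \<le> n" using h[of "Suc l"] that sub by auto
    then have "h (Suc l) - 1 < n" by linarith
    then show "position_of n (l * n + (h (Suc l) - 1)) = (h (Suc l), Suc l)"
      using \<open>1 \<le> h (Suc l)\<close> by (cases "h (Suc l)") (simp_all add: position_of_def)
  qed
  show "walk n ?f 0 = n * n"
  proof (rule walk_chain[where h = "\<lambda>l. h (Suc l) - 1"])
    show "?f 0" using P(4) by (simp add: position_of_def)
    show "h (Suc l) - 1 < n \<and> ?f (l * n + (h (Suc l) - 1))" if "l \<in> {0 div n..<n}" for l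
      using that pos[of l] h[of "Suc l"] by auto
    show "h (Suc l) - 1 \<le> h (Suc (Suc l)) - 1" if "l \<in> {0 div n..<n - 1}" for l
      using that by (intro diff_le_mono mono) auto
    show "h (Suc (n - 1)) - 1 = n - 1" using h[of n] assms by simp
  qed (use assms in simp_all)
qed

text \<open>A larger \<open>f'\<close> gives a different trajectory, so the two walks cannot be
  compared step by step. The path found for \<open>f\<close> is still a witness for
  \<open>f'\<close>; hence the detour through \<open>s_reachable\<close>, with \<open>f\<close>
  turned into an indicator on positions.\<close>

lemma walk_mono:
  assumes "1 \<le> n" "walk n f 0 = n * n" "\<And>x. f x \<Longrightarrow> f' x"
  shows "walk n f' 0 = n * n"
proof -
  define g where "g f = (\<lambda>(i, j). if f ((j - 1) * n + (i - 1)) then 1 else 0 :: nat)"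
    for f :: "nat \<Rightarrow> bool"
  have g: "(\<lambda>x. g f (position_of n x) = 1) = f" for f
  proof (rule ext)
    fix x
    have "g f (position_of n x) = (if f (x div n * n + x mod n) then 1 else 0)"
      unfolding g_def position_of_def case_prod_conv add_diff_cancel_right' ..
    also have "x div n * n + x mod n = x" by (rule div_mult_mod_eq)
    finally show "(g f (position_of n x) = 1) = f x" by simp
  qed
  have g_eq: "g f (i, j) = 1 \<longleftrightarrow> f ((j - 1) * n + (i - 1))" for f i j
    unfolding g_def case_prod_conv by (cases "f ((j - 1) * n + (i - 1))") simp_all
  have imp: "g f' (i, j) = 1" if "g f (i, j) = 1" for i j
    using that unfolding g_eq by (rule assms(3))
  have "s_reachable n (g f) (n, n)"
    unfolding s_reachable_iff_walk[OF assms(1)] g by (rule assms(2))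
  then obtain P where P: "vpath P (with_proj (position_graph n)) \<and> hd P = (1, 1) \<and> last P = (n, n) \<and>
      g f (1, 1) = 1 \<and> g f (n, n) = 1 \<and> (\<forall>l. 1 < l \<and> l < n \<longrightarrow> (\<exists>k. (k, l) \<in> set P \<and> g f (k, l) = 1))"
    unfolding s_reachable_def case_prod_conv by (elim exE that)
  have "s_reachable n (g f') (n, n)"
    unfolding s_reachable_def case_prod_conv
  proof (rule exI[of _ P], use P in \<open>elim conjE\<close>, intro conjI)
    assume *: "\<forall>l. 1 < l \<and> l < n \<longrightarrow> (\<exists>k. (k, l) \<in> set P \<and> g f (k, l) = 1)"
    show "\<forall>l. 1 < l \<and> l < n \<longrightarrow> (\<exists>k. (k, l) \<in> set P \<and> g f' (k, l) = 1)"
    proof (intro allI impI)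
      fix l assume "1 < l \<and> l < n"
      with * obtain k where "(k, l) \<in> set P" "g f (k, l) = 1" by blast
      then show "\<exists>k. (k, l) \<in> set P \<and> g f' (k, l) = 1" using imp by blast
    qed
  qed (assumption | erule imp)+
  then show ?thesis unfolding s_reachable_iff_walk[OF assms(1)] g .
qed


section \<open>Contraction of the walk graph\<close>

definition in_window :: "(nat \<Rightarrow> nat) \<Rightarrow> nat \<Rightarrow> nat \<Rightarrow> nat \<Rightarrow> bool" where
  "in_window rk p q x \<longleftrightarrow> p \<le> rk x \<and> rk x < q"

definition nodes :: "nat \<Rightarrow> (nat \<Rightarrow> nat) \<Rightarrow> nat \<Rightarrow> nat set" where
  "nodes n xs z = xs ` {..<z} \<union> {n * n, n * n + 1}"

text \<open>
  The list \<open>xs\<close> of length \<open>z\<close> with the successor functions \<open>V\<close> (of valid nodes) and \<open>I\<close> (of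
  invalid nodes) and the start node \<open>s\<close> gives the same walks as the whole grid, for all windows
  \<open>[p', q')\<close> with \<open>p' \<in> {p..p + K}\<close> and \<open>q' \<in> {q..q + K}\<close>. The list is descending since
  contraction goes against the direction of the walk.
\<close>

definition contracted ::
    "nat \<Rightarrow> (nat \<Rightarrow> nat) \<Rightarrow> nat \<Rightarrow> nat \<Rightarrow> nat \<Rightarrow> nat \<Rightarrow> (nat \<Rightarrow> nat) \<Rightarrow> (nat \<Rightarrow> nat) \<Rightarrow> (nat \<Rightarrow> nat) \<Rightarrow> nat \<Rightarrow> bool"
  where "contracted n rk p q K z xs V I s \<longleftrightarrow>
     (\<forall>i<z. xs i < n * n) \<and> (\<forall>i j. i < j \<and> j < z \<longrightarrow> xs j < xs i) \<and> s \<in> nodes n xs z \<and>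
     (\<forall>x\<in>xs ` {..<z}. V x \<in> nodes n xs z \<and> I x \<in> nodes n xs z \<and> x < V x \<and> x < I x) \<and>
     (\<forall>p'\<in>{p..p + K}. \<forall>q'\<in>{q..q + K}. let f = in_window rk p' q' in
        walk n f s = walk n f 0 \<and>
        (\<forall>x\<in>xs ` {..<z}. walk n f (if f x then V x else I x) = walk n f x))"

text \<open>This is how a graph ages: after some moves of the pointers it is still right for the
  present window, with fewer moves ahead.\<close>

lemma contracted_subrange:
  assumes "contracted n rk p q K z xs V I s"
    and "p \<le> p'" "p' + K' \<le> p + K" "q \<le> q'" "q' + K' \<le> q + K"
  shows "contracted n rk p' q' K' z xs V I s"
proof -
  have sub: "u \<in> {p..p + K}" "v \<in> {q..q + K}" if "u \<in> {p'..p' + K'}" "v \<in> {q'..q' + K'}" for u v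
    using that assms(2-) by auto
  show ?thesis
    unfolding contracted_def
  proof (insert assms(1)[unfolded contracted_def], elim conjE, intro conjI)
  qed (assumption | use sub in blast)+
qed

text \<open>Only the list entries below \<open>z\<close> and the successors of grid nodes count, so
  a graph survives changes in all other cells of the store.\<close>

lemma contracted_cong:
  assumes "contracted n rk p q K z xs V I s"
    and "\<And>i. i < z \<Longrightarrow> xs' i = xs i" "\<And>x. x < n * n \<Longrightarrow> V' x = V x \<and> I' x = I x"
  shows "contracted n rk p q K z xs' V' I' s"
proof -
  have img: "xs' ` {..<z} = xs ` {..<z}" using assms(2) by auto
  then have nodes: "nodes n xs' z = nodes n xs z" by (simp add: nodes_def)
  have VI: "V' x = V x" "I' x = I x" if "x \<in> xs ` {..<z}" for x
    using assms(1,3) that unfolding contracted_def by auto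
  have "walk n f (if f x then V' x else I' x) = walk n f (if f x then V x else I x)"
    if "x \<in> xs ` {..<z}" for f x
    using VI[OF that] by simp
  then show ?thesis
    using assms(1,2) VI unfolding contracted_def nodes img Let_def by (simp split del: if_split)
qed

text \<open>Nothing is contracted here, so the number \<open>K\<close> of moves is arbitrary and
  this graph never has to be rebuilt.\<close>

lemma contracted_full:
  assumes "0 < n"
  shows "contracted n rk p q K (n * n) (\<lambda>i. n * n - 1 - i) (next_valid n) (next_invalid n) 0"
proof -
  have img: "(\<lambda>i. n * n - 1 - i) ` {..<n * n} = {..<n * n}"
  proof (intro equalityI subsetI)
    fix x assume "x \<in> {..<n * n}"
    then show "x \<in> (\<lambda>i. n * n - 1 - i) ` {..<n * n}"
      by (intro image_eqI[of _ _ "n * n - 1 - x"]) auto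
  qed (use assms in auto)
  have nodes: "nodes n (\<lambda>i. n * n - 1 - i) (n * n) = {..n * n + 1}"
    unfolding nodes_def img by auto
  show ?thesis
    unfolding contracted_def nodes img Let_def
    using next_valid_bounds[of _ n] next_invalid_bounds[of _ n] assms
    by (auto simp: walk_step[symmetric])
qed

definition undecided :: "(nat \<Rightarrow> nat) \<Rightarrow> nat \<Rightarrow> nat \<Rightarrow> nat \<Rightarrow> nat \<Rightarrow> bool" where
  "undecided rk p q K x \<longleftrightarrow> p \<le> rk x \<and> rk x < p + K \<or> q \<le> rk x \<and> rk x < q + K"

text \<open>\<open>p' \<le> rk x\<close> can differ from \<open>p \<le> rk x\<close> only if
  \<open>rk x\<close> lies in \<open>{p..<p + K}\<close>, and similarly for
  \<open>q\<close>.\<close>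

lemma in_window_decided:
  assumes "\<not> undecided rk p q K x" "p' \<in> {p..p + K}" "q' \<in> {q..q + K}"
  shows "in_window rk p' q' x \<longleftrightarrow> in_window rk p q x"
  using assms by (auto simp: undecided_def in_window_def)

text \<open>
  State of the contraction of \<open>(xs, V, I)\<close> to \<open>(xs', V', I')\<close> after the first \<open>i\<close> nodes of \<open>xs\<close>;
  \<open>R x\<close> is the first undecided node on the walk from \<open>x\<close>.
\<close>

definition contracting ::
    "nat \<Rightarrow> (nat \<Rightarrow> nat) \<Rightarrow> nat \<Rightarrow> nat \<Rightarrow> nat \<Rightarrow> (nat \<Rightarrow> nat) \<Rightarrow> nat \<Rightarrow>
     nat \<Rightarrow> (nat \<Rightarrow> nat) \<Rightarrow> (nat \<Rightarrow> nat) \<Rightarrow> (nat \<Rightarrow> nat) \<Rightarrow> (nat \<Rightarrow> nat) \<Rightarrow> bool"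
  where "contracting n rk p q K xs i z xs' V' I' R \<longleftrightarrow>
     z \<le> i \<and> xs' ` {..<z} \<subseteq> {x \<in> xs ` {..<i}. undecided rk p q K x} \<and>
     (\<forall>i j. i < j \<and> j < z \<longrightarrow> xs' j < xs' i) \<and>
     R (n * n) = n * n \<and> R (n * n + 1) = n * n + 1 \<and>
     (\<forall>x\<in>xs ` {..<i}. x \<le> R x \<and> R x \<in> nodes n xs' z) \<and>
     (\<forall>x\<in>xs' ` {..<z}. V' x \<in> nodes n xs' z \<and> I' x \<in> nodes n xs' z \<and> x < V' x \<and> x < I' x) \<and>
     (\<forall>p'\<in>{p..p + K}. \<forall>q'\<in>{q..q + K}. let f = in_window rk p' q' in
        (\<forall>x\<in>xs ` {..<i}. walk n f (R x) = walk n f x) \<and>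
        (\<forall>x\<in>xs' ` {..<z}. walk n f (if f x then V' x else I' x) = walk n f x))"

lemma contracting_init:
  assumes "R (n * n) = n * n" "R (n * n + 1) = n * n + 1"
  shows "contracting n rk p q K xs 0 0 xs' V' I' R"
  using assms by (simp add: contracting_def)

text \<open>The list is descending, so a successor of \<open>xs i\<close> is terminal or occurs
  before index \<open>i\<close>; in both cases \<open>R\<close> is already known there.\<close>

lemma contracting_successor:
  assumes G: "contracted n rk p q K c xs V I s"
    and C: "contracting n rk p q K xs i z xs' V' I' R"
    and i: "i < c" and y: "y \<in> nodes n xs c" "xs i < y"
  shows "y \<le> R y \<and> R y \<in> nodes n xs' z \<and> y \<le> n * n + 1 \<and>
    (\<forall>p'\<in>{p..p + K}. \<forall>q'\<in>{q..q + K}. walk n (in_window rk p' q') (R y) = walk n (in_window rk p' q') y)"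
proof (cases "y \<in> {n * n, n * n + 1}")
  case True
  then show ?thesis using C by (auto simp: contracting_def nodes_def)
next
  case False
  then obtain k where k: "k < c" "y = xs k" using y by (auto simp: nodes_def)
  have "k < i"
  proof (rule ccontr)
    assume "\<not> k < i"
    then have "xs k \<le> xs i" using G k unfolding contracted_def by (metis linorder_neqE_nat less_imp_le order_refl)
    then show False using y k by simp
  qed
  then have "y \<in> xs ` {..<i}" using k by auto
  moreover have "y \<le> n * n + 1" using G k unfolding contracted_def by force
  ultimately show ?thesis using C unfolding contracting_def Let_def by blast
qed

text \<open>An undecided node is kept: it represents itself, and its two successors are replaced by
  their representatives. A decided node takes the same branch in all windows of the range, so it
  inherits the representative of that one successor, and a test in the window \<open>[p, q)\<close>
  finds the branch.\<close>

lemma contracting_step: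
  assumes G: "contracted n rk p q K c xs V I s"
    and C: "contracting n rk p q K xs i z xs' V' I' R"
    and i: "i < c"
  shows "undecided rk p q K (xs i) \<Longrightarrow>
      contracting n rk p q K xs (Suc i) (Suc z) (xs'(z := xs i)) (V'(xs i := R (V (xs i))))
        (I'(xs i := R (I (xs i)))) (R(xs i := xs i))"
    and "\<not> undecided rk p q K (xs i) \<Longrightarrow>
      contracting n rk p q K xs (Suc i) z xs' V' I'
        (R(xs i := R ((if in_window rk p q (xs i) then V else I) (xs i))))"
proof -
  let ?w = "\<lambda>p' q'. walk n (in_window rk p' q')"
  define x where "x = xs i"
  have x: "x < n * n" "x \<in> xs ` {..<c}" using G i unfolding contracted_def x_def by auto
  have Vx: "V x \<in> nodes n xs c" "x < V x" "I x \<in> nodes n xs c" "x < I x"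
    using G x unfolding contracted_def by auto
  note RV = contracting_successor[OF G C i Vx(1,2)[unfolded x_def], folded x_def]
  note RI = contracting_successor[OF G C i Vx(3,4)[unfolded x_def], folded x_def]
  have walk_x: "?w p' q' (if in_window rk p' q' x then V x else I x)
      = ?w p' q' x"
    if "p' \<in> {p..p + K}" "q' \<in> {q..q + K}" for p' q'
    using G x that unfolding contracted_def Let_def by blast
  have earlier: "x < y" if "y \<in> xs ` {..<i}" for y
    using G i that unfolding contracted_def x_def by auto
  then have x_notin: "x \<notin> xs ` {..<i}" by blast
  have sub: "xs' ` {..<z} \<subseteq> {x \<in> xs ` {..<i}. undecided rk p q K x}"
    using C unfolding contracting_def by blast
  then have x_notin': "x \<notin> xs' ` {..<z}" using x_notin by blast
  have insert: "xs ` {..<Suc i} = insert x (xs ` {..<i})" by (simp add: lessThan_Suc x_def)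
  show "contracting n rk p q K xs (Suc i) (Suc z) (xs'(z := xs i)) (V'(xs i := R (V (xs i))))
        (I'(xs i := R (I (xs i)))) (R(xs i := xs i))" if und: "undecided rk p q K (xs i)"
  proof -
    have img: "(xs'(z := x)) ` {..<Suc z} = insert x (xs' ` {..<z})"
      by (auto simp: lessThan_Suc)
    have nodes: "nodes n (xs'(z := x)) (Suc z) = insert x (nodes n xs' z)"
      unfolding nodes_def img by auto
    have desc: "\<forall>a b. a < b \<and> b < Suc z \<longrightarrow> (xs'(z := x)) b < (xs'(z := x)) a"
    proof (intro allI impI)
      fix a b assume ab: "a < b \<and> b < Suc z"
      show "(xs'(z := x)) b < (xs'(z := x)) a"
      proof (cases "b = z")
        case True
        then have "xs' a \<in> xs ` {..<i}" using sub ab by auto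
        then show ?thesis using True ab earlier by simp
      next
        case False
        then show ?thesis using C ab unfolding contracting_def by simp
      qed
    qed
    have neq: "y \<noteq> x" if "y \<in> xs ` {..<i} \<or> y \<in> xs' ` {..<z}" for y using that x_notin x_notin' by blast
    have R: "y \<le> R y \<and> R y \<in> nodes n xs' z" if "y \<in> xs ` {..<i}" for y
      using C that unfolding contracting_def by blast
    have V': "V' y \<in> nodes n xs' z \<and> I' y \<in> nodes n xs' z \<and> y < V' y \<and> y < I' y"
      if "y \<in> xs' ` {..<z}" for y
      using C that unfolding contracting_def by blast
    have w: "?w p' q' (R y) = ?w p' q' y"
      if "y \<in> xs ` {..<i}" "p' \<in> {p..p + K}" "q' \<in> {q..q + K}" for y p' q'
      using C that unfolding contracting_def Let_def by blast
    have w': "?w p' q' (if in_window rk p' q' y then V' y else I' y)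
        = ?w p' q' y"
      if "y \<in> xs' ` {..<z}" "p' \<in> {p..p + K}" "q' \<in> {q..q + K}" for y p' q'
      using C that unfolding contracting_def Let_def by blast
    have wx: "?w p' q' (if in_window rk p' q' x then R (V x) else R (I x))
        = ?w p' q' x"
      if "p' \<in> {p..p + K}" "q' \<in> {q..q + K}" for p' q'
      using walk_x[OF that] RV RI that by (metis (full_types))
    show ?thesis
      unfolding contracting_def x_def[symmetric] img nodes insert Let_def
    proof (intro conjI)
      show "Suc z \<le> Suc i" using C unfolding contracting_def by simp
      show "insert x (xs' ` {..<z}) \<subseteq> {y \<in> insert x (xs ` {..<i}). undecided rk p q K y}"
        using sub und x_def by auto
      show "\<forall>a b. a < b \<and> b < Suc z \<longrightarrow> (xs'(z := x)) b < (xs'(z := x)) a" by (fact desc)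
      show "(R(x := x)) (n * n) = n * n" "(R(x := x)) (n * n + 1) = n * n + 1"
        using C unfolding contracting_def by simp_all
      show "\<forall>y\<in>insert x (xs ` {..<i}). y \<le> (R(x := x)) y \<and> (R(x := x)) y \<in> insert x (nodes n xs' z)"
        using R neq by simp
      show "\<forall>y\<in>insert x (xs' ` {..<z}). (V'(x := R (V x))) y \<in> insert x (nodes n xs' z) \<and>
          (I'(x := R (I x))) y \<in> insert x (nodes n xs' z) \<and> y < (V'(x := R (V x))) y \<and> y < (I'(x := R (I x))) y"
        using V' neq RV RI Vx by simp
      show "\<forall>p'\<in>{p..p + K}. \<forall>q'\<in>{q..q + K}.
          (\<forall>y\<in>insert x (xs ` {..<i}). ?w p' q' ((R(x := x)) y) = ?w p' q' y) \<and>
          (\<forall>y\<in>insert x (xs' ` {..<z}). walk n (in_window rk p' q')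
             (if in_window rk p' q' y then (V'(x := R (V x))) y else (I'(x := R (I x))) y)
              = ?w p' q' y)"
      proof (intro ballI conjI)
        fix p' q' y assume pq: "p' \<in> {p..p + K}" "q' \<in> {q..q + K}" and "y \<in> insert x (xs ` {..<i})"
        then show "?w p' q' ((R(x := x)) y) = ?w p' q' y"
          using w[OF _ pq, of y] by (cases "y = x") simp_all
      next
        fix p' q' y assume pq: "p' \<in> {p..p + K}" "q' \<in> {q..q + K}" and "y \<in> insert x (xs' ` {..<z})"
        then show "walk n (in_window rk p' q')
             (if in_window rk p' q' y then (V'(x := R (V x))) y else (I'(x := R (I x))) y)
              = ?w p' q' y"
          using w'[OF _ pq, of y] wx[OF pq] by (cases "y = x"; cases "in_window rk p' q' y") simp_all
      qed
    qed
  qed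
  show "contracting n rk p q K xs (Suc i) z xs' V' I'
        (R(xs i := R ((if in_window rk p q (xs i) then V else I) (xs i))))" if dec: "\<not> undecided rk p q K (xs i)"
  proof -
    define y where "y = (if in_window rk p q x then V x else I x)"
    have Ry: "x \<le> R y \<and> R y \<in> nodes n xs' z"
      using RV RI Vx unfolding y_def by auto
    have wy: "?w p' q' (R y) = ?w p' q' x"
      if "p' \<in> {p..p + K}" "q' \<in> {q..q + K}" for p' q'
      using walk_x[OF that] in_window_decided[OF dec that] RV RI that unfolding y_def x_def by (metis (full_types))
    have y_eq: "R ((if in_window rk p q x then V else I) x) = R y" by (simp add: y_def)
    show ?thesis
      using C unfolding contracting_def x_def[symmetric] insert y_eq Let_def
      by (elim conjE, intro conjI)
        (use x x_notin Ry wy in \<open>auto simp: fun_upd_apply\<close>)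
  qed
qed

lemma contracting_final:
  assumes G: "contracted n rk p q K c xs V I s"
    and C: "contracting n rk p q K xs c z xs' V' I' R"
  shows "contracted n rk p q K z xs' V' I' (R s)"
proof -
  have s: "R s \<in> nodes n xs' z \<and> (\<forall>p'\<in>{p..p + K}. \<forall>q'\<in>{q..q + K}.
      walk n (in_window rk p' q') (R s) = walk n (in_window rk p' q') s)"
  proof (cases "s \<in> {n * n, n * n + 1}")
    case True
    then show ?thesis using C by (auto simp: contracting_def nodes_def)
  next
    case False
    then have "s \<in> xs ` {..<c}" using G by (auto simp: contracted_def nodes_def)
    then show ?thesis using C unfolding contracting_def Let_def by blast
  qed
  have sub: "xs' ` {..<z} \<subseteq> xs ` {..<c}" using C unfolding contracting_def by blast
  have xs: "\<forall>i<c. xs i < n * n" using G unfolding contracted_def by blast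
  have less: "\<forall>i<z. xs' i < n * n"
  proof (intro allI impI)
    fix i assume "i < z"
    then obtain k where "k < c" "xs' i = xs k" using sub by blast
    then show "xs' i < n * n" using xs by simp
  qed
  have start: "walk n (in_window rk p' q') s = walk n (in_window rk p' q') 0"
    if "p' \<in> {p..p + K}" "q' \<in> {q..q + K}" for p' q'
    using G that unfolding contracted_def Let_def by blast
  have w: "\<forall>x\<in>xs' ` {..<z}. walk n (in_window rk p' q') (if in_window rk p' q' x then V' x else I' x)
      = walk n (in_window rk p' q') x"
    if "p' \<in> {p..p + K}" "q' \<in> {q..q + K}" for p' q'
    using C that unfolding contracting_def Let_def by blast
  have C': "\<forall>i j. i < j \<and> j < z \<longrightarrow> xs' j < xs' i"
    "\<forall>x\<in>xs' ` {..<z}. V' x \<in> nodes n xs' z \<and> I' x \<in> nodes n xs' z \<and> x < V' x \<and> x < I' x"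
    using C unfolding contracting_def by - (elim conjE, assumption)+
  have s': "walk n (in_window rk p' q') (R s) = walk n (in_window rk p' q') 0"
    if "p' \<in> {p..p + K}" "q' \<in> {q..q + K}" for p' q'
    using s that start[OF that] by simp
  show ?thesis
    unfolding contracted_def Let_def
    by (intro conjI ballI less[THEN spec] less C' s[THEN conjunct1] s' w[THEN bspec])
qed

text \<open>Distinct nodes have distinct ranks, and the ranks of undecided nodes lie in two
  intervals of length \<open>K\<close>.\<close>

lemma contracting_length:
  assumes C: "contracting n rk p q K xs c z xs' V' I' R"
    and inj: "inj_on rk {..<n * n}" and xs: "\<And>i. i < c \<Longrightarrow> xs i < n * n"
  shows "z \<le> 2 * K"
proof -
  have sub: "xs' ` {..<z} \<subseteq> {x \<in> xs ` {..<c}. undecided rk p q K x}"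
    and desc: "\<And>i j. i < j \<and> j < z \<Longrightarrow> xs' j < xs' i"
    using C unfolding contracting_def by blast+
  have "inj_on xs' {..<z}"
    by (rule linorder_inj_onI) (use desc in force)+
  then have "z = card (xs' ` {..<z})" by (simp add: card_image)
  also have "\<dots> = card (rk ` xs' ` {..<z})"
    using sub xs by (intro card_image[symmetric] inj_on_subset[OF inj]) auto
  also have "\<dots> \<le> card ({p..<p + K} \<union> {q..<q + K})"
    using sub by (intro card_mono) (auto simp: undecided_def)
  also have "\<dots> \<le> card {p..<p + K} + card {q..<q + K}" by (rule card_Un_le)
  finally show ?thesis by simp
qed

text \<open>Without inner nodes the start is terminal, hence it is itself the outcome of the
  walk.\<close>

lemma contracted_empty:
  assumes "contracted n rk p q 0 0 xs V I s"
  shows "walk n (in_window rk p q) 0 = s"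
  using assms by (auto simp: contracted_def nodes_def Let_def walk_terminal)


section \<open>Sorting with a tournament tree\<close>

abbreviation seq (infixr ";;" 60) where "p ;; q \<equiv> Seq p q"
abbreviation var :: "nat \<Rightarrow> nexp" where "var x \<equiv> NCell x (NConst 0)"
abbreviation set_var :: "nat \<Rightarrow> nexp \<Rightarrow> program" where "set_var x e \<equiv> NAssign x (NConst 0) e"

text \<open>
  Integer variables: 1 \<open>n\<close>; 2 \<open>n\<^sup>2\<close>; 3, 4, 5 auxiliary; 8 \<open>2\<^sup>J\<close>; 9 \<open>J\<close>. Integer array 6 is a
  tournament tree with leaves \<open>n\<^sup>2 + x\<close>, 7 the rank of a node \<open>x\<close>. Real array 2 contains the
  distances (and in cell \<open>n\<^sup>2\<close> a larger number, which stands for an absent player of the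
  tournament), real array 3 the distances in ascending order.
\<close>

definition fits_word :: "nat \<Rightarrow> nat \<Rightarrow> bool" where
  "fits_word m W \<longleftrightarrow> 1 \<le> m \<and> 30 * (m * m) + 30 \<le> W"

lemma fits_word_linear: "fits_word m W \<Longrightarrow> 30 * m + 30 \<le> W"
proof -
  assume "fits_word m W"
  moreover have "m \<le> m * m" by simp
  ultimately show ?thesis unfolding fits_word_def by linarith
qed

lemma fits_word_cell:
  assumes W: "fits_word m W" and j: "j \<le> 4 * m" and x: "x \<le> 2 * m + 2"
  shows "j * m \<le> W" "j * m + x \<le> W"
proof -
  have "j * m \<le> 4 * (m * m)" using j mult_le_mono1[OF j, of m] by (simp add: mult.assoc)
  moreover have "m \<le> m * m" by simp
  moreover have "30 * (m * m) + 30 \<le> W" using W by (simp add: fits_word_def)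
  ultimately show "j * m \<le> W" "j * m + x \<le> W" using x by linarith+
qed

definition base :: "nat \<Rightarrow> nat \<Rightarrow> (nat \<Rightarrow> real) \<Rightarrow> store \<Rightarrow> bool" where
  "base n m D \<sigma> \<longleftrightarrow> fst \<sigma> 0 0 = 0 \<and> fst \<sigma> (Suc 0) 0 = n \<and> fst \<sigma> 2 0 = m \<and> snd \<sigma> 2 = D"

definition winner :: "(nat \<Rightarrow> real) \<Rightarrow> (nat \<Rightarrow> nat) \<Rightarrow> nat \<Rightarrow> nat" where
  "winner D tr i = (if D (tr (2 * i + 1)) < D (tr (2 * i)) then tr (2 * i + 1) else tr (2 * i))"

text \<open>On the way from \<open>i\<close> up to the root the distance of the winner never
  increases. For \<open>m = 1\<close> the root is the only leaf.\<close>

lemma tournament_root: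
  assumes "\<And>i. 1 \<le> i \<Longrightarrow> i < m \<Longrightarrow> tr i = winner D tr i" and "1 \<le> i" "i < 2 * m"
  shows "D (tr 1) \<le> D (tr i)"
  using assms(2,3)
proof (induction i rule: less_induct)
  case (less i)
  show ?case
  proof (cases "i = 1")
    case False
    then have i: "1 \<le> i div 2" "i div 2 < m" "i div 2 < i" using less.prems by auto
    have winner: "D (winner D tr j) \<le> D (tr k)" if "k = 2 * j \<or> k = 2 * j + 1" for j k
      using that by (elim disjE) (simp_all add: winner_def)
    have "D (winner D tr (i div 2)) \<le> D (tr i)" by (rule winner) linarith
    then show ?thesis using less.IH[OF i(3,1)] assms(1)[OF i(1,2)] less.prems i(2) by simp
  qed simp
qed

lemma tournament_players:
  assumes "\<And>i. 1 \<le> i \<Longrightarrow> i < m \<Longrightarrow> tr i = winner D tr i" and "\<And>x. x < m \<Longrightarrow> tr (m + x) \<in> S"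
    and "1 \<le> i" "i < 2 * m"
  shows "tr i \<in> S"
  using assms(3,4)
proof (induction "2 * m - i" arbitrary: i rule: less_induct)
  case less
  show ?case
  proof (cases "i < m")
    case True
    then have "tr (2 * i) \<in> S" "tr (2 * i + 1) \<in> S" using less by (auto intro!: less.hyps)
    then show ?thesis using assms(1)[of i] True less.prems by (simp add: winner_def)
  next
    case False
    then show ?thesis using assms(2)[of "i - m"] less.prems by simp
  qed
qed

definition update_node :: "nat \<Rightarrow> program" where
  "update_node v = Cond (RLess (RCell 2 (NCell 6 (NPlus (NTimes (NConst 2) (var v)) (NConst 1))))
       (RCell 2 (NCell 6 (NTimes (NConst 2) (var v)))))
     (NAssign 6 (var v) (NCell 6 (NPlus (NTimes (NConst 2) (var v)) (NConst 1))))
     (NAssign 6 (var v) (NCell 6 (NTimes (NConst 2) (var v))))"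

definition build_tree_loop :: program where
  "build_tree_loop =
     Loop (NLess (NConst 0) (var 3)) (update_node 3 ;; set_var 3 (NMinus (var 3) (NConst 1)))"

definition build_tree :: program where
  "build_tree = set_var 3 (NMinus (var 2) (NConst 1)) ;; build_tree_loop"

text \<open>\<open>A\<close> holds the nodes that may still violate the winner condition: an initial
  segment of the indices while the tree is built, the ancestors of a changed leaf while it is
  repaired.\<close>

definition tree_ok :: "(nat \<Rightarrow> real) \<Rightarrow> nat \<Rightarrow> (nat \<Rightarrow> nat) \<Rightarrow> nat set \<Rightarrow> bool" where
  "tree_ok D m tr A \<longleftrightarrow> (\<forall>i. 1 \<le> i \<and> i < m \<and> i \<notin> A \<longrightarrow> tr i = winner D tr i)"

text \<open>A new entry at \<open>i\<close> restores the condition there and can disturb it only at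
  the parent \<open>i div 2\<close>, which therefore has to be exempt, unless it is the non-node
  0.\<close>

lemma tree_ok_update:
  assumes ok: "tree_ok D m tr A" and i: "1 \<le> i" and A: "A \<subseteq> insert i B" "i div 2 = 0 \<or> i div 2 \<in> B"
  shows "tree_ok D m (tr(i := winner D tr i)) B"
  unfolding tree_ok_def
proof (intro allI impI)
  fix k assume k: "1 \<le> k \<and> k < m \<and> k \<notin> B"
  have "2 * k \<noteq> i" "2 * k + 1 \<noteq> i" using k A(2) by auto
  then have w: "winner D (tr(i := winner D tr i)) k = winner D tr k" by (simp add: winner_def)
  show "(tr(i := winner D tr i)) k = winner D (tr(i := winner D tr i)) k"
    unfolding w using ok k A(1) by (cases "k = i") (auto simp: tree_ok_def)
qed

lemma runs_update_node:
  assumes "fits_word m W" "base n m D \<sigma>" "fst \<sigma> v 0 = i" "1 \<le> i" "i < m"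
    and "fst \<sigma> 6 (2 * i) \<le> m" "fst \<sigma> 6 (2 * i + 1) \<le> m"
  shows "runs W (update_node v) \<sigma> 40 (\<lambda>\<sigma>'. \<sigma>' = nupdate \<sigma> 6 i (winner D (fst \<sigma> 6) i))"
  using assms fits_word_linear[OF assms(1)]
  by (auto simp: update_node_def base_def winner_def)

lemma runs_build_tree_loop:
  assumes W: "fits_word m W" and b: "base n m D \<sigma>" and leaves: "\<And>x. x < m \<Longrightarrow> fst \<sigma> 6 (m + x) = x"
    and X: "fst \<sigma> 3 0 = m - 1"
  shows "runs W build_tree_loop \<sigma> (60 * m)
    (\<lambda>\<sigma>'. base n m D \<sigma>' \<and> (\<forall>x<m. fst \<sigma>' 6 (m + x) = x) \<and> tree_ok D m (fst \<sigma>' 6) {})"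
  unfolding build_tree_loop_def
proof (rule runs_Loop)
  define I where "I t \<sigma> \<longleftrightarrow> base n m D \<sigma> \<and> (\<forall>x<m. fst \<sigma> 6 (m + x) = x) \<and> fst \<sigma> 3 0 < m \<and>
      tree_ok D m (fst \<sigma> 6) {..fst \<sigma> 3 0} \<and>
      (\<forall>i. fst \<sigma> 3 0 < i \<and> i < 2 * m \<longrightarrow> fst \<sigma> 6 i < m) \<and> 60 * fst \<sigma> 3 0 + 10 \<le> t"
    for t and \<sigma> :: store
  note lin = fits_word_linear[OF W]
  have "fst \<sigma> 6 i < m" if "m - 1 < i" "i < 2 * m" for i
    using leaves[of "i - m"] that by auto
  then show "I (60 * m) \<sigma>" using b leaves X W by (auto simp: I_def fits_word_def tree_ok_def)
  fix t and \<sigma> :: store assume I: "I t \<sigma>"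
  let ?c = "NLess (NConst 0) (var 3)"
  let ?p = "update_node 3 ;; set_var 3 (NMinus (var 3) (NConst 1))"
  show "bfits W \<sigma> ?c"
    using I lin by (auto simp: I_def)
  show "1 + bcost ?c \<le> t \<and> base n m D \<sigma> \<and>
      (\<forall>x<m. fst \<sigma> 6 (m + x) = x) \<and> tree_ok D m (fst \<sigma> 6) {}"
    if "\<not> bval \<sigma> ?c"
    using that I by (auto simp: I_def tree_ok_def)
  show "\<exists>u t'. runs W ?p \<sigma> u (I t') \<and>
      1 + bcost ?c + u + t' \<le> t"
    if "bval \<sigma> ?c"
  proof (intro exI conjI)
    define X where "X = fst \<sigma> 3 0"
    define w where "w = winner D (fst \<sigma> 6) X"
    have X1: "X - 1 \<le> W" "X - 1 < m" if "X < m" using lin that by linarith+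
    have X: "0 < X" "X < m" "60 * X + 10 \<le> t" using that I by (auto simp: I_def X_def)
    have tr: "fst \<sigma> 6 i < m" if "X < i" "i < 2 * m" for i
      using I that by (auto simp: I_def X_def)
    then have w: "w < m" using X tr[of "2 * X"] tr[of "2 * X + 1"] by (simp add: w_def winner_def)
    \<comment> \<open>The parent \<open>X div 2\<close> is at most \<open>X - 1\<close>, hence still
      exempt.\<close>
    have ok: "tree_ok D m ((fst \<sigma> 6)(X := w)) {..X - 1}"
      unfolding w_def by (rule tree_ok_update[of _ _ _ "{..X}"]) (use I X in \<open>auto simp: I_def X_def\<close>)
    have tr': "\<forall>i. X - 1 < i \<and> i < 2 * m \<longrightarrow> ((fst \<sigma> 6)(X := w)) i < m" using tr w by auto
    have next_inv: "runs W (set_var 3 (NMinus (var 3) (NConst 1))) (nupdate \<sigma> 6 X w) 10 (I (60 * (X - 1) + 10))"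
      using I X X1 lin ok tr'
      by (simp add: I_def base_def X_def[symmetric])
    have tr2: "fst \<sigma> 6 (2 * X) \<le> m" "fst \<sigma> 6 (2 * X + 1) \<le> m"
      using tr[of "2 * X"] tr[of "2 * X + 1"] X by simp_all
    have "runs W (update_node 3) \<sigma> 40 (\<lambda>\<sigma>'. \<sigma>' = nupdate \<sigma> 6 X w)"
      unfolding w_def
      by (rule runs_update_node[OF W, of n D])
        (use I X tr2 in \<open>simp_all add: I_def X_def\<close>)
    then show "runs W ?p \<sigma> 50 (I (60 * (X - 1) + 10))"
      using next_inv by (rule runs_Seq_exact) simp
    show "1 + bcost ?c + 50 + (60 * (X - 1) + 10) \<le> t" using X by simp
  qed
qed

lemma runs_build_tree:
  assumes W: "fits_word m W" and b: "base n m D \<sigma>" and leaves: "\<And>x. x < m \<Longrightarrow> fst \<sigma> 6 (m + x) = x"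
  shows "runs W build_tree \<sigma> (60 * m + 10)
    (\<lambda>\<sigma>'. base n m D \<sigma>' \<and> (\<forall>x<m. fst \<sigma>' 6 (m + x) = x) \<and> tree_ok D m (fst \<sigma>' 6) {})"
proof -
  have "runs W (set_var 3 (NMinus (var 2) (NConst 1))) \<sigma> 10 (\<lambda>\<sigma>'. \<sigma>' = nupdate \<sigma> 3 0 (m - 1))"
    using b fits_word_linear[OF W] by (simp add: base_def)
  moreover have "runs W build_tree_loop (nupdate \<sigma> 3 0 (m - 1)) (60 * m)
    (\<lambda>\<sigma>'. base n m D \<sigma>' \<and> (\<forall>x<m. fst \<sigma>' 6 (m + x) = x) \<and> tree_ok D m (fst \<sigma>' 6) {})"
    using b leaves by (intro runs_build_tree_loop[OF W]) (simp_all add: base_def)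
  ultimately show ?thesis
    unfolding build_tree_def by (rule runs_Seq_exact) simp
qed

text \<open>Since \<open>e\<close> is unbounded, every such set contains 0, which is not a node and
  marks the end of the climb.\<close>

definition ancestors :: "nat \<Rightarrow> nat set" where
  "ancestors i = {k. \<exists>e. k = i div 2 ^ e}"

lemma ancestors_subset: "ancestors i \<subseteq> insert i (ancestors (i div 2))"
proof
  fix k assume "k \<in> ancestors i"
  then obtain e where k: "k = i div 2 ^ e" by (auto simp: ancestors_def)
  show "k \<in> insert i (ancestors (i div 2))"
  proof (cases e)
    case (Suc e')
    then have "k = i div 2 div 2 ^ e'" by (simp add: k div_mult2_eq)
    then show ?thesis unfolding ancestors_def by blast
  qed (simp add: k)
qed

lemma self_in_ancestors: "i \<in> ancestors i"
  by (auto simp: ancestors_def intro: exI[of _ 0])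

definition climb :: program where
  "climb = Loop (NLess (NConst 0) (var 5)) (update_node 5 ;; set_var 5 (NDiv (var 5) (NConst 2)))"

text \<open>The index is halved in every round, so \<open>e\<close> rounds suffice from an index
  below \<open>2 ^ e\<close>.\<close>

lemma runs_climb:
  assumes W: "fits_word m W" and b: "base n m D \<sigma>" and ok: "tree_ok D m (fst \<sigma> 6) (ancestors (fst \<sigma> 5 0))"
    and i: "fst \<sigma> 5 0 < m" "fst \<sigma> 5 0 < 2 ^ e" and tr: "\<And>i. 1 \<le> i \<Longrightarrow> i < 2 * m \<Longrightarrow> fst \<sigma> 6 i \<le> m"
  shows "runs W climb \<sigma> (60 * e + 10) (\<lambda>\<sigma>'. base n m D \<sigma>' \<and> tree_ok D m (fst \<sigma>' 6) {} \<and>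
    (\<forall>x. fst \<sigma>' 6 (m + x) = fst \<sigma> 6 (m + x)) \<and> (\<forall>i. 1 \<le> i \<and> i < 2 * m \<longrightarrow> fst \<sigma>' 6 i \<le> m) \<and>
    (\<forall>v. v \<noteq> 5 \<and> v \<noteq> 6 \<longrightarrow> fst \<sigma>' v = fst \<sigma> v) \<and> snd \<sigma>' = snd \<sigma>)"
    (is "runs _ _ _ _ ?Q")
proof -
  define J where "J \<sigma>' \<longleftrightarrow> base n m D \<sigma>' \<and>
    (\<forall>x. fst \<sigma>' 6 (m + x) = fst \<sigma> 6 (m + x)) \<and> (\<forall>i. 1 \<le> i \<and> i < 2 * m \<longrightarrow> fst \<sigma>' 6 i \<le> m) \<and>
    (\<forall>v. v \<noteq> 5 \<and> v \<noteq> 6 \<longrightarrow> fst \<sigma>' v = fst \<sigma> v) \<and> snd \<sigma>' = snd \<sigma>" for \<sigma>'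
  define I where "I t \<sigma>' \<longleftrightarrow> J \<sigma>' \<and> tree_ok D m (fst \<sigma>' 6) (ancestors (fst \<sigma>' 5 0)) \<and> fst \<sigma>' 5 0 < m \<and>
    (\<exists>e. fst \<sigma>' 5 0 < 2 ^ e \<and> 60 * e + 10 \<le> t)" for t \<sigma>'
  note lin = fits_word_linear[OF W]
  show ?thesis
    unfolding climb_def
  proof (rule runs_Loop[where I = I])
    show "I (60 * e + 10) \<sigma>" using assms by (auto simp: I_def J_def)
    fix t and \<sigma>1 :: store assume I: "I t \<sigma>1"
    let ?c = "NLess (NConst 0) (var 5)"
    let ?p = "update_node 5 ;; set_var 5 (NDiv (var 5) (NConst 2))"
    show "bfits W \<sigma>1 ?c"
      using I lin by (auto simp: I_def)
    show "1 + bcost ?c \<le> t \<and> ?Q \<sigma>1"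
      if "\<not> bval \<sigma>1 ?c"
    proof -
      have "fst \<sigma>1 5 0 = 0" using that by simp
      moreover have "tree_ok D m (fst \<sigma>1 6) {}" if "tree_ok D m (fst \<sigma>1 6) (ancestors 0)"
        using that by (auto simp: tree_ok_def ancestors_def)
      ultimately show ?thesis using I unfolding I_def J_def by auto
    qed
    show "\<exists>u t'. runs W ?p \<sigma>1 u (I t') \<and>
        1 + bcost ?c + u + t' \<le> t"
      if "bval \<sigma>1 ?c"
    proof -
      define X where "X = fst \<sigma>1 5 0"
      obtain e where e: "X < 2 ^ e" "60 * e + 10 \<le> t" using I by (auto simp: I_def X_def)
      define w where "w = winner D (fst \<sigma>1 6) X"
      have J: "J \<sigma>1" using I by (simp add: I_def)
      have X: "0 < X" "X < m" using that I by (auto simp: I_def X_def)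
      have e0: "e \<noteq> 0" using X e by (cases e) auto
      have tr: "fst \<sigma>1 6 i \<le> m" if "1 \<le> i" "i < 2 * m" for i
        using J that by (auto simp: J_def)
      have tr2: "fst \<sigma>1 6 (2 * X) \<le> m" "fst \<sigma>1 6 (2 * X + 1) \<le> m"
        using tr[of "2 * X"] tr[of "2 * X + 1"] X by simp_all
      then have w: "w \<le> m" by (simp add: w_def winner_def)
      have ok: "tree_ok D m ((fst \<sigma>1 6)(X := w)) (ancestors (X div 2))"
        unfolding w_def
        by (rule tree_ok_update[of _ _ _ "ancestors X"])
          (use I X ancestors_subset self_in_ancestors in \<open>auto simp: I_def X_def\<close>)
      have "J (nupdate (nupdate \<sigma>1 6 X w) 5 0 (X div 2))"
        using J X w b by (simp add: J_def base_def)
      moreover have "X div 2 < 2 ^ (e - 1)" using e(1) e0 by (cases e) auto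
      moreover have "X \<le> W" using X lin by linarith
      moreover have "X div 2 < m" "X div 2 \<le> W" using X lin by linarith+
      ultimately have "runs W (set_var 5 (NDiv (var 5) (NConst 2))) (nupdate \<sigma>1 6 X w) 10 (I (60 * (e - 1) + 10))"
        using ok lin by (auto simp: I_def X_def[symmetric] intro: exI[of _ "e - Suc 0"])
      moreover have "runs W (update_node 5) \<sigma>1 40 (\<lambda>\<sigma>'. \<sigma>' = nupdate \<sigma>1 6 X w)"
        unfolding w_def
        by (rule runs_update_node[OF W, of n D])
          (use J X tr2 in \<open>simp_all add: J_def X_def\<close>)
      ultimately have "runs W ?p \<sigma>1 50 (I (60 * (e - 1) + 10))"
        by - (rule runs_Seq_exact, assumption+, simp)
      moreover have "1 + bcost ?c + 50 + (60 * (e - 1) + 10) \<le> t"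
        using e(2) e0 by simp
      ultimately show ?thesis by blast
    qed
  qed
qed

text \<open>\<open>A\<close> consists of the nodes ranked so far; their leaves hold
  \<open>m\<close>, the absent player.\<close>

definition selection :: "(nat \<Rightarrow> real) \<Rightarrow> nat \<Rightarrow> (nat \<Rightarrow> nat) \<Rightarrow> (nat \<Rightarrow> nat) \<Rightarrow> (nat \<Rightarrow> real) \<Rightarrow> nat \<Rightarrow> nat set \<Rightarrow> bool" where
  "selection D m tr rk Ds r A \<longleftrightarrow> A \<subseteq> {..<m} \<and> bij_betw rk A {..<r} \<and>
     (\<forall>x<m. tr (m + x) = (if x \<in> A then m else x)) \<and>
     (\<forall>x\<in>A. Ds (rk x) = D x \<and> (\<forall>y\<in>A. rk x \<le> rk y \<longrightarrow> D x \<le> D y) \<and> (\<forall>y\<in>{..<m} - A. D x \<le> D y))"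

text \<open>Some node is still unranked and its distance is smaller than \<open>D m\<close>, so the
  root is not the absent player. It is an unranked node of least distance and gets the next
  rank.\<close>

lemma selection_step:
  assumes S: "selection D m tr rk Ds r A" and ok: "tree_ok D m tr {}" and r: "r < m" and x: "x = tr 1"
    and top: "\<And>x. x < m \<Longrightarrow> D x < D m"
  shows "x < m" and "selection D m (tr(m + x := m)) (rk(x := r)) (Ds(r := D x)) (Suc r) (insert x A)"
proof -
  have A: "A \<subseteq> {..<m}" and bij: "bij_betw rk A {..<r}"
    and leaf: "\<And>y. y < m \<Longrightarrow> tr (m + y) = (if y \<in> A then m else y)"
    and D: "\<And>y. y \<in> A \<Longrightarrow> Ds (rk y) = D y" "\<And>y z. y \<in> A \<Longrightarrow> z \<in> A \<Longrightarrow> rk y \<le> rk z \<Longrightarrow> D y \<le> D z"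
      "\<And>y z. y \<in> A \<Longrightarrow> z \<in> {..<m} - A \<Longrightarrow> D y \<le> D z"
    using S unfolding selection_def by blast+
  have tree: "\<And>i. 1 \<le> i \<Longrightarrow> i < m \<Longrightarrow> tr i = winner D tr i" using ok by (auto simp: tree_ok_def)
  have min: "D x \<le> D y" if "y \<in> {..<m} - A" for y
    using tournament_root[of m tr D "m + y", OF tree] leaf[of y] that x by simp
  have "card A = r" using bij_betw_same_card[OF bij] by simp
  then have "A \<noteq> {..<m}" using r by auto
  then obtain y where y: "y \<in> {..<m} - A" using A by blast
  have "x \<in> insert m ({..<m} - A)"
    unfolding x by (rule tournament_players[OF tree, of m]) (use leaf r in auto)
  moreover have "x \<noteq> m" using min[OF y] top[of y] y by auto
  ultimately have xA: "x < m" "x \<notin> A" by auto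
  have less: "rk y < r" if "y \<in> A" for y using bij that by (auto simp: bij_betw_def)
  have bij': "bij_betw (rk(x := r)) (insert x A) {..<Suc r}"
  proof -
    have "bij_betw (rk(x := r)) A {..<r}"
      using bij xA(2) by (subst bij_betw_cong[of _ _ rk]) auto
    then show ?thesis
      using xA(2) notIn_Un_bij_betw[of x A "rk(x := r)" "{..<r}"] by (simp add: lessThan_Suc)
  qed
  show "x < m" by (fact xA)
  show "selection D m (tr(m + x := m)) (rk(x := r)) (Ds(r := D x)) (Suc r) (insert x A)"
    unfolding selection_def
  proof (intro conjI ballI allI impI)
    show "insert x A \<subseteq> {..<m}" using A xA by auto
    show "bij_betw (rk(x := r)) (insert x A) {..<Suc r}" by (fact bij')
    show "(tr(m + x := m)) (m + y) = (if y \<in> insert x A then m else y)" if "y < m" for y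
      using leaf[OF that] by simp
    show "(Ds(r := D x)) ((rk(x := r)) y) = D y" if "y \<in> insert x A" for y
      using that xA D(1)[of y] less[of y] by auto
    show "D y \<le> D z" if "y \<in> insert x A" "z \<in> insert x A" "(rk(x := r)) y \<le> (rk(x := r)) z" for y z
    proof (cases "y = x")
      case True
      then have "z = x" using that xA less[of z] by (auto split: if_splits)
      then show ?thesis using True by simp
    next
      case False
      then show ?thesis
        using that xA D(2)[of y z] D(3)[of y x] by (cases "z = x") auto
    qed
    show "D y \<le> D z" if "y \<in> insert x A" "z \<in> {..<m} - insert x A" for y z
      using that min[of z] D(3)[of y z] by auto
  qed
qed

text \<open>\<open>rk\<close> is a bijection even if distances coincide: ties are broken by the
  order of selection. The length bound for contracted lists depends on this.\<close>

definition sorted_ranks :: "(nat \<Rightarrow> real) \<Rightarrow> nat \<Rightarrow> (nat \<Rightarrow> nat) \<Rightarrow> (nat \<Rightarrow> real) \<Rightarrow> bool" where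
  "sorted_ranks D m rk Ds \<longleftrightarrow> bij_betw rk {..<m} {..<m} \<and> (\<forall>x<m. Ds (rk x) = D x) \<and>
     (\<forall>x<m. \<forall>y<m. rk x \<le> rk y \<longrightarrow> D x \<le> D y)"

lemma selection_final:
  assumes "selection D m tr rk Ds m A"
  shows "sorted_ranks D m rk Ds"
proof -
  have "A \<subseteq> {..<m}" "bij_betw rk A {..<m}" using assms by (auto simp: selection_def)
  moreover from this have "card A = m" using bij_betw_same_card by fastforce
  ultimately have "A = {..<m}" by (simp add: card_subset_eq)
  then show ?thesis using assms by (auto simp: selection_def sorted_ranks_def)
qed

definition select_step :: program where
  "select_step = set_var 3 (NCell 6 (NConst 1)) ;; NAssign 7 (var 3) (var 4) ;; RAssign 3 (var 4) (RCell 2 (var 3)) ;;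
     NAssign 6 (NPlus (var 2) (var 3)) (var 2) ;; set_var 5 (NDiv (NPlus (var 2) (var 3)) (NConst 2))"

definition select_loop :: program where
  "select_loop = Loop (NLess (var 4) (var 2)) (select_step ;; climb ;; set_var 4 (NPlus (var 4) (NConst 1)))"

lemma runs_select_step:
  assumes W: "fits_word m W" and b: "base n m D \<sigma>" and x: "fst \<sigma> 6 1 = x" "x < m" and r: "fst \<sigma> 4 0 = r" "r < m"
  shows "runs W select_step \<sigma> 60 (\<lambda>\<sigma>'. \<sigma>' = nupdate (nupdate (rupdate (nupdate (nupdate \<sigma> 3 0 x) 7 x r)
    3 r (D x)) 6 (m + x) m) 5 0 ((m + x) div 2))"
  using assms fits_word_linear[OF W] unfolding select_step_def
  by (simp add: base_def)

lemma runs_select_loop: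
  assumes W: "fits_word m W" and b: "base n m D \<sigma>" and top: "\<And>x. x < m \<Longrightarrow> D x < D m"
    and leaves: "\<And>x. x < m \<Longrightarrow> fst \<sigma> 6 (m + x) = x" and ok: "tree_ok D m (fst \<sigma> 6) {}"
    and r: "fst \<sigma> 4 0 = 0" and e: "m < 2 ^ e"
  shows "runs W select_loop \<sigma> (m * (60 * e + 100) + 10) (\<lambda>\<sigma>'. base n m D \<sigma>' \<and> sorted_ranks D m (fst \<sigma>' 7) (snd \<sigma>' 3))"
  unfolding select_loop_def
proof (rule runs_Loop)
  define I where "I t \<sigma> \<longleftrightarrow> base n m D \<sigma> \<and> fst \<sigma> 4 0 \<le> m \<and> tree_ok D m (fst \<sigma> 6) {} \<and>
    (\<exists>A. selection D m (fst \<sigma> 6) (fst \<sigma> 7) (snd \<sigma> 3) (fst \<sigma> 4 0) A) \<and>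
    (m - fst \<sigma> 4 0) * (60 * e + 100) + 10 \<le> t" for t \<sigma>
  note lin = fits_word_linear[OF W]
  show "I (m * (60 * e + 100) + 10) \<sigma>"
    using assms by (auto simp: I_def selection_def bij_betw_def intro!: exI[of _ "{}"])
  fix t and \<sigma> :: store assume I: "I t \<sigma>"
  have b: "base n m D \<sigma>" using I by (simp add: I_def)
  let ?c = "NLess (var 4) (var 2)"
  let ?p = "select_step ;; climb ;; set_var 4 (NPlus (var 4) (NConst 1))"
  show "bfits W \<sigma> ?c" using I lin by (auto simp: I_def base_def)
  show "1 + bcost ?c \<le> t \<and> base n m D \<sigma> \<and> sorted_ranks D m (fst \<sigma> 7) (snd \<sigma> 3)"
    if "\<not> bval \<sigma> ?c"
  proof -
    have "fst \<sigma> 4 0 = m" using that I by (simp add: I_def base_def)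
    then show ?thesis using I selection_final by (auto simp: I_def)
  qed
  show "\<exists>u t'. runs W ?p \<sigma> u (I t') \<and>
      1 + bcost ?c + u + t' \<le> t"
    if "bval \<sigma> ?c"
  proof -
    define r where "r = fst \<sigma> 4 0"
    define x where "x = fst \<sigma> 6 1"
    define \<sigma>1 where "\<sigma>1 = nupdate (nupdate (rupdate (nupdate (nupdate \<sigma> 3 0 x) 7 x r)
      3 r (D x)) 6 (m + x) m) 5 0 ((m + x) div 2)"
    define t' where "t' = (m - Suc r) * (60 * e + 100) + 10"
    have r: "r < m" using that b by (simp add: r_def base_def)
    obtain A where A: "selection D m (fst \<sigma> 6) (fst \<sigma> 7) (snd \<sigma> 3) r A" using I by (auto simp: I_def r_def)
    have ok: "tree_ok D m (fst \<sigma> 6) {}" using I by (simp add: I_def)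
    note step = selection_step[OF A ok r x_def top]
    have tree: "\<And>i. 1 \<le> i \<Longrightarrow> i < m \<Longrightarrow> fst \<sigma> 6 i = winner D (fst \<sigma> 6) i" using ok by (auto simp: tree_ok_def)
    have tr: "fst \<sigma> 6 i \<in> {..m}" if "1 \<le> i" "i < 2 * m" for i
      by (rule tournament_players[OF tree _ that]) (use A in \<open>auto simp: selection_def\<close>)
    have run1: "runs W select_step \<sigma> 60 (\<lambda>\<sigma>'. \<sigma>' = \<sigma>1)"
      unfolding \<sigma>1_def by (rule runs_select_step[OF W b]) (use step(1) r in \<open>simp_all add: x_def r_def\<close>)
    have anc: "tree_ok D m (fst \<sigma>1 6) (ancestors (fst \<sigma>1 5 0))"
      unfolding tree_ok_def
    proof (intro allI impI)
      fix i assume i: "1 \<le> i \<and> i < m \<and> i \<notin> ancestors (fst \<sigma>1 5 0)"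
      \<comment> \<open>Only the parent of the changed leaf \<open>m + x\<close> sees a different
        child.\<close>
      then have "i \<noteq> (m + x) div 2" using self_in_ancestors by (auto simp: \<sigma>1_def)
      then have "2 * i \<noteq> m + x" "2 * i + 1 \<noteq> m + x" by auto
      then show "fst \<sigma>1 6 i = winner D (fst \<sigma>1 6) i"
        using tree[of i] i by (simp add: \<sigma>1_def winner_def)
    qed
    have run2: "runs W climb \<sigma>1 (60 * e + 10) (\<lambda>\<sigma>'. base n m D \<sigma>' \<and> tree_ok D m (fst \<sigma>' 6) {} \<and>
        (\<forall>x. fst \<sigma>' 6 (m + x) = fst \<sigma>1 6 (m + x)) \<and> (\<forall>i. 1 \<le> i \<and> i < 2 * m \<longrightarrow> fst \<sigma>' 6 i \<le> m) \<and>
        (\<forall>v. v \<noteq> 5 \<and> v \<noteq> 6 \<longrightarrow> fst \<sigma>' v = fst \<sigma>1 v) \<and> snd \<sigma>' = snd \<sigma>1)"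
    proof (rule runs_climb[OF W _ anc])
      show "base n m D \<sigma>1" using b by (simp add: base_def \<sigma>1_def)
      show "fst \<sigma>1 5 0 < m" using step(1) by (simp add: \<sigma>1_def)
      then show "fst \<sigma>1 5 0 < 2 ^ e" using e by simp
      show "fst \<sigma>1 6 i \<le> m" if "1 \<le> i" "i < 2 * m" for i using tr[OF that] by (simp add: \<sigma>1_def)
    qed
    have run3: "runs W (set_var 4 (NPlus (var 4) (NConst 1))) \<sigma>2 10 (I t')"
      if \<sigma>2: "base n m D \<sigma>2 \<and> tree_ok D m (fst \<sigma>2 6) {} \<and>
        (\<forall>x. fst \<sigma>2 6 (m + x) = fst \<sigma>1 6 (m + x)) \<and> (\<forall>i. 1 \<le> i \<and> i < 2 * m \<longrightarrow> fst \<sigma>2 6 i \<le> m) \<and>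
        (\<forall>v. v \<noteq> 5 \<and> v \<noteq> 6 \<longrightarrow> fst \<sigma>2 v = fst \<sigma>1 v) \<and> snd \<sigma>2 = snd \<sigma>1" for \<sigma>2
    proof -
      have "fst \<sigma>2 4 = fst \<sigma> 4" "fst \<sigma>2 7 = (fst \<sigma> 7)(x := r)" "snd \<sigma>2 3 = (snd \<sigma> 3)(r := D x)"
        using \<sigma>2 by (simp_all add: \<sigma>1_def)
      moreover from this have "selection D m (fst \<sigma>2 6) (fst \<sigma>2 7) (snd \<sigma>2 3) (Suc r) (insert x A)"
        using step(2) \<sigma>2 unfolding selection_def by (simp add: \<sigma>1_def)
      ultimately show ?thesis
        using \<sigma>2 r lin by (auto simp: I_def base_def r_def[symmetric] t'_def)
    qed
    have "runs W ?p \<sigma> (60 + (60 * e + 10 + 10)) (I t')"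
      by (rule runs_Seq_exact[OF run1 runs_Seq[OF run2 run3 order_refl] order_refl])
    moreover have "1 + bcost ?c + (60 + (60 * e + 10 + 10)) + t' \<le> t"
    proof -
      have "(m - r) * (60 * e + 100) = (m - Suc r) * (60 * e + 100) + (60 * e + 100)"
        using r by (simp add: Suc_diff_Suc[symmetric])
      then show ?thesis using I by (simp add: I_def r_def[symmetric] t'_def)
    qed
    ultimately show ?thesis by blast
  qed
qed

text \<open>The two pointers together move at most \<open>2 * m\<close> times, so
  \<open>2 ^ height m\<close> rounds exhaust the search.\<close>

definition height :: "nat \<Rightarrow> nat" where
  "height m = (LEAST j. 2 * m < 2 ^ j)"

lemma less_height: "2 * m < 2 ^ height m"
  unfolding height_def by (rule LeastI[of _ "2 * m"]) simp

lemma height_le: "j < height m \<Longrightarrow> 2 ^ j \<le> 2 * m"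
  unfolding height_def using not_less_Least by fastforce

lemma power_height_le: "1 \<le> m \<Longrightarrow> 2 ^ height m \<le> 4 * m"
  using height_le[of "height m - 1" m] less_height[of m] by (cases "height m") auto

text \<open>Crude, but it only serves to bound integers and addresses, where any polynomial is good
  enough.\<close>

lemma height_le_linear: "1 \<le> m \<Longrightarrow> height m \<le> 4 * m"
  using power_height_le[of m] less_exp[of "height m"] by linarith

definition height_loop :: program where
  "height_loop = Loop (BNot (NLess (NTimes (NConst 2) (var 2)) (var 8)))
     (set_var 8 (NTimes (NConst 2) (var 8)) ;; set_var 9 (NPlus (var 9) (NConst 1)))"

definition compute_height :: program where
  "compute_height = set_var 8 (NConst 1) ;; set_var 9 (NConst 0) ;; height_loop"

lemma runs_height_loop:
  assumes W: "fits_word m W" and b: "base n m D \<sigma>" and P: "fst \<sigma> 8 0 = 1" "fst \<sigma> 9 0 = 0"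
  shows "runs W height_loop \<sigma> (40 * height m + 20) (\<lambda>\<sigma>'. base n m D \<sigma>' \<and> fst \<sigma>' 8 0 = 2 ^ height m \<and>
    fst \<sigma>' 9 0 = height m \<and> (\<forall>v. v \<noteq> 8 \<and> v \<noteq> 9 \<longrightarrow> fst \<sigma>' v = fst \<sigma> v) \<and> snd \<sigma>' = snd \<sigma>)"
proof -
  define I where "I t \<sigma>' \<longleftrightarrow> base n m D \<sigma>' \<and> fst \<sigma>' 8 0 = 2 ^ fst \<sigma>' 9 0 \<and> fst \<sigma>' 9 0 \<le> height m \<and>
    (\<forall>v. v \<noteq> 8 \<and> v \<noteq> 9 \<longrightarrow> fst \<sigma>' v = fst \<sigma> v) \<and> snd \<sigma>' = snd \<sigma> \<and>
    40 * (height m - fst \<sigma>' 9 0) + 20 \<le> t" for t \<sigma>'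
  note lin = fits_word_linear[OF W]
  have m: "1 \<le> m" using W by (simp add: fits_word_def)
  show ?thesis
    unfolding height_loop_def
  proof (rule runs_Loop[where I = I])
    show "I (40 * height m + 20) \<sigma>" using b P by (simp add: I_def)
    fix t and \<sigma>1 :: store assume I: "I t \<sigma>1"
    define j where "j = fst \<sigma>1 9 0"
    have j: "fst \<sigma>1 8 0 = 2 ^ j" "j \<le> height m" "40 * (height m - j) + 20 \<le> t"
      using I by (simp_all add: I_def j_def)
    have "(2::nat) ^ j \<le> 2 ^ height m" using j(2) by (intro power_increasing) auto
    then have W1: "2 ^ j \<le> W" "j \<le> W" "Suc j \<le> W"
      using power_height_le[OF m] height_le_linear[OF m] j(2) lin by linarith+
    have b1: "base n m D \<sigma>1" using I by (simp add: I_def)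
    let ?c = "BNot (NLess (NTimes (NConst 2) (var 2)) (var 8))"
    let ?p = "set_var 8 (NTimes (NConst 2) (var 8)) ;; set_var 9 (NPlus (var 9) (NConst 1))"
    show "bfits W \<sigma>1 ?c"
      using b1 W1 lin by (simp add: j base_def)
    have eq: "bval \<sigma>1 ?c \<longleftrightarrow> 2 ^ j \<le> 2 * m"
      using b1 by (auto simp: j base_def)
    show "1 + bcost ?c \<le> t \<and> base n m D \<sigma>1 \<and>
      fst \<sigma>1 8 0 = 2 ^ height m \<and> fst \<sigma>1 9 0 = height m \<and>
      (\<forall>v. v \<noteq> 8 \<and> v \<noteq> 9 \<longrightarrow> fst \<sigma>1 v = fst \<sigma> v) \<and> snd \<sigma>1 = snd \<sigma>"
      if "\<not> bval \<sigma>1 ?c"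
    proof -
      have "j = height m" using that[unfolded eq] height_le[of j m] j(2) by (metis le_neq_implies_less)
      then show ?thesis using I j by (simp add: I_def j_def)
    qed
    show "\<exists>u t'. runs W ?p \<sigma>1 u (I t') \<and>
      1 + bcost ?c + u + t' \<le> t"
      if "bval \<sigma>1 ?c"
    proof (intro exI conjI)
      have le: "2 ^ j \<le> 2 * m" using that eq by blast
      then have "j \<noteq> height m" using less_height[of m] by auto
      then have j': "Suc j \<le> height m" using j(2) by simp
      show "runs W ?p \<sigma>1 20
          (I (40 * (height m - Suc j) + 20))"
        using I b1 j j' W1 le lin by (simp add: I_def base_def j_def[symmetric])
      show "1 + bcost ?c + 20 + (40 * (height m - Suc j) + 20) \<le> t"
        using j j' by simp
    qed
  qed
qed

lemma runs_compute_height: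
  assumes W: "fits_word m W" and b: "base n m D \<sigma>"
  shows "runs W compute_height \<sigma> (40 * height m + 40) (\<lambda>\<sigma>'. base n m D \<sigma>' \<and> fst \<sigma>' 8 0 = 2 ^ height m \<and>
    fst \<sigma>' 9 0 = height m \<and> (\<forall>v. v \<noteq> 8 \<and> v \<noteq> 9 \<longrightarrow> fst \<sigma>' v = fst \<sigma> v) \<and> snd \<sigma>' = snd \<sigma>)"
proof -
  define \<sigma>1 where "\<sigma>1 = nupdate (nupdate \<sigma> 8 0 1) 9 0 0"
  have "runs W height_loop \<sigma>1 (40 * height m + 20) (\<lambda>\<sigma>'. base n m D \<sigma>' \<and> fst \<sigma>' 8 0 = 2 ^ height m \<and>
    fst \<sigma>' 9 0 = height m \<and> (\<forall>v. v \<noteq> 8 \<and> v \<noteq> 9 \<longrightarrow> fst \<sigma>' v = fst \<sigma>1 v) \<and> snd \<sigma>' = snd \<sigma>1)"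
    using b by (intro runs_height_loop[OF W]) (simp_all add: base_def \<sigma>1_def)
  then have "runs W height_loop \<sigma>1 (40 * height m + 20) (\<lambda>\<sigma>'. base n m D \<sigma>' \<and> fst \<sigma>' 8 0 = 2 ^ height m \<and>
    fst \<sigma>' 9 0 = height m \<and> (\<forall>v. v \<noteq> 8 \<and> v \<noteq> 9 \<longrightarrow> fst \<sigma>' v = fst \<sigma> v) \<and> snd \<sigma>' = snd \<sigma>)"
    by (rule runs_mono) (simp_all add: \<sigma>1_def)
  then show ?thesis
    using fits_word_linear[OF W] unfolding compute_height_def
    by (auto simp: \<sigma>1_def elim!: runs_mono)
qed


section \<open>The contraction program\<close>

text \<open>
  Integer arrays of the level graphs, where \<open>n\<^sup>2\<close> consecutive cells belong to a level: 10 list of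
  nodes, 11 and 12 successors of valid and invalid nodes; one cell per level: 13 length of the list,
  14 start node. Array 15 contains the contracted successors. Variables: 16 and 17 the window, 18
  the number of steps, 19 the level, 20 its period, 21 and 22 the lengths of the new list and of the
  processed part of the old one, 24 whether a range has been found (its value is in real cell (0, 0)).
\<close>

definition level_row :: "(nat \<Rightarrow> nat) \<Rightarrow> nat \<Rightarrow> nat \<Rightarrow> nat \<Rightarrow> nat" where
  "level_row A m j = (\<lambda>x. A (j * m + x))"

lemma level_row_upd_same: "level_row (A(j * m + x := v)) m j = (level_row A m j)(x := v)"
  by (auto simp: level_row_def)

lemma cell_eq_iff:
  fixes j j' m x y :: nat
  assumes "x < m" "y < m"
  shows "j * m + x = j' * m + y \<longleftrightarrow> j = j' \<and> x = y"
proof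
  assume eq: "j * m + x = j' * m + y"
  have "j = (j * m + x) div m" "j' = (j' * m + y) div m" using assms by simp_all
  then show "j = j' \<and> x = y" using eq by simp
qed simp

lemma level_row_upd_other: "x < m \<Longrightarrow> y < m \<Longrightarrow> j' \<noteq> j \<Longrightarrow> level_row (A(j * m + x := v)) m j' y = level_row A m j' y"
  by (simp add: level_row_def cell_eq_iff)

abbreviation rows_eq ::
    "nat \<Rightarrow> nat \<Rightarrow> (nat \<Rightarrow> nat) \<Rightarrow> (nat \<Rightarrow> nat) \<Rightarrow> (nat \<Rightarrow> nat) \<Rightarrow> store \<Rightarrow> bool" where
  "rows_eq m j xs V I \<sigma> \<equiv> \<forall>y<m. level_row (fst \<sigma> 10) m j y = xs y \<and> level_row (fst \<sigma> 11) m j y = V y \<and>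
     level_row (fst \<sigma> 12) m j y = I y"

definition level_ok :: "nat \<Rightarrow> nat \<Rightarrow> (nat \<Rightarrow> nat) \<Rightarrow> nat \<Rightarrow> nat \<Rightarrow> nat \<Rightarrow> nat \<Rightarrow> store \<Rightarrow> bool" where
  "level_ok n m rk p q K j \<sigma> \<longleftrightarrow> contracted n rk p q K (fst \<sigma> 13 j) (level_row (fst \<sigma> 10) m j)
     (level_row (fst \<sigma> 11) m j) (level_row (fst \<sigma> 12) m j) (fst \<sigma> 14 j)"

definition same_level :: "nat \<Rightarrow> nat \<Rightarrow> store \<Rightarrow> store \<Rightarrow> bool" where
  "same_level m j \<sigma> \<sigma>' \<longleftrightarrow> fst \<sigma>' 13 j = fst \<sigma> 13 j \<and> fst \<sigma>' 14 j = fst \<sigma> 14 j \<and>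
     (\<forall>y<m. level_row (fst \<sigma>' 10) m j y = level_row (fst \<sigma> 10) m j y \<and> level_row (fst \<sigma>' 11) m j y = level_row (fst \<sigma> 11) m j y \<and>
        level_row (fst \<sigma>' 12) m j y = level_row (fst \<sigma> 12) m j y)"

lemma contracted_length:
  assumes "contracted n rk p q K z xs V I s"
  shows "z \<le> n * n"
proof -
  have desc: "\<And>i j. i < j \<and> j < z \<Longrightarrow> xs j < xs i" and sub: "xs ` {..<z} \<subseteq> {..<n * n}"
    using assms unfolding contracted_def by auto
  have "inj_on xs {..<z}"
    by (rule linorder_inj_onI) (use desc in force)+
  from card_inj_on_le[OF this sub] show ?thesis by simp
qed

lemma level_ok_same:
  assumes ok: "level_ok n m rk p q K j \<sigma>" and m: "m = n * n" and same: "same_level m j \<sigma> \<sigma>'"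
  shows "level_ok n m rk p q K j \<sigma>'"
proof -
  note len = contracted_length[OF ok[unfolded level_ok_def]]
  show ?thesis
    using contracted_cong[OF ok[unfolded level_ok_def], of "level_row (fst \<sigma>' 10) m j" "level_row (fst \<sigma>' 11) m j"
        "level_row (fst \<sigma>' 12) m j"] same len
    unfolding level_ok_def same_level_def m by simp
qed

definition cell :: "nexp \<Rightarrow> nexp \<Rightarrow> nexp" where
  "cell l e = NPlus (NTimes l (var 2)) e"

definition parent_level :: nexp where
  "parent_level = NPlus (var 19) (NConst 1)"

text \<open>Array 15 is the map \<open>R\<close> of \<open>contracting\<close>. One array serves all
  levels, since a contraction reads it only at terminal nodes and at nodes that the same contraction
  has already processed.\<close>

definition load_node :: program where
  "load_node = set_var 3 (NCell 10 (cell parent_level (var 22))) ;; set_var 4 (NCell 7 (var 3)) ;;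
     set_var 5 (NCell 15 (NCell 11 (cell parent_level (var 3)))) ;;
     set_var 23 (NCell 15 (NCell 12 (cell parent_level (var 3))))"

text \<open>With \<open>2 ^ j\<close> in variable 20 this says that the rank is at least
  \<open>e\<close> and below \<open>e + K\<close> for \<open>K = 2 ^ j - 1\<close>; adding 1 on the
  left replaces the subtraction.\<close>

definition in_range :: "nexp \<Rightarrow> bexp" where
  "in_range e = BAnd (BNot (NLess (var 4) e)) (NLess (NPlus (var 4) (NConst 1)) (NPlus e (var 20)))"

definition store_node :: program where
  "store_node = Cond (BNot (BAnd (BNot (in_range (var 16))) (BNot (in_range (var 17)))))
     (NAssign 15 (var 3) (var 3) ;; NAssign 11 (cell (var 19) (var 3)) (var 5) ;;
      NAssign 12 (cell (var 19) (var 3)) (var 23) ;; NAssign 10 (cell (var 19) (var 21)) (var 3) ;;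
      set_var 21 (NPlus (var 21) (NConst 1)))
     (Cond (BAnd (BNot (NLess (var 4) (var 16))) (NLess (var 4) (var 17)))
       (NAssign 15 (var 3) (var 5)) (NAssign 15 (var 3) (var 23)))"

definition contract_loop :: program where
  "contract_loop = Loop (NLess (var 22) (NCell 13 parent_level))
     (load_node ;; store_node ;; set_var 22 (NPlus (var 22) (NConst 1)))"

definition contract :: program where
  "contract = set_var 21 (NConst 0) ;; set_var 22 (NConst 0) ;; contract_loop ;;
     NAssign 13 (var 19) (var 21) ;; NAssign 14 (var 19) (NCell 15 (NCell 14 parent_level))"

lemma runs_load_node:
  assumes W: "fits_word m W" and b: "base n m D \<sigma>" and j: "fst \<sigma> 19 0 = j" "j < 4 * m"
    and i: "fst \<sigma> 22 0 < m" and x: "level_row (fst \<sigma> 10) m (Suc j) (fst \<sigma> 22 0) = x" "x < m"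
    and r: "fst \<sigma> 7 x = r" "r < m" and v: "level_row (fst \<sigma> 11) m (Suc j) x = v" "v \<le> m + 1" "fst \<sigma> 15 v = v'" "v' \<le> m + 1"
    and w: "level_row (fst \<sigma> 12) m (Suc j) x = w" "w \<le> m + 1" "fst \<sigma> 15 w = w'" "w' \<le> m + 1"
  shows "runs W load_node \<sigma> 100
    (\<lambda>\<sigma>'. \<sigma>' = nupdate (nupdate (nupdate (nupdate \<sigma> 3 0 x) 4 0 r) 5 0 v') 23 0 w')"
proof -
  have c: "Suc j * m \<le> W" "Suc j * m + y \<le> W" if "y \<le> 2 * m + 2" for y
    using fits_word_cell[OF W, of "Suc j" y] j that by auto
  show ?thesis
    using assms fits_word_linear[OF W] c[of "fst \<sigma> 22 0"] c[of x]
    unfolding load_node_def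
    by (simp add: base_def cell_def parent_level_def level_row_def)
qed

definition store_result :: "nat \<Rightarrow> nat \<Rightarrow> nat \<Rightarrow> nat \<Rightarrow> bool \<Rightarrow> bool \<Rightarrow> nat \<Rightarrow> nat \<Rightarrow> store \<Rightarrow> store" where
  "store_result j m x z und dec v w \<sigma> =
     (if und then nupdate (nupdate (nupdate (nupdate (nupdate \<sigma> 15 x x) 11 (j * m + x) v) 12 (j * m + x) w)
        10 (j * m + z) x) 21 0 (Suc z)
      else nupdate \<sigma> 15 x (if dec then v else w))"

lemma runs_store_node:
  assumes W: "fits_word m W" and b: "base n m D \<sigma>" and j: "fst \<sigma> 19 0 = j" "j < 4 * m" "fst \<sigma> 20 0 = 2 ^ j" "2 ^ j \<le> 4 * m"
    and x: "fst \<sigma> 3 0 = x" "x < m" and r: "fst \<sigma> 4 0 = rk x" "rk x < m" and v: "fst \<sigma> 5 0 = v" "v \<le> m + 1"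
    and w: "fst \<sigma> 23 0 = w" "w \<le> m + 1" and z: "fst \<sigma> 21 0 = z" "z < m"
    and p: "fst \<sigma> 16 0 = p" "p \<le> m" and q: "fst \<sigma> 17 0 = q" "q \<le> m"
  shows "runs W store_node \<sigma> 100
    (\<lambda>\<sigma>'. \<sigma>' = store_result j m x z (undecided rk p q (2 ^ j - 1) x) (in_window rk p q x) v w \<sigma>)"
proof -
  have c: "j * m \<le> W" "j * m + y \<le> W" if "y \<le> 2 * m + 2" for y
    using fits_word_cell[OF W, of j y] j that by auto
  have 1: "(1::nat) \<le> 2 ^ j" by simp
  have und: "undecided rk p q (2 ^ j - 1) x \<longleftrightarrow>
      (\<not> rk x < p \<and> rk x + 1 < p + 2 ^ j) \<or> (\<not> rk x < q \<and> rk x + 1 < q + 2 ^ j)"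
    using 1 unfolding undecided_def by (simp add: not_less less_diff_conv)
  show ?thesis
    using assms fits_word_linear[OF W] c[of x] c[of z]
    unfolding store_node_def und
    by (simp add: base_def cell_def in_range_def store_result_def in_window_def not_less)
qed

definition main_state :: "nat \<Rightarrow> nat \<Rightarrow> (nat \<Rightarrow> real) \<Rightarrow> (nat \<Rightarrow> nat) \<Rightarrow> nat \<Rightarrow> nat \<Rightarrow> nat \<Rightarrow> store \<Rightarrow> bool" where
  "main_state n m D rk j p q \<sigma> \<longleftrightarrow> base n m D \<sigma> \<and> fst \<sigma> 7 = rk \<and> fst \<sigma> 16 0 = p \<and> fst \<sigma> 17 0 = q \<and>
     fst \<sigma> 19 0 = j \<and> fst \<sigma> 20 0 = 2 ^ j \<and> j \<le> height m \<and> p \<le> m \<and> q \<le> m"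

text \<open>The last clause keeps the terminal nodes as their own representatives; these two cells
  of array 15 are set only once, before the search.\<close>

definition contract_frame :: "nat \<Rightarrow> nat \<Rightarrow> store \<Rightarrow> store \<Rightarrow> bool" where
  "contract_frame m j \<sigma> \<sigma>' \<longleftrightarrow> (\<forall>v. v \<notin> {3, 4, 5, 10, 11, 12, 13, 14, 15, 21, 22, 23} \<longrightarrow> fst \<sigma>' v = fst \<sigma> v) \<and>
     snd \<sigma>' = snd \<sigma> \<and> (\<forall>j'. j' \<noteq> j \<longrightarrow> same_level m j' \<sigma> \<sigma>') \<and>
     (fst \<sigma> 15 m = m \<and> fst \<sigma> 15 (Suc m) = Suc m \<longrightarrow> fst \<sigma>' 15 m = m \<and> fst \<sigma>' 15 (Suc m) = Suc m)"

lemma contract_frame_main_state: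
  "contract_frame m j \<sigma> \<sigma>' \<Longrightarrow> main_state n m D rk j' p q \<sigma> \<Longrightarrow> main_state n m D rk j' p q \<sigma>'"
  by (simp add: contract_frame_def main_state_def base_def)

lemma contract_frame_refl: "contract_frame m j \<sigma> \<sigma>"
  by (simp add: contract_frame_def same_level_def)

lemma contract_frame_trans:
  "contract_frame m j \<sigma> \<sigma>' \<Longrightarrow> contract_frame m j \<sigma>' \<sigma>'' \<Longrightarrow> contract_frame m j \<sigma> \<sigma>''"
  unfolding contract_frame_def same_level_def by simp

lemma contract_frame_vars:
  "v \<in> {3, 4, 5, 21, 22, 23} \<Longrightarrow> contract_frame m j \<sigma> (nupdate \<sigma> v i w)"
  by (auto simp: contract_frame_def same_level_def)

lemma contract_frame_store_result:
  assumes "x < m" "z < m"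
  shows "contract_frame m j \<sigma> (store_result j m x z und dec v w \<sigma>)"
  using assms by (simp add: contract_frame_def same_level_def store_result_def level_row_upd_other)

abbreviation contracting_store ::
    "nat \<Rightarrow> nat \<Rightarrow> (nat \<Rightarrow> nat) \<Rightarrow> nat \<Rightarrow> nat \<Rightarrow> nat \<Rightarrow> (nat \<Rightarrow> nat) \<Rightarrow> nat \<Rightarrow> nat \<Rightarrow> store \<Rightarrow> bool" where
  "contracting_store n m rk j p q xs i z \<sigma> \<equiv> contracting n rk p q (2 ^ j - 1) xs i z
     (level_row (fst \<sigma> 10) m j) (level_row (fst \<sigma> 11) m j) (level_row (fst \<sigma> 12) m j) (fst \<sigma> 15)"

lemma runs_contract_step:
  assumes W: "fits_word m W" and m: "m = n * n" and s: "main_state n m D rk j p q \<sigma>" and j: "j < height m"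
    and rk: "\<And>x. x < m \<Longrightarrow> rk x < m"
    and G: "contracted n rk p q (2 ^ j - 1) c xs V I st"
    and same: "rows_eq m (Suc j) xs V I \<sigma>"
    and C: "contracting_store n m rk j p q xs i z \<sigma>"
    and i: "fst \<sigma> 22 0 = i" "i < c" and z: "fst \<sigma> 21 0 = z"
  shows "runs W (load_node ;; store_node ;; set_var 22 (NPlus (var 22) (NConst 1))) \<sigma> 220
    (\<lambda>\<sigma>'. contract_frame m j \<sigma> \<sigma>' \<and> fst \<sigma>' 22 0 = Suc i \<and>
      contracting_store n m rk j p q xs (Suc i) (fst \<sigma>' 21 0) \<sigma>')"
proof -
  have m1: "1 \<le> m" using W by (simp add: fits_word_def)
  have c: "c \<le> m" using contracted_length[OF G] m by simp
  have im: "i < m" using i c by simp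
  define x where "x = xs i"
  have x: "x < m" "x \<in> xs ` {..<c}" using G i m unfolding contracted_def x_def by auto
  have Vx: "V x \<in> nodes n xs c" "x < V x" "I x \<in> nodes n xs c" "x < I x"
    using G x unfolding contracted_def by auto
  have RV: "V x \<le> m + 1" "fst \<sigma> 15 (V x) \<in> nodes n (level_row (fst \<sigma> 10) m j) z"
    using contracting_successor[OF G C i(2) Vx(1)] Vx(2) m by (auto simp: x_def)
  have RI: "I x \<le> m + 1" "fst \<sigma> 15 (I x) \<in> nodes n (level_row (fst \<sigma> 10) m j) z"
    using contracting_successor[OF G C i(2) Vx(3)] Vx(4) m by (auto simp: x_def)
  have xs': "level_row (fst \<sigma> 10) m j ` {..<z} \<subseteq> xs ` {..<i}" and zi: "z \<le> i"
    using C unfolding contracting_def by blast+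
  have xsm: "xs k < m" if "k < i" for k using G i that m unfolding contracted_def by auto
  have nodes_le: "y \<le> m + 1" if "y \<in> nodes n (level_row (fst \<sigma> 10) m j) z" for y
  proof (cases "y \<in> level_row (fst \<sigma> 10) m j ` {..<z}")
    case True
    then obtain k where "k < i" "y = xs k" using xs' by blast
    then show ?thesis using xsm[of k] by simp
  next
    case False
    then show ?thesis using that m by (auto simp: nodes_def)
  qed
  define v where "v = fst \<sigma> 15 (V x)"
  define w where "w = fst \<sigma> 15 (I x)"
  have v: "v \<le> m + 1" and w: "w \<le> m + 1" using nodes_le RV RI by (auto simp: v_def w_def)
  have b: "base n m D \<sigma>" and s': "fst \<sigma> 7 = rk" "fst \<sigma> 16 0 = p" "fst \<sigma> 17 0 = q"
     "fst \<sigma> 19 0 = j" "fst \<sigma> 20 0 = 2 ^ j" "p \<le> m" "q \<le> m"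
    using s by (simp_all add: main_state_def)
  have j4: "j < 4 * m" using j height_le_linear[OF m1] by simp
  have "(2::nat) ^ j \<le> 2 ^ height m" using j by (intro power_increasing) auto
  then have P4: "2 ^ j \<le> 4 * m" using power_height_le[OF m1] by linarith
  define \<sigma>1 where "\<sigma>1 = nupdate (nupdate (nupdate (nupdate \<sigma> 3 0 x) 4 0 (rk x)) 5 0 v) 23 0 w"
  define und where "und \<longleftrightarrow> undecided rk p q (2 ^ j - 1) x"
  define dec where "dec \<longleftrightarrow> in_window rk p q x"
  define \<sigma>2 where "\<sigma>2 = store_result j m x z und dec v w \<sigma>1"
  have run1: "runs W load_node \<sigma> 100 (\<lambda>\<sigma>'. \<sigma>' = \<sigma>1)"
    unfolding \<sigma>1_def
    by (rule runs_load_node[OF W b s'(4) j4, where v = "V x" and w = "I x"])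
      (use same im i x RV RI rk[OF x(1)] s' v w in \<open>simp_all add: x_def v_def w_def\<close>)
  have run2: "runs W store_node \<sigma>1 100 (\<lambda>\<sigma>'. \<sigma>' = \<sigma>2)"
    unfolding \<sigma>2_def und_def dec_def
    by (rule runs_store_node[OF W])
      (use b s' j4 P4 x rk[OF x(1)] v w z zi im in \<open>simp_all add: \<sigma>1_def base_def\<close>)
  have run3: "runs W (set_var 22 (NPlus (var 22) (NConst 1))) \<sigma>2 20 (\<lambda>\<sigma>'. \<sigma>' = nupdate \<sigma>2 22 0 (Suc i))"
    using fits_word_linear[OF W] im i by (simp add: \<sigma>2_def store_result_def \<sigma>1_def)
  have "contract_frame m j \<sigma> \<sigma>1"
    unfolding \<sigma>1_def by (intro contract_frame_trans[OF _ contract_frame_vars] contract_frame_refl) auto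
  moreover have "contract_frame m j \<sigma>1 \<sigma>2"
    unfolding \<sigma>2_def using x zi im by (intro contract_frame_store_result) auto
  moreover have "contract_frame m j \<sigma>2 (nupdate \<sigma>2 22 0 (Suc i))"
    by (rule contract_frame_vars) auto
  ultimately have frame: "contract_frame m j \<sigma> (nupdate \<sigma>2 22 0 (Suc i))"
    by (meson contract_frame_trans)
  have step: "contracting_store n m rk j p q xs (Suc i) (fst \<sigma>2 21 0) \<sigma>2"
  proof (cases und)
    case True
    then show ?thesis
      using contracting_step(1)[OF G C i(2)] z
      by (simp add: \<sigma>2_def store_result_def \<sigma>1_def und_def x_def[symmetric] level_row_upd_same v_def w_def)
  next
    case False
    have "fst \<sigma> 15 ((if in_window rk p q x then V else I) x) = (if dec then v else w)"
      by (simp add: dec_def v_def w_def)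
    then show ?thesis
      using contracting_step(2)[OF G C i(2)] z False
      by (simp add: \<sigma>2_def store_result_def \<sigma>1_def und_def x_def[symmetric])
  qed
  have "runs W (store_node ;; set_var 22 (NPlus (var 22) (NConst 1))) \<sigma>1 120 (\<lambda>\<sigma>'. \<sigma>' = nupdate \<sigma>2 22 0 (Suc i))"
    by (rule runs_Seq_exact[OF run2 run3]) simp
  then have "runs W (load_node ;; store_node ;; set_var 22 (NPlus (var 22) (NConst 1))) \<sigma> 220
      (\<lambda>\<sigma>'. \<sigma>' = nupdate \<sigma>2 22 0 (Suc i))"
    by (rule runs_Seq_exact[OF run1]) simp
  then show ?thesis
    by (rule runs_mono) (use frame step in simp_all)
qed

lemma runs_contract_loop:
  assumes W: "fits_word m W" and m: "m = n * n" and s: "main_state n m D rk j p q \<sigma>" and j: "j < height m"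
    and rk: "\<And>x. x < m \<Longrightarrow> rk x < m"
    and G: "contracted n rk p q (2 ^ j - 1) c xs V I st" and c: "fst \<sigma> 13 (Suc j) = c"
    and same: "rows_eq m (Suc j) xs V I \<sigma>"
    and C: "contracting_store n m rk j p q xs 0 0 \<sigma>"
    and i: "fst \<sigma> 22 0 = 0" and z: "fst \<sigma> 21 0 = 0"
  shows "runs W contract_loop \<sigma> (240 * c + 20)
    (\<lambda>\<sigma>'. contract_frame m j \<sigma> \<sigma>' \<and>
      contracting_store n m rk j p q xs c (fst \<sigma>' 21 0) \<sigma>')"
proof -
  have m1: "1 \<le> m" using W by (simp add: fits_word_def)
  note lin = fits_word_linear[OF W]
  have cm: "c \<le> m" using contracted_length[OF G] m by simp
  have jm: "j < 4 * m" using j height_le_linear[OF m1] by simp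
  define J where "J t \<sigma>' \<longleftrightarrow> contract_frame m j \<sigma> \<sigma>' \<and> fst \<sigma>' 22 0 \<le> c \<and>
      contracting_store n m rk j p q xs (fst \<sigma>' 22 0) (fst \<sigma>' 21 0) \<sigma>' \<and>
      240 * (c - fst \<sigma>' 22 0) + 20 \<le> t" for t \<sigma>'
  show ?thesis
    unfolding contract_loop_def
  proof (rule runs_Loop[where I = J])
    show "J (240 * c + 20) \<sigma>" using C i z by (simp add: J_def contract_frame_refl)
    fix t and \<sigma>1 :: store assume J: "J t \<sigma>1"
    have frame: "contract_frame m j \<sigma> \<sigma>1" using J by (simp add: J_def)
    note s1 = contract_frame_main_state[OF frame s]
    have same_parent: "same_level m (Suc j) \<sigma> \<sigma>1" using frame by (simp add: contract_frame_def)
    have c1: "fst \<sigma>1 13 (Suc j) = c" using same_parent c by (simp add: same_level_def)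
    have j1: "fst \<sigma>1 19 0 = j" using s1 by (simp add: main_state_def)
    have ic: "fst \<sigma>1 22 0 \<le> c" "240 * (c - fst \<sigma>1 22 0) + 20 \<le> t" using J by (simp_all add: J_def)
    let ?c = "NLess (var 22) (NCell 13 parent_level)"
    let ?p = "load_node ;; store_node ;; set_var 22 (NPlus (var 22) (NConst 1))"
    show "bfits W \<sigma>1 ?c"
      using ic c1 j1 cm jm lin by (simp add: parent_level_def)
    have val: "bval \<sigma>1 ?c \<longleftrightarrow> fst \<sigma>1 22 0 < c"
      using c1 j1 by (simp add: parent_level_def)
    have cost: "bcost ?c = 8" by (simp add: parent_level_def)
    show "1 + bcost ?c \<le> t \<and> contract_frame m j \<sigma> \<sigma>1 \<and>
      contracting_store n m rk j p q xs c (fst \<sigma>1 21 0) \<sigma>1"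
      if "\<not> bval \<sigma>1 ?c"
    proof -
      have "fst \<sigma>1 22 0 = c" using that ic unfolding val by simp
      then show ?thesis using J unfolding cost by (simp add: J_def)
    qed
    show "\<exists>u t'. runs W ?p \<sigma>1 u (J t') \<and>
      1 + bcost ?c + u + t' \<le> t"
      if "bval \<sigma>1 ?c"
    proof (intro exI conjI)
      define i where "i = fst \<sigma>1 22 0"
      have i: "i < c" using that unfolding val i_def .
      have same1: "rows_eq m (Suc j) xs V I \<sigma>1"
        using same same_parent by (simp add: same_level_def)
      have C1: "contracting_store n m rk j p q xs i (fst \<sigma>1 21 0) \<sigma>1"
        using J by (simp add: J_def i_def)
      show "runs W ?p \<sigma>1 220
          (J (240 * (c - Suc i) + 20))"
        by (rule runs_mono[OF runs_contract_step[OF W m s1 j rk G same1 C1 i_def[symmetric] i refl]])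
          (use frame i in \<open>auto simp: J_def intro: contract_frame_trans\<close>)
      show "1 + bcost ?c + 220 + (240 * (c - Suc i) + 20) \<le> t"
        using ic(2) i unfolding cost i_def by simp
    qed
  qed
qed

text \<open>The time depends on the length of the parent's list, the length of the result only on
  \<open>j\<close>; so a level is cheap to rebuild once its parent is short.\<close>

lemma runs_contract:
  assumes W: "fits_word m W" and m: "m = n * n" and s: "main_state n m D rk j p q \<sigma>" and j: "j < height m"
    and rk: "\<And>x. x < m \<Longrightarrow> rk x < m" "inj_on rk {..<m}"
    and G: "level_ok n m rk p q (2 ^ j - 1) (Suc j) \<sigma>"
    and R: "fst \<sigma> 15 m = m" "fst \<sigma> 15 (Suc m) = Suc m"
  shows "runs W contract \<sigma> (240 * fst \<sigma> 13 (Suc j) + 80)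
    (\<lambda>\<sigma>'. contract_frame m j \<sigma> \<sigma>' \<and> level_ok n m rk p q (2 ^ j - 1) j \<sigma>' \<and> fst \<sigma>' 13 j \<le> 2 * (2 ^ j - 1))"
proof -
  have m1: "1 \<le> m" using W by (simp add: fits_word_def)
  note lin = fits_word_linear[OF W]
  have jm: "j < 4 * m" using j height_le_linear[OF m1] by simp
  define c where "c = fst \<sigma> 13 (Suc j)"
  define xs where "xs = level_row (fst \<sigma> 10) m (Suc j)"
  define V where "V = level_row (fst \<sigma> 11) m (Suc j)"
  define I where "I = level_row (fst \<sigma> 12) m (Suc j)"
  define st where "st = fst \<sigma> 14 (Suc j)"
  have G': "contracted n rk p q (2 ^ j - 1) c xs V I st"
    using G by (simp add: level_ok_def c_def xs_def V_def I_def st_def)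
  define \<sigma>1 where "\<sigma>1 = nupdate (nupdate \<sigma> 21 0 0) 22 0 0"
  have frame1: "contract_frame m j \<sigma> \<sigma>1"
    unfolding \<sigma>1_def by (intro contract_frame_trans[OF _ contract_frame_vars] contract_frame_refl) auto
  \<comment> \<open>No node has been processed yet, so whatever an earlier contraction left in the
    cells of level \<open>j\<close> is irrelevant.\<close>
  have C: "contracting n rk p q (2 ^ j - 1) xs 0 0 xs' V' I' (fst \<sigma> 15)" for xs' V' I'
    using R m by (intro contracting_init) auto
  have run1: "runs W contract_loop \<sigma>1 (240 * c + 20)
    (\<lambda>\<sigma>'. contract_frame m j \<sigma>1 \<sigma>' \<and>
      contracting_store n m rk j p q xs c (fst \<sigma>' 21 0) \<sigma>')"
    using C by (intro runs_contract_loop[OF W m contract_frame_main_state[OF frame1 s] j rk(1) G'])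
      (simp_all add: \<sigma>1_def c_def xs_def V_def I_def)
  let ?finish = "NAssign 13 (var 19) (var 21) ;; NAssign 14 (var 19) (NCell 15 (NCell 14 parent_level))"
  have run2: "runs W ?finish \<sigma>2 30
    (\<lambda>\<sigma>'. contract_frame m j \<sigma> \<sigma>' \<and> level_ok n m rk p q (2 ^ j - 1) j \<sigma>' \<and> fst \<sigma>' 13 j \<le> 2 * (2 ^ j - 1))"
    if \<sigma>2: "contract_frame m j \<sigma>1 \<sigma>2 \<and>
      contracting_store n m rk j p q xs c (fst \<sigma>2 21 0) \<sigma>2" for \<sigma>2
  proof -
    define z where "z = fst \<sigma>2 21 0"
    define \<sigma>3 where "\<sigma>3 = nupdate (nupdate \<sigma>2 13 j z) 14 j (fst \<sigma>2 15 st)"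
    have frame2: "contract_frame m j \<sigma> \<sigma>2" using frame1 \<sigma>2 by (blast intro: contract_frame_trans)
    have j2: "fst \<sigma>2 19 0 = j" using contract_frame_main_state[OF frame2 s] by (simp add: main_state_def)
    have st2: "fst \<sigma>2 14 (Suc j) = st" using frame2 by (simp add: contract_frame_def same_level_def st_def)
    note fin = contracting_final[OF G' \<sigma>2[THEN conjunct2], folded z_def]
    have len: "z \<le> 2 * (2 ^ j - 1)"
      unfolding z_def by (rule contracting_length[OF \<sigma>2[THEN conjunct2]])
        (use rk(2) m G' in \<open>auto simp: contracted_def\<close>)
    have zm: "z \<le> m" using contracted_length[OF fin] m by simp
    have nodes: "y \<le> m + 1" if "y \<in> nodes n xs' z'" "\<And>i. i < z' \<Longrightarrow> xs' i < n * n" for y xs' z'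
      using that m by (force simp: nodes_def)
    have stm: "st \<le> m + 1" using G' by (intro nodes[of st xs c]) (auto simp: contracted_def)
    have st': "fst \<sigma>2 15 st \<le> m + 1"
      using fin by (intro nodes[of _ "level_row (fst \<sigma>2 10) m j" z]) (auto simp: contracted_def)
    have "contract_frame m j \<sigma>2 \<sigma>3"
      by (simp add: \<sigma>3_def contract_frame_def same_level_def)
    with frame2 have frame3: "contract_frame m j \<sigma> \<sigma>3" by (rule contract_frame_trans)
    have "level_ok n m rk p q (2 ^ j - 1) j \<sigma>3"
      using fin by (simp add: level_ok_def \<sigma>3_def)
    moreover have "runs W ?finish \<sigma>2 30
        (\<lambda>\<sigma>'. \<sigma>' = \<sigma>3)"
      using j2 st2 stm st' zm jm lin by (simp add: parent_level_def \<sigma>3_def z_def)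
    ultimately show ?thesis using frame3 len by (elim runs_mono) (simp_all add: \<sigma>3_def)
  qed
  have "runs W (contract_loop ;; ?finish)
      \<sigma>1 (240 * c + 20 + 30)
    (\<lambda>\<sigma>'. contract_frame m j \<sigma> \<sigma>' \<and> level_ok n m rk p q (2 ^ j - 1) j \<sigma>' \<and> fst \<sigma>' 13 j \<le> 2 * (2 ^ j - 1))"
    by (rule runs_Seq[OF run1 run2 order_refl])
  then show ?thesis
    using lin unfolding contract_def by (auto simp: \<sigma>1_def c_def elim!: runs_mono)
qed

section \<open>The uncontracted graph on the top level\<close>

definition store_cell :: "nat \<Rightarrow> nexp \<Rightarrow> program" where
  "store_cell v e = NAssign v (cell (var 9) (var 3)) e"

text \<open>There is no remainder operation, so \<open>x mod n\<close> is computed as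
  \<open>x - x div n * n\<close>; the test against \<open>m - n\<close> asks for a row before the
  last. Listing \<open>m - 1 - x\<close> gives the descending order that \<open>contracted\<close>
  demands.\<close>

definition init_node :: program where
  "init_node = store_cell 10 (NMinus (NMinus (var 2) (NConst 1)) (var 3)) ;;
     Cond (NLess (NPlus (var 3) (NConst 1)) (var 2))
       (Cond (NLess (var 3) (NMinus (var 2) (var 1)))
          (store_cell 11 (NPlus (var 3) (var 1)) ;;
           Cond (BAnd (NLess (NConst 0) (var 3))
               (NLess (NPlus (NMinus (var 3) (NTimes (NDiv (var 3) (var 1)) (var 1))) (NConst 1)) (var 1)))
             (store_cell 12 (NPlus (var 3) (NConst 1))) (store_cell 12 (NPlus (var 2) (NConst 1))))
          (store_cell 11 (NPlus (var 3) (NConst 1)) ;; store_cell 12 (NPlus (var 3) (NConst 1))))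
       (store_cell 11 (var 2) ;; store_cell 12 (NPlus (var 2) (NConst 1)))"

definition init_loop :: program where
  "init_loop = Loop (NLess (var 3) (var 2)) (init_node ;; set_var 3 (NPlus (var 3) (NConst 1)))"

definition init_level :: program where
  "init_level = set_var 3 (NConst 0) ;; init_loop ;; NAssign 13 (var 9) (var 2) ;; NAssign 14 (var 9) (NConst 0) ;;
     NAssign 15 (var 2) (var 2) ;; NAssign 15 (NPlus (var 2) (NConst 1)) (NPlus (var 2) (NConst 1)) ;;
     set_var 16 (NConst 0) ;; set_var 17 (NConst 0) ;; set_var 18 (NConst 0) ;; set_var 24 (NConst 0)"

lemma runs_init_node:
  assumes W: "fits_word m W" and m: "m = n * n" and b: "base n m D \<sigma>" and J: "fst \<sigma> 9 0 = J" "J \<le> 4 * m"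
    and x: "fst \<sigma> 3 0 = x" "x < m"
  shows "runs W init_node \<sigma> 100 (\<lambda>\<sigma>'. \<sigma>' = nupdate (nupdate (nupdate \<sigma> 10 (J * m + x) (m - 1 - x))
    11 (J * m + x) (next_valid n x)) 12 (J * m + x) (next_invalid n x))"
proof -
  note lin = fits_word_linear[OF W]
  have c: "J * m \<le> W" "J * m + x \<le> W" using fits_word_cell[OF W J(2), of x] x by auto
  have m1: "1 \<le> m" using W by (simp add: fits_word_def)
  then have n: "1 \<le> n" "n \<le> m" using m by (cases n; simp)+
  have row: "n * (n - 1) = m - n" by (simp add: m diff_mult_distrib2)
  have mod: "x - x div n * n = x mod n" by (simp add: minus_div_mult_eq_mod)
  have lt: "x mod n < n" "x div n \<le> x" "x mod n \<le> x" "x div n * n \<le> x" using n by simp_all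
  have mod_test: "x mod n + 1 < n \<longleftrightarrow> x mod n \<noteq> n - 1" using lt(1) by linarith
  have nv: "next_valid n x = (if x + 1 < m then if x < m - n then x + n else x + 1 else m)"
    using x unfolding next_valid_def row m[symmetric] by auto
  \<comment> \<open>A start node in the last row means \<open>n = 1\<close>, and then it is also the
    end node. So the case \<open>x = 0\<close> of \<open>next_invalid\<close> needs a test of its
    own only before the last row.\<close>
  have "\<not> x < m - n \<Longrightarrow> x + 1 < m \<Longrightarrow> x \<noteq> 0"
  proof
    assume 0: "\<not> x < m - n" "x + 1 < m" "x = 0"
    then have "2 \<le> n" using n m by (cases "n = 1") auto
    then have "n * 2 \<le> m" unfolding m by (rule mult_le_mono2)
    then show False using 0 n by simp
  qed
  then have ni: "next_invalid n x = (if x + 1 < m then if x < m - n then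
      if 0 < x \<and> x mod n + 1 < n then x + 1 else m + 1 else x + 1 else m + 1)"
    using x unfolding next_invalid_def row m[symmetric] mod_test by auto
  have W1: "m - 1 - x \<le> W" "m - 1 \<le> W" "m - n \<le> W" "x + n \<le> W" "x mod n + 1 \<le> W" "n \<le> W" "x \<le> W" "x div n \<le> W"
      "x div n * n \<le> W" "x mod n \<le> W" "x + 1 \<le> W" "m + 1 \<le> W" "m \<le> W" "1 \<le> W" "J \<le> W"
    using lin n x lt J(2) by linarith+
  show ?thesis
    using b J x c W1 unfolding init_node_def nv ni
    by (simp add: base_def cell_def store_cell_def mod)
qed

lemma runs_init_loop:
  assumes W: "fits_word m W" and m: "m = n * n" and b: "base n m D \<sigma>" and J: "fst \<sigma> 9 0 = J" "J \<le> 4 * m"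
    and x: "fst \<sigma> 3 0 = 0"
  shows "runs W init_loop \<sigma> (130 * m + 20) (\<lambda>\<sigma>'. base n m D \<sigma>' \<and>
    (\<forall>v. v \<notin> {3, 10, 11, 12} \<longrightarrow> fst \<sigma>' v = fst \<sigma> v) \<and> snd \<sigma>' = snd \<sigma> \<and>
    (rows_eq m J (\<lambda>y. m - 1 - y) (next_valid n) (next_invalid n) \<sigma>'))"
proof -
  define I where "I t \<sigma>' \<longleftrightarrow> base n m D \<sigma>' \<and> fst \<sigma>' 3 0 \<le> m \<and>
    (\<forall>v. v \<notin> {3, 10, 11, 12} \<longrightarrow> fst \<sigma>' v = fst \<sigma> v) \<and> snd \<sigma>' = snd \<sigma> \<and>
    (\<forall>y<fst \<sigma>' 3 0. level_row (fst \<sigma>' 10) m J y = m - 1 - y \<and> level_row (fst \<sigma>' 11) m J y = next_valid n y \<and>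
      level_row (fst \<sigma>' 12) m J y = next_invalid n y) \<and> 130 * (m - fst \<sigma>' 3 0) + 20 \<le> t" for t \<sigma>'
  note lin = fits_word_linear[OF W]
  show ?thesis
    unfolding init_loop_def
  proof (rule runs_Loop[where I = I])
    show "I (130 * m + 20) \<sigma>" using b x by (simp add: I_def)
    fix t and \<sigma>1 :: store assume I: "I t \<sigma>1"
    have b1: "base n m D \<sigma>1" and x1: "fst \<sigma>1 3 0 \<le> m" and t: "130 * (m - fst \<sigma>1 3 0) + 20 \<le> t"
      using I by (simp_all add: I_def)
    let ?c = "NLess (var 3) (var 2)"
    let ?p = "init_node ;; set_var 3 (NPlus (var 3) (NConst 1))"
    show "bfits W \<sigma>1 ?c" using b1 x1 lin by (simp add: base_def)
    show "1 + bcost ?c \<le> t \<and> base n m D \<sigma>1 \<and>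
      (\<forall>v. v \<notin> {3, 10, 11, 12} \<longrightarrow> fst \<sigma>1 v = fst \<sigma> v) \<and> snd \<sigma>1 = snd \<sigma> \<and>
      (rows_eq m J (\<lambda>y. m - 1 - y) (next_valid n) (next_invalid n) \<sigma>1)" if "\<not> bval \<sigma>1 ?c"
    proof -
      have "fst \<sigma>1 3 0 = m" using that b1 x1 by (simp add: base_def)
      then show ?thesis using I by (simp add: I_def)
    qed
    show "\<exists>u t'. runs W ?p \<sigma>1 u (I t') \<and>
        1 + bcost ?c + u + t' \<le> t" if "bval \<sigma>1 ?c"
    proof (intro exI conjI)
      define x where "x = fst \<sigma>1 3 0"
      have x: "x < m" using that b1 by (simp add: x_def base_def)
      define \<sigma>2 where "\<sigma>2 = nupdate (nupdate (nupdate \<sigma>1 10 (J * m + x) (m - 1 - x))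
        11 (J * m + x) (next_valid n x)) 12 (J * m + x) (next_invalid n x)"
      have J1: "fst \<sigma>1 9 0 = J" using I J by (simp add: I_def)
      have run1: "runs W init_node \<sigma>1 100 (\<lambda>\<sigma>'. \<sigma>' = \<sigma>2)"
        unfolding \<sigma>2_def by (rule runs_init_node[OF W m b1 J1 J(2) x_def[symmetric] x])
      have "runs W (set_var 3 (NPlus (var 3) (NConst 1))) \<sigma>2 10 (I (130 * (m - Suc x) + 20))"
        using I b x lin by (simp add: \<sigma>2_def I_def x_def[symmetric] base_def level_row_upd_same less_Suc_eq)
      then show "runs W ?p \<sigma>1 110 (I (130 * (m - Suc x) + 20))"
        by (rule runs_Seq_exact[OF run1]) simp
      show "1 + bcost ?c + 110 + (130 * (m - Suc x) + 20) \<le> t"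
        using t x by (simp add: x_def)
    qed
  qed
qed

lemma runs_init_level:
  assumes W: "fits_word m W" and m: "m = n * n" and b: "base n m D \<sigma>" and J: "fst \<sigma> 9 0 = J" "J \<le> 4 * m"
  shows "runs W init_level \<sigma> (130 * m + 100) (\<lambda>\<sigma>'. base n m D \<sigma>' \<and>
    (\<forall>v. v \<notin> {3, 10, 11, 12, 13, 14, 15, 16, 17, 18, 24} \<longrightarrow> fst \<sigma>' v = fst \<sigma> v) \<and> snd \<sigma>' = snd \<sigma> \<and>
    (\<forall>rk p q K. level_ok n m rk p q K J \<sigma>') \<and> fst \<sigma>' 13 J = m \<and> fst \<sigma>' 15 m = m \<and> fst \<sigma>' 15 (Suc m) = Suc m \<and>
    fst \<sigma>' 16 0 = 0 \<and> fst \<sigma>' 17 0 = 0 \<and> fst \<sigma>' 18 0 = 0 \<and> fst \<sigma>' 24 0 = 0)"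
    (is "runs W init_level \<sigma> _ ?Q")
proof -
  note lin = fits_word_linear[OF W]
  have "0 < m" using W by (simp add: fits_word_def)
  then have n: "0 < n" using m by (cases n) auto
  define \<sigma>1 where "\<sigma>1 = nupdate \<sigma> 3 0 0"
  have run1: "runs W init_loop \<sigma>1 (130 * m + 20) (\<lambda>\<sigma>'. base n m D \<sigma>' \<and>
    (\<forall>v. v \<notin> {3, 10, 11, 12} \<longrightarrow> fst \<sigma>' v = fst \<sigma>1 v) \<and> snd \<sigma>' = snd \<sigma>1 \<and>
    (rows_eq m J (\<lambda>y. m - 1 - y) (next_valid n) (next_invalid n) \<sigma>'))"
    by (rule runs_init_loop[OF W m _ _ J(2)]) (use b J in \<open>simp_all add: \<sigma>1_def base_def\<close>)
  let ?reset = "NAssign 13 (var 9) (var 2) ;; NAssign 14 (var 9) (NConst 0) ;;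
     NAssign 15 (var 2) (var 2) ;; NAssign 15 (NPlus (var 2) (NConst 1)) (NPlus (var 2) (NConst 1)) ;;
     set_var 16 (NConst 0) ;; set_var 17 (NConst 0) ;; set_var 18 (NConst 0) ;; set_var 24 (NConst 0)"
  have run2: "runs W ?reset \<sigma>2 70 ?Q"
    if \<sigma>2: "base n m D \<sigma>2 \<and>
    (\<forall>v. v \<notin> {3, 10, 11, 12} \<longrightarrow> fst \<sigma>2 v = fst \<sigma>1 v) \<and> snd \<sigma>2 = snd \<sigma>1 \<and>
    (rows_eq m J (\<lambda>y. m - 1 - y) (next_valid n) (next_invalid n) \<sigma>2)" for \<sigma>2
  proof -
    have "contracted n rk p q K m (level_row (fst \<sigma>2 10) m J) (level_row (fst \<sigma>2 11) m J)
        (level_row (fst \<sigma>2 12) m J) 0" for rk p q K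
      using \<sigma>2 unfolding m by (intro contracted_cong[OF contracted_full[OF n]]) auto
    moreover have "fst \<sigma>2 9 0 = J" using \<sigma>2 J by (simp add: \<sigma>1_def)
    ultimately show ?thesis
      using \<sigma>2 b J lin by (simp add: level_ok_def base_def \<sigma>1_def)
  qed
  have "runs W (init_loop ;; ?reset)
     \<sigma>1 (130 * m + 20 + 70) ?Q"
    by (rule runs_Seq[OF run1 run2 order_refl])
  then show ?thesis
    using lin unfolding init_level_def by (auto simp: \<sigma>1_def elim!: runs_mono)
qed

section \<open>Gap and ratio as one objective, and the invariant of the search\<close>

definition admissible :: "bool \<Rightarrow> real \<Rightarrow> bool" where
  "admissible ratio s \<longleftrightarrow> (if ratio then 0 < s else 0 \<le> s)"

definition range_value :: "bool \<Rightarrow> real \<Rightarrow> real \<Rightarrow> real" where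
  "range_value ratio s t = (if ratio then t / s else t - s)"

text \<open>This monotonicity lets the search treat gap and ratio alike: for a given left end the
  least feasible right end is best.\<close>

lemma range_value_mono:
  "admissible ratio s' \<Longrightarrow> admissible ratio s \<Longrightarrow> 0 \<le> t \<Longrightarrow> s \<le> s' \<Longrightarrow> t' \<le> t \<Longrightarrow> range_value ratio s' t' \<le> range_value ratio s t"
  by (auto simp: admissible_def range_value_def intro: frac_le order_trans[OF divide_right_mono divide_left_mono] )

definition feasible_window :: "nat \<Rightarrow> (nat \<Rightarrow> nat) \<Rightarrow> nat \<Rightarrow> nat \<Rightarrow> bool" where
  "feasible_window n rk p q \<longleftrightarrow> walk n (in_window rk p q) 0 = n * n"

lemma feasible_window_mono:
  assumes "1 \<le> n" "feasible_window n rk p' q'" "p \<le> p'" "q' \<le> q"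
  shows "feasible_window n rk p q"
  using assms(2) unfolding feasible_window_def
  by (rule walk_mono[OF assms(1)]) (use assms(3,4) in \<open>auto simp: in_window_def\<close>)

lemma feasible_window_nonempty:
  assumes "1 \<le> n" "feasible_window n rk p q"
  shows "p < q"
proof (rule ccontr)
  assume "\<not> p < q"
  then have "\<not> in_window rk p q 0" by (simp add: in_window_def)
  moreover have 0: "0 < n * n" using assms(1) by simp
  ultimately have "walk n (in_window rk p q) 0 = n * n + 1"
    by (simp add: walk_step[OF 0] next_invalid_def walk_terminal)
  then show False using assms(2) by (simp add: feasible_window_def)
qed

text \<open>The invariant of the two pointers. The two middle clauses together leave no feasible
  window unaccounted for, whichever pointer moves next; the last one keeps \<open>best\<close>
  attained.\<close>

definition searching :: "bool \<Rightarrow> nat \<Rightarrow> nat \<Rightarrow> (nat \<Rightarrow> nat) \<Rightarrow> (nat \<Rightarrow> real) \<Rightarrow> nat \<Rightarrow> nat \<Rightarrow> nat \<Rightarrow> real \<Rightarrow> bool" where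
  "searching ratio n m rk Ds p q found best \<longleftrightarrow> p \<le> q \<and> q \<le> m \<and>
     (\<forall>p' q'. p \<le> p' \<longrightarrow> feasible_window n rk p' q' \<longrightarrow> q \<le> q') \<and>
     (\<forall>p' q'. p' < p \<longrightarrow> q' \<le> m \<longrightarrow> feasible_window n rk p' q' \<longrightarrow> admissible ratio (Ds p') \<longrightarrow>
        found \<noteq> 0 \<and> best \<le> range_value ratio (Ds p') (Ds (q' - 1))) \<and>
     (found \<noteq> 0 \<longrightarrow> (\<exists>p' q'. q' \<le> m \<and> feasible_window n rk p' q' \<and> admissible ratio (Ds p') \<and>
        best = range_value ratio (Ds p') (Ds (q' - 1))))"

text \<open>A feasible window that ends at \<open>q\<close> and starts at \<open>p\<close> or later
  would make \<open>[p, q)\<close> feasible as well, so none ends at \<open>q\<close>.\<close>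

lemma searching_infeasible:
  assumes n: "1 \<le> n" and S: "searching ratio n m rk Ds p q found best" and inf: "\<not> feasible_window n rk p q" and q: "q < m"
  shows "searching ratio n m rk Ds p (Suc q) found best"
proof -
  have "Suc q \<le> q'" if "p \<le> p'" "feasible_window n rk p' q'" for p' q'
  proof -
    have "q \<le> q'" using S that unfolding searching_def by blast
    moreover have "q \<noteq> q'" using feasible_window_mono[OF n that(2,1), of q] inf by auto
    ultimately show ?thesis by simp
  qed
  then show ?thesis using S q unfolding searching_def by simp
qed

text \<open>By the invariant \<open>q\<close> is the least right end for the left end
  \<open>p\<close>, so \<open>v\<close> is optimal among the windows starting at \<open>p\<close>,
  and \<open>p\<close> can be left for good.\<close>

lemma searching_feasible:
  assumes n: "1 \<le> n" and S: "searching ratio n m rk Ds p q found best" and feas: "feasible_window n rk p q"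
    and sorted: "\<And>i j. i \<le> j \<Longrightarrow> j < m \<Longrightarrow> Ds i \<le> Ds j" and nonneg: "\<And>i. i < m \<Longrightarrow> 0 \<le> Ds i"
    and v: "v = range_value ratio (Ds p) (Ds (q - 1))"
  shows "admissible ratio (Ds p) \<Longrightarrow> found = 0 \<or> v < best \<Longrightarrow> searching ratio n m rk Ds (Suc p) q 1 v"
    and "\<not> (admissible ratio (Ds p) \<and> (found = 0 \<or> v < best)) \<Longrightarrow> searching ratio n m rk Ds (Suc p) q found best"
proof -
  have pq: "p < q" "q \<le> m" using feasible_window_nonempty[OF n feas] S by (auto simp: searching_def)
  have future: "\<And>p' q'. p \<le> p' \<Longrightarrow> feasible_window n rk p' q' \<Longrightarrow> q \<le> q'"
    and past: "\<And>p' q'. p' < p \<Longrightarrow> q' \<le> m \<Longrightarrow> feasible_window n rk p' q' \<Longrightarrow> admissible ratio (Ds p') \<Longrightarrow>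
        found \<noteq> 0 \<and> best \<le> range_value ratio (Ds p') (Ds (q' - 1))"
    and witness: "found \<noteq> 0 \<longrightarrow> (\<exists>p' q'. q' \<le> m \<and> feasible_window n rk p' q' \<and> admissible ratio (Ds p') \<and>
        best = range_value ratio (Ds p') (Ds (q' - 1)))"
    using S unfolding searching_def by blast+
  then have future': "\<And>p' q'. Suc p \<le> p' \<Longrightarrow> feasible_window n rk p' q' \<Longrightarrow> q \<le> q'"
    using Suc_leD by blast
  have now: "v \<le> range_value ratio (Ds p) (Ds (q' - 1))"
    if "q' \<le> m" "feasible_window n rk p q'" "admissible ratio (Ds p)" for q'
  proof -
    have "q \<le> q'" using future that by blast
    then have "Ds (q - 1) \<le> Ds (q' - 1)" "0 \<le> Ds (q' - 1)" using that pq by (auto intro: sorted nonneg)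
    then show ?thesis unfolding v using that by (intro range_value_mono) auto
  qed
  show "searching ratio n m rk Ds (Suc p) q 1 v" if A: "admissible ratio (Ds p)" "found = 0 \<or> v < best"
    unfolding searching_def
  proof (intro conjI allI impI)
    fix p' q' assume *: "p' < Suc p" "q' \<le> m" "feasible_window n rk p' q'" "admissible ratio (Ds p')"
    show "v \<le> range_value ratio (Ds p') (Ds (q' - 1))"
      using * now[of q'] past[of p' q'] A(2) by (cases "p' = p") force+
  next
    show "\<exists>p' q'. q' \<le> m \<and> feasible_window n rk p' q' \<and> admissible ratio (Ds p') \<and>
        v = range_value ratio (Ds p') (Ds (q' - 1))"
      using pq feas A(1) v by blast
  qed (use pq future' in auto)
  show "searching ratio n m rk Ds (Suc p) q found best"
    if B: "\<not> (admissible ratio (Ds p) \<and> (found = 0 \<or> v < best))"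
    unfolding searching_def
  proof (intro conjI allI)
    fix p' q'
    show "p' < Suc p \<longrightarrow> q' \<le> m \<longrightarrow> feasible_window n rk p' q' \<longrightarrow> admissible ratio (Ds p') \<longrightarrow>
        found \<noteq> 0 \<and> best \<le> range_value ratio (Ds p') (Ds (q' - 1))"
      using now[of q'] past[of p' q'] B by (cases "p' = p") force+
  qed (use pq future' witness in auto)
qed

text \<open>The amortisation: the graph of level \<open>j\<close> is rebuilt in
  \<open>2 ^ (J - j)\<close> of the \<open>2 ^ J\<close> rounds at a cost proportional to
  \<open>2 ^ j\<close>, so every level contributes \<open>2 ^ J\<close>.\<close>

lemma sum_powers_dividing:
  "(\<Sum>c<(2::nat) ^ J. \<Sum>j<J. if 2 ^ j dvd c then 2 ^ j else 0) = J * (2 ^ J :: nat)"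
proof -
  have card: "card {c \<in> {..<2 ^ J}. (2::nat) ^ j dvd c} * 2 ^ j = 2 ^ J" if "j < J" for j
  proof -
    have J: "(2::nat) ^ J = 2 ^ (J - j) * 2 ^ j" using that by (simp flip: power_add)
    have "{c \<in> {..<2 ^ J}. (2::nat) ^ j dvd c} = (\<lambda>k. k * 2 ^ j) ` {..<2 ^ (J - j)}"
      unfolding J by (auto simp: dvd_def mult.commute)
    moreover have "inj_on (\<lambda>k. k * (2::nat) ^ j) {..<2 ^ (J - j)}" by (auto simp: inj_on_def)
    ultimately show ?thesis using J by (simp add: card_image)
  qed
  have "(\<Sum>c<(2::nat) ^ J. \<Sum>j<J. if 2 ^ j dvd c then 2 ^ j else (0::nat)) = (\<Sum>j<J. \<Sum>c<(2::nat) ^ J. if 2 ^ j dvd c then 2 ^ j else 0)"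
    by (rule sum.swap)
  also have "\<dots> = (\<Sum>j<J. card {c \<in> {..<2 ^ J}. (2::nat) ^ j dvd c} * 2 ^ j)"
    by (intro sum.cong refl) (simp flip: sum.inter_filter)
  also have "\<dots> = (\<Sum>j<J. 2 ^ J)" by (intro sum.cong refl card) simp
  finally show ?thesis by simp
qed


section \<open>Two-pointer search\<close>

text \<open>
  The graph of level \<open>j\<close> is built for \<open>2\<^sup>j - 1\<close> further steps, of which \<open>c mod 2\<^sup>j\<close> are already
  used up at step \<open>c\<close>; the top level is never rebuilt.
\<close>

definition levels_ok :: "nat \<Rightarrow> nat \<Rightarrow> (nat \<Rightarrow> nat) \<Rightarrow> nat \<Rightarrow> nat \<Rightarrow> nat \<Rightarrow> nat \<Rightarrow> store \<Rightarrow> bool" where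
  "levels_ok n m rk p q c j0 \<sigma> \<longleftrightarrow> (\<forall>p q K. level_ok n m rk p q K (height m) \<sigma>) \<and>
     fst \<sigma> 13 (height m) = m \<and> fst \<sigma> 15 m = m \<and> fst \<sigma> 15 (Suc m) = Suc m \<and>
     (\<forall>j<height m. j0 \<le> j \<or> \<not> 2 ^ j dvd c \<longrightarrow>
        level_ok n m rk p q (2 ^ j - 1 - c mod 2 ^ j) j \<sigma> \<and> fst \<sigma> 13 j \<le> 2 * (2 ^ j - 1))"

text \<open>Levels are treated from the top downwards, so that the parent is up to date when a graph
  is rebuilt from it; \<open>j0\<close> in \<open>levels_ok\<close> is the level reached so far. The
  test says that \<open>2 ^ j\<close> divides the step number.\<close>

definition refresh_step :: program where
  "refresh_step = set_var 19 (NMinus (var 19) (NConst 1)) ;; set_var 20 (NDiv (var 20) (NConst 2)) ;;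
     Cond (BNot (NLess (NTimes (NDiv (var 18) (var 20)) (var 20)) (var 18))) contract Skip"

definition refresh_loop :: program where
  "refresh_loop = Loop (NLess (NConst 0) (var 19)) refresh_step"

definition refresh :: program where
  "refresh = set_var 19 (var 9) ;; set_var 20 (var 8) ;; refresh_loop"

definition refresh_frame :: "store \<Rightarrow> store \<Rightarrow> bool" where
  "refresh_frame \<sigma> \<sigma>' \<longleftrightarrow> snd \<sigma>' = snd \<sigma> \<and>
     (\<forall>v. v \<notin> {3, 4, 5, 10, 11, 12, 13, 14, 15, 19, 20, 21, 22, 23} \<longrightarrow> fst \<sigma>' v = fst \<sigma> v)"

lemma refresh_frame_refl: "refresh_frame \<sigma> \<sigma>"
  and refresh_frame_trans: "refresh_frame \<sigma> \<sigma>' \<Longrightarrow> refresh_frame \<sigma>' \<sigma>'' \<Longrightarrow> refresh_frame \<sigma> \<sigma>''"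
  by (simp_all add: refresh_frame_def)

lemma contract_frame_refresh_frame: "contract_frame m j \<sigma> \<sigma>' \<Longrightarrow> refresh_frame \<sigma> \<sigma>'"
  by (simp add: contract_frame_def refresh_frame_def)

text \<open>If \<open>2 ^ j\<close> divides \<open>c\<close>, then \<open>c mod 2 ^ Suc j\<close> is
  0 or \<open>2 ^ j\<close>, so the parent still allows at least \<open>2 ^ j - 1\<close> moves,
  just what the new graph needs. Its list has at most \<open>2 * (2 ^ Suc j - 1)\<close> nodes below
  the top level; on the top level it has \<open>m < 2 ^ j\<close> nodes by the choice of
  \<open>height\<close>.\<close>

lemma levels_ok_parent:
  assumes L: "levels_ok n m rk p q c (Suc j) \<sigma>" and j: "j < height m" and c: "2 ^ j dvd c"
  shows "level_ok n m rk p q (2 ^ j - 1) (Suc j) \<sigma>" and "fst \<sigma> 13 (Suc j) \<le> 4 * 2 ^ j"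
proof -
  have cm: "c mod 2 ^ Suc j \<le> 2 ^ j"
  proof -
    obtain k where k: "c = 2 ^ j * k" using c by (auto simp: dvd_def)
    have "c mod 2 ^ Suc j = 2 ^ j * (k mod 2)"
      unfolding k power_Suc2 by (rule mult_mod_right[symmetric])
    also have "\<dots> \<le> 2 ^ j * 1" by (intro mult_le_mono2) linarith
    finally show ?thesis by simp
  qed
  have "level_ok n m rk p q (2 ^ j - 1) (Suc j) \<sigma> \<and> fst \<sigma> 13 (Suc j) \<le> 4 * 2 ^ j"
  proof (cases "Suc j = height m")
    case True
    have "2 * m < 2 * 2 ^ j" using less_height[of m] by (simp add: True[symmetric])
    moreover have "level_ok n m rk p q (2 ^ j - 1) (height m) \<sigma>" "fst \<sigma> 13 (height m) = m"
      using L by (simp_all add: levels_ok_def)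
    ultimately show ?thesis unfolding True by simp
  next
    case False
    then have j1: "Suc j < height m" using j by simp
    have all: "\<forall>j'<height m. Suc j \<le> j' \<or> \<not> 2 ^ j' dvd c \<longrightarrow>
        level_ok n m rk p q (2 ^ j' - 1 - c mod 2 ^ j') j' \<sigma> \<and> fst \<sigma> 13 j' \<le> 2 * (2 ^ j' - 1)"
      using L unfolding levels_ok_def by (elim conjE)
    have ok: "level_ok n m rk p q (2 ^ Suc j - 1 - c mod 2 ^ Suc j) (Suc j) \<sigma> \<and> fst \<sigma> 13 (Suc j) \<le> 2 * (2 ^ Suc j - 1)"
      using all j1 by blast
    have K: "2 ^ j - 1 \<le> 2 ^ Suc j - 1 - c mod 2 ^ Suc j" using cm by simp
    have "level_ok n m rk p q (2 ^ j - 1) (Suc j) \<sigma>"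
      unfolding level_ok_def
      by (rule contracted_subrange[OF ok[THEN conjunct1, unfolded level_ok_def]]) (use K in linarith)+
    moreover have "2 * (2 ^ Suc j - 1) \<le> 4 * (2::nat) ^ j" by simp
    ultimately show ?thesis using ok by (meson order_trans)
  qed
  then show "level_ok n m rk p q (2 ^ j - 1) (Suc j) \<sigma>" "fst \<sigma> 13 (Suc j) \<le> 4 * 2 ^ j" by blast+
qed

lemma runs_refresh_step:
  assumes W: "fits_word m W" and m: "m = n * n" and s: "main_state n m D rk (Suc j) p q \<sigma>"
    and c: "fst \<sigma> 18 0 = c" "c \<le> 4 * m" and L: "levels_ok n m rk p q c (Suc j) \<sigma>"
    and rk: "\<And>x. x < m \<Longrightarrow> rk x < m" "inj_on rk {..<m}"
  shows "runs W refresh_step \<sigma> (60 + (if 2 ^ j dvd c then 1100 * 2 ^ j else 0))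
    (\<lambda>\<sigma>'. main_state n m D rk j p q \<sigma>' \<and> levels_ok n m rk p q c j \<sigma>' \<and> refresh_frame \<sigma> \<sigma>')"
proof -
  note lin = fits_word_linear[OF W]
  have m1: "1 \<le> m" using W by (simp add: fits_word_def)
  have j: "j < height m" using s by (simp add: main_state_def)
  have P: "fst \<sigma> 19 0 = Suc j" "fst \<sigma> 20 0 = 2 * 2 ^ j" using s by (simp_all add: main_state_def)
  have "(2::nat) * 2 ^ j \<le> 2 ^ height m"
    using j power_increasing[of "Suc j" "height m" "2::nat"] by simp
  then have P4: "2 * 2 ^ j \<le> 4 * m" "(2::nat) ^ j \<le> 4 * m" using power_height_le[OF m1] by linarith+
  have j4: "Suc j \<le> 4 * m" using j height_le_linear[OF m1] by simp
  define \<sigma>1 where "\<sigma>1 = nupdate (nupdate \<sigma> 19 0 j) 20 0 (2 ^ j)"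
  have s1: "main_state n m D rk j p q \<sigma>1" using s by (simp add: main_state_def base_def \<sigma>1_def)
  have level1: "level_ok n m rk p' q' K j' \<sigma>1 \<longleftrightarrow> level_ok n m rk p' q' K j' \<sigma>" for p' q' K j'
    by (simp add: level_ok_def \<sigma>1_def)
  have L1: "levels_ok n m rk p q c (Suc j) \<sigma>1" using L unfolding levels_ok_def level1 by (simp add: \<sigma>1_def)
  have frame1: "refresh_frame \<sigma> \<sigma>1" by (simp add: refresh_frame_def \<sigma>1_def)
  have div: "c div 2 ^ j * 2 ^ j \<le> c" "c div 2 ^ j \<le> c" by simp_all
  have val: "\<not> c div 2 ^ j * 2 ^ j < c \<longleftrightarrow> 2 ^ j dvd c"
  proof
    assume "\<not> c div 2 ^ j * 2 ^ j < c"
    then have "c = c div 2 ^ j * 2 ^ j" using div(1) by linarith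
    then show "2 ^ j dvd c" by (rule dvdI[OF trans[OF _ mult.commute]])
  qed simp
  have run2: "runs W (if 2 ^ j dvd c then contract else Skip) \<sigma>1 (1 + (if 2 ^ j dvd c then 1100 * 2 ^ j else 0))
    (\<lambda>\<sigma>'. main_state n m D rk j p q \<sigma>' \<and> levels_ok n m rk p q c j \<sigma>' \<and> refresh_frame \<sigma> \<sigma>')"
  proof (cases "2 ^ j dvd c")
    case True
    note parent = levels_ok_parent[OF L1 j True]
    have R: "fst \<sigma>1 15 m = m" "fst \<sigma>1 15 (Suc m) = Suc m" using L1 by (simp_all add: levels_ok_def)
    have post: "levels_ok n m rk p q c j \<sigma>'"
      if \<sigma>': "contract_frame m j \<sigma>1 \<sigma>' \<and> level_ok n m rk p q (2 ^ j - 1) j \<sigma>' \<and> fst \<sigma>' 13 j \<le> 2 * (2 ^ j - 1)" for \<sigma>'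
    proof -
      have same: "same_level m j' \<sigma>1 \<sigma>'" if "j' \<noteq> j" for j' using \<sigma>' that by (simp add: contract_frame_def)
      show ?thesis
        unfolding levels_ok_def
      proof (intro conjI allI impI)
        show "level_ok n m rk p' q' K (height m) \<sigma>'" for p' q' K
          by (rule level_ok_same[OF _ m same]) (use L1 j in \<open>auto simp: levels_ok_def\<close>)
        show "fst \<sigma>' 13 (height m) = m"
          using same[of "height m"] L1 j by (simp add: levels_ok_def same_level_def)
        show "fst \<sigma>' 15 m = m" "fst \<sigma>' 15 (Suc m) = Suc m" using \<sigma>' R by (simp_all add: contract_frame_def)
        fix j' assume j': "j' < height m" "j \<le> j' \<or> \<not> 2 ^ j' dvd c"
        have "level_ok n m rk p q (2 ^ j' - 1 - c mod 2 ^ j') j' \<sigma>' \<and> fst \<sigma>' 13 j' \<le> 2 * (2 ^ j' - 1)"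
        proof (cases "j' = j")
          case True
          then show ?thesis using \<sigma>' \<open>2 ^ j dvd c\<close> by auto
        next
          case False
          then have "Suc j \<le> j' \<or> \<not> 2 ^ j' dvd c" using j' by auto
          then have "level_ok n m rk p q (2 ^ j' - 1 - c mod 2 ^ j') j' \<sigma>1" "fst \<sigma>1 13 j' \<le> 2 * (2 ^ j' - 1)"
            using L1 j'(1) unfolding levels_ok_def by blast+
          then show ?thesis using level_ok_same[OF _ m same[OF False]] same[OF False] by (simp add: same_level_def)
        qed
        then show "level_ok n m rk p q (2 ^ j' - 1 - c mod 2 ^ j') j' \<sigma>'" "fst \<sigma>' 13 j' \<le> 2 * (2 ^ j' - 1)" by blast+
      qed
    qed
    \<comment> \<open>The parent has at most \<open>4 * 2 ^ j\<close> nodes at 240 steps each, and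
      \<open>80 \<le> 80 * 2 ^ j\<close> absorbs the fixed part; 1100 exceeds the sum 1040.\<close>
    have "(1::nat) \<le> 2 ^ j" by simp
    then have cost: "240 * fst \<sigma>1 13 (Suc j) + 80 \<le> 1 + 1100 * 2 ^ j" using parent(2) by linarith
    have "runs W contract \<sigma>1 (1 + 1100 * 2 ^ j)
        (\<lambda>\<sigma>'. main_state n m D rk j p q \<sigma>' \<and> levels_ok n m rk p q c j \<sigma>' \<and> refresh_frame \<sigma> \<sigma>')"
    proof (rule runs_mono[OF runs_contract[OF W m s1 j rk parent(1) R] cost])
      fix \<sigma>' assume \<sigma>': "contract_frame m j \<sigma>1 \<sigma>' \<and> level_ok n m rk p q (2 ^ j - 1) j \<sigma>' \<and> fst \<sigma>' 13 j \<le> 2 * (2 ^ j - 1)"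
      then have frame': "contract_frame m j \<sigma>1 \<sigma>'" by (rule conjunct1)
      show "main_state n m D rk j p q \<sigma>' \<and> levels_ok n m rk p q c j \<sigma>' \<and> refresh_frame \<sigma> \<sigma>'"
        using post[OF \<sigma>'] contract_frame_main_state[OF frame' s1]
          refresh_frame_trans[OF frame1 contract_frame_refresh_frame[OF frame']] by blast
    qed
    then show ?thesis using True by simp
  next
    case False
    have "Suc j \<le> j' \<or> \<not> 2 ^ j' dvd c" if "j \<le> j' \<or> \<not> 2 ^ j' dvd c" for j'
      using that False by (cases "j' = j") auto
    then have "levels_ok n m rk p q c j \<sigma>1"
      using L1 unfolding levels_ok_def by blast
    then show ?thesis using False s1 frame1 by simp
  qed
  have W1: "j \<le> W" "Suc j \<le> W" "c \<le> W" "2 ^ j \<le> W" "2 * 2 ^ j \<le> W" "c div 2 ^ j \<le> W" "c div 2 ^ j * 2 ^ j \<le> W" "2 \<le> W" "1 \<le> W"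
    using lin j4 c P4 div by linarith+
  show ?thesis
    using run2 W1 P c val unfolding refresh_step_def
    by (auto simp: \<sigma>1_def elim!: runs_mono)
qed

lemma runs_refresh_loop:
  assumes W: "fits_word m W" and m: "m = n * n" and s: "main_state n m D rk (height m) p q \<sigma>"
    and c: "fst \<sigma> 18 0 = c" "c \<le> 4 * m" and L: "levels_ok n m rk p q c (height m) \<sigma>"
    and rk: "\<And>x. x < m \<Longrightarrow> rk x < m" "inj_on rk {..<m}"
  shows "runs W refresh_loop \<sigma> (80 * height m + (\<Sum>j<height m. if 2 ^ j dvd c then 1100 * 2 ^ j else 0) + 10)
    (\<lambda>\<sigma>'. main_state n m D rk 0 p q \<sigma>' \<and> levels_ok n m rk p q c 0 \<sigma>' \<and> refresh_frame \<sigma> \<sigma>')"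
proof -
  define I where "I t \<sigma>' \<longleftrightarrow> (\<exists>j. main_state n m D rk j p q \<sigma>' \<and> levels_ok n m rk p q c j \<sigma>' \<and> refresh_frame \<sigma> \<sigma>' \<and>
    80 * j + (\<Sum>j<j. if 2 ^ j dvd c then 1100 * 2 ^ j else 0) + 10 \<le> t)" for t \<sigma>'
  show ?thesis
    unfolding refresh_loop_def
  proof (rule runs_Loop[where I = I])
    show "I (80 * height m + (\<Sum>j<height m. if 2 ^ j dvd c then 1100 * 2 ^ j else 0) + 10) \<sigma>"
      using s L refresh_frame_refl unfolding I_def by blast
    fix t and \<sigma>1 :: store assume "I t \<sigma>1"
    then obtain j where s1: "main_state n m D rk j p q \<sigma>1" and L1: "levels_ok n m rk p q c j \<sigma>1"
      and frame: "refresh_frame \<sigma> \<sigma>1" and t: "80 * j + (\<Sum>j<j. if 2 ^ j dvd c then 1100 * 2 ^ j else 0) + 10 \<le> t"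
      unfolding I_def by blast
    have j: "fst \<sigma>1 19 0 = j" "j \<le> height m" using s1 by (simp_all add: main_state_def)
    have c1: "fst \<sigma>1 18 0 = c" using frame c by (simp add: refresh_frame_def)
    let ?c = "NLess (NConst 0) (var 19)"
    show "bfits W \<sigma>1 ?c"
      using j height_le_linear[of m] fits_word_linear[OF W] W by (simp add: fits_word_def)
    show "1 + bcost ?c \<le> t \<and> main_state n m D rk 0 p q \<sigma>1 \<and>
        levels_ok n m rk p q c 0 \<sigma>1 \<and> refresh_frame \<sigma> \<sigma>1" if "\<not> bval \<sigma>1 ?c"
      using that s1 L1 frame t j by simp
    show "\<exists>u t'. runs W refresh_step \<sigma>1 u (I t') \<and> 1 + bcost ?c + u + t' \<le> t"
      if "bval \<sigma>1 ?c"
    proof -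
      have "0 < j" using that j by simp
      then obtain i where i: "j = Suc i" by (cases j) auto
      have "runs W refresh_step \<sigma>1 (60 + (if 2 ^ i dvd c then 1100 * 2 ^ i else 0))
          (I (80 * i + (\<Sum>j<i. if 2 ^ j dvd c then 1100 * 2 ^ j else 0) + 10))"
        by (rule runs_mono[OF runs_refresh_step[OF W m s1[unfolded i] c1 c(2) L1[unfolded i] rk]])
          (use frame in \<open>auto simp: I_def intro: refresh_frame_trans\<close>)
      moreover have "1 + bcost ?c + (60 + (if 2 ^ i dvd c then 1100 * 2 ^ i else 0)) +
          (80 * i + (\<Sum>j<i. if 2 ^ j dvd c then 1100 * 2 ^ j else 0) + 10) \<le> t"
        using t unfolding i by simp
      ultimately show ?thesis by blast
    qed
  qed
qed

lemma runs_refresh: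
  assumes W: "fits_word m W" and m: "m = n * n" and b: "base n m D \<sigma>" and rk0: "fst \<sigma> 7 = rk"
    and pq: "fst \<sigma> 16 0 = p" "fst \<sigma> 17 0 = q" "p \<le> m" "q \<le> m"
    and J: "fst \<sigma> 8 0 = 2 ^ height m" "fst \<sigma> 9 0 = height m"
    and c: "fst \<sigma> 18 0 = c" "c \<le> 4 * m" and L: "levels_ok n m rk p q c (height m) \<sigma>"
    and rk: "\<And>x. x < m \<Longrightarrow> rk x < m" "inj_on rk {..<m}"
  shows "runs W refresh \<sigma> (80 * height m + (\<Sum>j<height m. if 2 ^ j dvd c then 1100 * 2 ^ j else 0) + 20)
    (\<lambda>\<sigma>'. levels_ok n m rk p q c 0 \<sigma>' \<and> refresh_frame \<sigma> \<sigma>')"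
proof -
  note lin = fits_word_linear[OF W]
  have m1: "1 \<le> m" using W by (simp add: fits_word_def)
  define \<sigma>1 where "\<sigma>1 = nupdate (nupdate \<sigma> 19 0 (height m)) 20 0 (2 ^ height m)"
  have s1: "main_state n m D rk (height m) p q \<sigma>1"
    using b rk0 pq by (simp add: main_state_def base_def \<sigma>1_def)
  have L1: "levels_ok n m rk p q c (height m) \<sigma>1"
  proof -
    have "level_ok n m rk p q K j \<sigma>1 \<longleftrightarrow> level_ok n m rk p q K j \<sigma>" for p q K j
      by (simp add: level_ok_def \<sigma>1_def)
    then show ?thesis using L unfolding levels_ok_def by (simp add: \<sigma>1_def)
  qed
  have frame1: "refresh_frame \<sigma> \<sigma>1" by (simp add: refresh_frame_def \<sigma>1_def)
  have "runs W refresh_loop \<sigma>1 (80 * height m + (\<Sum>j<height m. if 2 ^ j dvd c then 1100 * 2 ^ j else 0) + 10)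
    (\<lambda>\<sigma>'. main_state n m D rk 0 p q \<sigma>' \<and> levels_ok n m rk p q c 0 \<sigma>' \<and> refresh_frame \<sigma>1 \<sigma>')"
    by (rule runs_refresh_loop[OF W m s1 _ c(2) L1 rk]) (use c in \<open>simp_all add: \<sigma>1_def\<close>)
  then have run: "runs W refresh_loop \<sigma>1 (80 * height m + (\<Sum>j<height m. if 2 ^ j dvd c then 1100 * 2 ^ j else 0) + 10)
    (\<lambda>\<sigma>'. levels_ok n m rk p q c 0 \<sigma>' \<and> refresh_frame \<sigma> \<sigma>')"
    by (rule runs_mono) (use frame1 in \<open>auto intro: refresh_frame_trans\<close>)
  have W1: "height m \<le> W" "2 ^ height m \<le> W"
    using lin height_le_linear[OF m1] power_height_le[OF m1] by linarith+
  have run20: "runs W (set_var 20 (var 8)) (nupdate \<sigma> 19 0 (height m)) 5 (\<lambda>\<sigma>'. \<sigma>' = \<sigma>1)"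
    using J W1 by (simp add: \<sigma>1_def)
  have "runs W (set_var 19 (var 9)) \<sigma> 5 (\<lambda>\<sigma>'. \<sigma>' = nupdate \<sigma> 19 0 (height m))"
    using J W1 by simp
  then show ?thesis
    unfolding refresh_def
    by (rule runs_Seq_exact[OF _ runs_Seq_exact[OF run20 run order_refl]]) simp
qed

section \<open>Evaluating a window and moving the pointers\<close>

definition low_exp :: rexp where "low_exp = RCell 3 (var 16)"
definition high_exp :: rexp where "high_exp = RCell 3 (NMinus (var 17) (NConst 1))"

definition value_exp :: "bool \<Rightarrow> rexp" where
  "value_exp ratio = (if ratio then RDivide high_exp low_exp else RMinus high_exp low_exp)"

definition admissible_exp :: "bool \<Rightarrow> bexp" where
  "admissible_exp ratio = (if ratio then RLess (RConst 0) low_exp else BNot (RLess low_exp (RConst 0)))"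

lemma window_exps:
  assumes "fst \<sigma> 16 0 = p" "fst \<sigma> 17 0 = q" "snd \<sigma> 3 = Ds" "p \<le> W" "q - Suc 0 \<le> W"
    and "q \<le> W" "Suc 0 \<le> W"
  shows "rval \<sigma> (value_exp ratio) = range_value ratio (Ds p) (Ds (q - 1))"
    and "rfits W \<sigma> (value_exp ratio)" and "rcost (value_exp ratio) \<le> 15"
    and "bval \<sigma> (admissible_exp ratio) \<longleftrightarrow> admissible ratio (Ds p)"
    and "bfits W \<sigma> (admissible_exp ratio)" and "bcost (admissible_exp ratio) \<le> 10"
  using assms
  by (cases ratio; auto simp: value_exp_def admissible_exp_def low_exp_def high_exp_def range_value_def admissible_def)+

text \<open>\<open>BAnd\<close> evaluates both sides, so the quotient is formed even for
  \<open>s = 0\<close>; it is then 0 in HOL and masked by the admissibility test. Real cell (0, 0)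
  still holds a coordinate until the flag in variable 24 is set, hence the test of the flag
  alongside the comparison.\<close>

definition record_window :: "bool \<Rightarrow> program" where
  "record_window ratio = Cond (BAnd (admissible_exp ratio)
       (BNot (BAnd (NLess (NConst 0) (var 24)) (BNot (RLess (value_exp ratio) (RCell 0 (NConst 0)))))))
     (RAssign 0 (NConst 0) (value_exp ratio) ;; set_var 24 (NConst 1)) Skip"

text \<open>Level 0 has no nodes left, so its start node tells the outcome: success is
  \<open>m\<close>, an equality tested by two strict comparisons. When even \<open>[p, m)\<close> is
  infeasible, neither pointer moves and the remaining rounds are idle.\<close>

definition advance :: "bool \<Rightarrow> program" where
  "advance ratio = Cond (BAnd (BNot (NLess (NCell 14 (NConst 0)) (var 2))) (BNot (NLess (var 2) (NCell 14 (NConst 0)))))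
     (record_window ratio ;; set_var 16 (NPlus (var 16) (NConst 1)))
     (Cond (NLess (var 17) (var 2)) (set_var 17 (NPlus (var 17) (NConst 1))) Skip)"

definition advance_frame :: "store \<Rightarrow> store \<Rightarrow> bool" where
  "advance_frame \<sigma> \<sigma>' \<longleftrightarrow> (\<forall>v. v \<noteq> 0 \<longrightarrow> snd \<sigma>' v = snd \<sigma> v) \<and> (\<forall>v. v \<notin> {16, 17, 24} \<longrightarrow> fst \<sigma>' v = fst \<sigma> v)"

definition search_state :: "bool \<Rightarrow> nat \<Rightarrow> nat \<Rightarrow> (nat \<Rightarrow> nat) \<Rightarrow> (nat \<Rightarrow> real) \<Rightarrow> nat \<Rightarrow> nat \<Rightarrow> store \<Rightarrow> bool" where
  "search_state ratio n m rk Ds p q \<sigma> \<longleftrightarrow> fst \<sigma> 16 0 = p \<and> fst \<sigma> 17 0 = q \<and> snd \<sigma> 3 = Ds \<and> fst \<sigma> 24 0 \<le> 1 \<and>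
     searching ratio n m rk Ds p q (fst \<sigma> 24 0) (snd \<sigma> 0 0)"

lemma runs_advance:
  assumes W: "fits_word m W" and n: "1 \<le> n" and b: "base n m D \<sigma>" and S: "search_state ratio n m rk Ds p q \<sigma>"
    and start: "fst \<sigma> 14 0 = m \<longleftrightarrow> feasible_window n rk p q" "fst \<sigma> 14 0 \<le> m + 1"
    and sorted: "\<And>i j. i \<le> j \<Longrightarrow> j < m \<Longrightarrow> Ds i \<le> Ds j" and nonneg: "\<And>i. i < m \<Longrightarrow> 0 \<le> Ds i"
  shows "runs W (advance ratio) \<sigma> 100 (\<lambda>\<sigma>'. advance_frame \<sigma> \<sigma>' \<and> (\<exists>p' q'. search_state ratio n m rk Ds p' q' \<sigma>' \<and>
    (p' = p + 1 \<and> q' = q \<or> p' = p \<and> q' = q + 1 \<or> p' = p \<and> q' = q \<and> q = m \<and> \<not> feasible_window n rk p m)))"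
    (is "runs W _ _ _ ?Q")
proof -
  note lin = fits_word_linear[OF W]
  have vars: "fst \<sigma> 16 0 = p" "fst \<sigma> 17 0 = q" "snd \<sigma> 3 = Ds" "fst \<sigma> 24 0 \<le> 1" "fst \<sigma> 2 0 = m"
    and se: "searching ratio n m rk Ds p q (fst \<sigma> 24 0) (snd \<sigma> 0 0)"
    using S b by (simp_all add: search_state_def base_def)
  have pq: "p \<le> q" "q \<le> m" using se by (simp_all add: searching_def)
  have guard: "bval \<sigma> (BAnd (BNot (NLess (NCell 14 (NConst 0)) (var 2))) (BNot (NLess (var 2) (NCell 14 (NConst 0)))))
      \<longleftrightarrow> feasible_window n rk p q"
    using start(1) vars(5) by auto
  have W1: "p \<le> W" "q \<le> W" "Suc p \<le> W" "Suc q \<le> W" "q - Suc 0 \<le> W" "m \<le> W" "fst \<sigma> 14 0 \<le> W" "fst \<sigma> 24 0 \<le> W" "Suc 0 \<le> W"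
    using lin pq start(2) vars(4) by linarith+
  show ?thesis
  proof (cases "feasible_window n rk p q")
    case False
    show ?thesis
    proof (cases "q < m")
      case True
      have "?Q (nupdate \<sigma> 17 0 (Suc q))"
        using S searching_infeasible[OF n se False True]
        by (intro conjI exI[of _ p] exI[of _ "Suc q"]) (simp_all add: advance_frame_def search_state_def)
      then show ?thesis
        using False True vars W1 unfolding advance_def runs_Cond guard by simp
    next
      case F2: False
      then have "q = m" using pq by simp
      then have "?Q \<sigma>"
        using S False by (intro conjI exI[of _ p] exI[of _ q]) (simp_all add: advance_frame_def)
      then show ?thesis
        using False F2 vars W1 unfolding advance_def runs_Cond guard by simp
    qed
  next
    case True
    define v where "v = range_value ratio (Ds p) (Ds (q - 1))"
    define found where "found = fst \<sigma> 24 0"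
    define best where "best = snd \<sigma> 0 0"
    define rec where "rec \<longleftrightarrow> admissible ratio (Ds p) \<and> (found = 0 \<or> v < best)"
    note step = searching_feasible[OF n se True sorted nonneg v_def]
    define \<sigma>1 where "\<sigma>1 = (if rec then nupdate (rupdate \<sigma> 0 0 v) 24 0 1 else \<sigma>)"
    have post: "?Q (nupdate \<sigma>1 16 0 (Suc p))"
      using S step vars unfolding rec_def \<sigma>1_def found_def best_def
      by (intro conjI exI[of _ "Suc p"] exI[of _ q]) (auto simp: advance_frame_def search_state_def)
    note exps = window_exps[OF vars(1-3) W1(1,5,2,9), of ratio]
    have run1: "runs W (record_window ratio) \<sigma> 60 (\<lambda>\<sigma>'. \<sigma>' = \<sigma>1)"
    proof -
      have guard': "bval \<sigma> (BAnd (admissible_exp ratio)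
         (BNot (BAnd (NLess (NConst 0) (var 24)) (BNot (RLess (value_exp ratio) (RCell 0 (NConst 0))))))) \<longleftrightarrow> rec"
        using exps by (auto simp: rec_def v_def found_def best_def)
      have "rcost (value_exp ratio) \<le> 15" "bcost (admissible_exp ratio) \<le> 10" by (fact exps)+
      moreover have "rval \<sigma> (value_exp ratio) = v" using exps(1) by (simp only: v_def)
      ultimately show ?thesis
        using exps(2,5) vars(4) W1 unfolding record_window_def runs_Cond guard' by (cases rec) (auto simp: \<sigma>1_def)
    qed
    have "runs W (set_var 16 (NPlus (var 16) (NConst 1))) \<sigma>1 10 (\<lambda>\<sigma>'. \<sigma>' = nupdate \<sigma>1 16 0 (Suc p))"
      using vars W1 by (simp add: \<sigma>1_def)
    then have "runs W (set_var 16 (NPlus (var 16) (NConst 1))) \<sigma>1 10 ?Q"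
      by (rule runs_mono[OF _ order_refl]) (erule ssubst, rule post)
    then have "runs W (record_window ratio ;; set_var 16 (NPlus (var 16) (NConst 1))) \<sigma> 70 ?Q"
      by (rule runs_Seq_exact[OF run1]) simp
    then show ?thesis
      using True vars W1 unfolding advance_def runs_Cond[of W _ "record_window ratio ;; _"] guard
      by (simp add: runs_mono[where t = 70])
  qed
qed

definition search_loop :: "bool \<Rightarrow> program" where
  "search_loop ratio = Loop (NLess (var 18) (var 8)) (refresh ;; advance ratio ;; set_var 18 (NPlus (var 18) (NConst 1)))"

text \<open>The second summand pays for all contractions together, according to
  \<open>sum_powers_dividing\<close>.\<close>

definition search_time :: "nat \<Rightarrow> nat" where
  "search_time m = 2 ^ height m * (80 * height m + 150) + 1100 * (height m * 2 ^ height m) + 20"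

lemma search_time_eq:
  "search_time m = 2 ^ height m * (80 * height m + 150) +
     (\<Sum>c<(2::nat) ^ height m. \<Sum>j<height m. if 2 ^ j dvd c then 1100 * 2 ^ j else 0) + 20"
proof -
  have "(\<Sum>c<(2::nat) ^ height m. \<Sum>j<height m. if 2 ^ j dvd c then 1100 * 2 ^ j else 0) =
      1100 * (\<Sum>c<(2::nat) ^ height m. \<Sum>j<height m. if 2 ^ j dvd c then 2 ^ j else 0 :: nat)"
    unfolding sum_distrib_left by (intro sum.cong refl) simp
  then show ?thesis unfolding search_time_def sum_powers_dividing by simp
qed

definition optimal :: "bool \<Rightarrow> nat \<Rightarrow> nat \<Rightarrow> (nat \<Rightarrow> nat) \<Rightarrow> (nat \<Rightarrow> real) \<Rightarrow> nat \<Rightarrow> real \<Rightarrow> bool" where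
  "optimal ratio n m rk Ds found best \<longleftrightarrow>
     (\<forall>p q. q \<le> m \<longrightarrow> feasible_window n rk p q \<longrightarrow> admissible ratio (Ds p) \<longrightarrow>
        found \<noteq> 0 \<and> best \<le> range_value ratio (Ds p) (Ds (q - 1))) \<and>
     (found \<noteq> 0 \<longrightarrow> (\<exists>p q. q \<le> m \<and> feasible_window n rk p q \<and> admissible ratio (Ds p) \<and>
        best = range_value ratio (Ds p) (Ds (q - 1))))"

text \<open>Windows that start at \<open>p\<close> or later are contained in \<open>[p, m)\<close>
  and thus infeasible, so every feasible one has already been settled.\<close>

lemma searching_exhausted:
  assumes n: "1 \<le> n" and S: "searching ratio n m rk Ds p m found best" and inf: "\<not> feasible_window n rk p m"
  shows "optimal ratio n m rk Ds found best"
proof -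
  have "p' < p" if "q' \<le> m" "feasible_window n rk p' q'" for p' q'
    using feasible_window_mono[OF n that(2) _ that(1), of p] inf by force
  then show ?thesis using S unfolding searching_def optimal_def by blast
qed

text \<open>A move uses up one unit of the budget of each graph, while \<open>c mod 2 ^ j\<close>
  grows by one unless it wraps around to 0; levels where it wraps are due for rebuilding and
  exempt.\<close>

lemma levels_ok_next:
  assumes L: "levels_ok n m rk p q c 0 \<sigma>" and pq: "p' = p + 1 \<and> q' = q \<or> p' = p \<and> q' = q + 1 \<or> p' = p \<and> q' = q"
    and same: "\<And>v. v \<in> {10, 11, 12, 13, 14, 15} \<Longrightarrow> fst \<sigma>' v = fst \<sigma> v"
  shows "levels_ok n m rk p' q' (Suc c) (height m) \<sigma>'"
proof -
  have level: "level_ok n m rk p q K j \<sigma>' \<longleftrightarrow> level_ok n m rk p q K j \<sigma>" for p q K j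
    using same by (simp add: level_ok_def)
  have all: "\<forall>j<height m. level_ok n m rk p q (2 ^ j - 1 - c mod 2 ^ j) j \<sigma> \<and> fst \<sigma> 13 j \<le> 2 * (2 ^ j - 1)"
    using L by (simp add: levels_ok_def)
  have "level_ok n m rk p' q' (2 ^ j - 1 - Suc c mod 2 ^ j) j \<sigma>' \<and> fst \<sigma>' 13 j \<le> 2 * (2 ^ j - 1)"
    if j: "j < height m" and c: "\<not> 2 ^ j dvd Suc c" for j
  proof -
    have "Suc c mod 2 ^ j = Suc (c mod 2 ^ j)" using c by (simp add: mod_Suc dvd_eq_mod_eq_0 split: if_splits)
    moreover have "Suc c mod 2 ^ j < 2 ^ j" by simp
    ultimately have K: "Suc (2 ^ j - 1 - Suc c mod 2 ^ j) = 2 ^ j - 1 - c mod 2 ^ j" by linarith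
    have ok: "level_ok n m rk p q (2 ^ j - 1 - c mod 2 ^ j) j \<sigma>" and len: "fst \<sigma> 13 j \<le> 2 * (2 ^ j - 1)" using all j by blast+
    have "level_ok n m rk p' q' (2 ^ j - 1 - Suc c mod 2 ^ j) j \<sigma>"
      unfolding level_ok_def
      by (rule contracted_subrange[OF ok[unfolded level_ok_def]]) (use K pq in linarith)+
    then show ?thesis using len same unfolding level by simp
  qed
  then show ?thesis using L same unfolding levels_ok_def level by auto
qed

text \<open>The number of rounds is fixed to \<open>2 ^ height m\<close>. Each raises
  \<open>p + q\<close> by one unless the search is exhausted; as \<open>p + q \<le> 2 * m\<close>,
  it must be exhausted at the end.\<close>

lemma runs_search_loop:
  assumes W: "fits_word m W" and m: "m = n * n" and n: "1 \<le> n" and b: "base n m D \<sigma>" and rk0: "fst \<sigma> 7 = rk"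
    and S: "search_state ratio n m rk Ds 0 0 \<sigma>"
    and J: "fst \<sigma> 8 0 = 2 ^ height m" "fst \<sigma> 9 0 = height m"
    and c: "fst \<sigma> 18 0 = 0" and L: "levels_ok n m rk 0 0 0 (height m) \<sigma>"
    and rk: "\<And>x. x < m \<Longrightarrow> rk x < m" "inj_on rk {..<m}"
    and sorted: "\<And>i j. i \<le> j \<Longrightarrow> j < m \<Longrightarrow> Ds i \<le> Ds j" and nonneg: "\<And>i. i < m \<Longrightarrow> 0 \<le> Ds i"
  shows "runs W (search_loop ratio) \<sigma> (search_time m)
    (\<lambda>\<sigma>'. fst \<sigma>' 24 0 \<le> 1 \<and> optimal ratio n m rk Ds (fst \<sigma>' 24 0) (snd \<sigma>' 0 0))"
proof -
  define work where "work c = (\<Sum>j<height m. if 2 ^ j dvd c then 1100 * 2 ^ j else (0::nat))" for c :: nat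
  define N where "N = (2::nat) ^ height m"
  \<comment> \<open>Rounds differ in cost, so the potential sums the contraction work of exactly the
    remaining ones.\<close>
  define pot where "pot c = (N - c) * (80 * height m + 150) + (\<Sum>c'\<in>{c..<N}. work c') + 20" for c
  define I where "I t \<sigma> \<longleftrightarrow> base n m D \<sigma> \<and> fst \<sigma> 7 = rk \<and> fst \<sigma> 8 0 = N \<and> fst \<sigma> 9 0 = height m \<and> fst \<sigma> 18 0 \<le> N \<and>
    (\<exists>p q. search_state ratio n m rk Ds p q \<sigma> \<and> levels_ok n m rk p q (fst \<sigma> 18 0) (height m) \<sigma> \<and>
      (p + q = fst \<sigma> 18 0 \<or> q = m \<and> \<not> feasible_window n rk p m)) \<and> pot (fst \<sigma> 18 0) \<le> t" for t \<sigma>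
  note lin = fits_word_linear[OF W]
  have m1: "1 \<le> m" using W by (simp add: fits_word_def)
  have N: "N \<le> 4 * m" "2 * m < N" using power_height_le[OF m1] less_height[of m] by (simp_all add: N_def)
  have pot0: "pot 0 = search_time m" unfolding search_time_eq pot_def work_def N_def by (simp add: atLeast0LessThan)
  show ?thesis
    unfolding search_loop_def
  proof (rule runs_Loop[where I = I])
    show "I (search_time m) \<sigma>"
      unfolding I_def using b rk0 J c S L by (simp add: pot0 N_def) (metis add_0)
    fix t and \<sigma>1 :: store assume "I t \<sigma>1"
    then obtain p q where b1: "base n m D \<sigma>1" and rk1: "fst \<sigma>1 7 = rk" and J1: "fst \<sigma>1 8 0 = N" "fst \<sigma>1 9 0 = height m"
      and cN: "fst \<sigma>1 18 0 \<le> N" and S1: "search_state ratio n m rk Ds p q \<sigma>1"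
      and L1: "levels_ok n m rk p q (fst \<sigma>1 18 0) (height m) \<sigma>1"
      and progress: "p + q = fst \<sigma>1 18 0 \<or> q = m \<and> \<not> feasible_window n rk p m" and t: "pot (fst \<sigma>1 18 0) \<le> t"
      unfolding I_def by blast
    define c where "c = fst \<sigma>1 18 0"
    have pq: "p \<le> q" "q \<le> m" "p \<le> m" using S1 by (auto simp: search_state_def searching_def)
    let ?c = "NLess (var 18) (var 8)"
    let ?p = "refresh ;; advance ratio ;; set_var 18 (NPlus (var 18) (NConst 1))"
    show "bfits W \<sigma>1 ?c" using cN J1 N lin by simp
    show "1 + bcost ?c \<le> t \<and> fst \<sigma>1 24 0 \<le> 1 \<and>
        optimal ratio n m rk Ds (fst \<sigma>1 24 0) (snd \<sigma>1 0 0)"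
      if "\<not> bval \<sigma>1 ?c"
    proof -
      have "fst \<sigma>1 18 0 = N" using that cN J1 by simp
      then have "q = m \<and> \<not> feasible_window n rk p m" using progress pq N by linarith
      then show ?thesis
        using S1 t searching_exhausted[OF n] by (auto simp: search_state_def pot_def)
    qed
    show "\<exists>u t'. runs W ?p \<sigma>1 u (I t') \<and>
        1 + bcost ?c + u + t' \<le> t"
      if "bval \<sigma>1 ?c"
    proof -
      have c: "c < N" using that J1 by (simp add: c_def)
      have c4: "c \<le> 4 * m" using c N by simp
      have vars: "fst \<sigma>1 16 0 = p" "fst \<sigma>1 17 0 = q" using S1 by (simp_all add: search_state_def)
      have run1: "runs W refresh \<sigma>1 (80 * height m + work c + 20)
          (\<lambda>\<sigma>'. levels_ok n m rk p q c 0 \<sigma>' \<and> refresh_frame \<sigma>1 \<sigma>')"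
        unfolding work_def
        by (rule runs_refresh[OF W m b1 rk1 vars pq(3,2) J1(1)[unfolded N_def] J1(2) c_def[symmetric] c4 L1[folded c_def] rk])
      have run2: "runs W (advance ratio ;; set_var 18 (NPlus (var 18) (NConst 1))) \<sigma>2 110 (I (pot (Suc c)))"
        if \<sigma>2: "levels_ok n m rk p q c 0 \<sigma>2 \<and> refresh_frame \<sigma>1 \<sigma>2" for \<sigma>2
      proof -
        have frame: "refresh_frame \<sigma>1 \<sigma>2" and L2: "levels_ok n m rk p q c 0 \<sigma>2" using \<sigma>2 by blast+
        have b2: "base n m D \<sigma>2" and S2: "search_state ratio n m rk Ds p q \<sigma>2"
          using frame b1 S1 by (simp_all add: refresh_frame_def base_def search_state_def)
        have "0 < height m" using less_height[of m] m1 by (cases "height m") auto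
        \<comment> \<open>For \<open>j = 0\<close> the number of moves \<open>2 ^ j - 1\<close>
          vanishes and with it the length bound, so the node list is empty.\<close>
        then have level: "level_ok n m rk p q 0 0 \<sigma>2" and len: "fst \<sigma>2 13 0 = 0"
          using L2 unfolding levels_ok_def by force+
        have contr: "contracted n rk p q 0 0 (level_row (fst \<sigma>2 10) m 0)
            (level_row (fst \<sigma>2 11) m 0) (level_row (fst \<sigma>2 12) m 0) (fst \<sigma>2 14 0)"
          using level by (simp add: level_ok_def len)
        have start: "fst \<sigma>2 14 0 = m \<longleftrightarrow> feasible_window n rk p q" "fst \<sigma>2 14 0 \<le> m + 1"
          using contracted_empty[OF contr] contr m by (auto simp: feasible_window_def contracted_def nodes_def)
        have run3: "runs W (set_var 18 (NPlus (var 18) (NConst 1))) \<sigma>3 10 (I (pot (Suc c)))"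
          if \<sigma>3: "advance_frame \<sigma>2 \<sigma>3 \<and> (\<exists>p' q'. search_state ratio n m rk Ds p' q' \<sigma>3 \<and>
            (p' = p + 1 \<and> q' = q \<or> p' = p \<and> q' = q + 1 \<or> p' = p \<and> q' = q \<and> q = m \<and> \<not> feasible_window n rk p m))"
          for \<sigma>3
        proof -
          from \<sigma>3 have frame3: "advance_frame \<sigma>2 \<sigma>3" by (rule conjunct1)
          from \<sigma>3 obtain p' q' where S3: "search_state ratio n m rk Ds p' q' \<sigma>3"
            and move: "p' = p + 1 \<and> q' = q \<or> p' = p \<and> q' = q + 1 \<or> p' = p \<and> q' = q \<and> q = m \<and> \<not> feasible_window n rk p m"
            by blast
          define \<sigma>4 where "\<sigma>4 = nupdate \<sigma>3 18 0 (Suc c)"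
          have vars3: "fst \<sigma>3 18 0 = c" "fst \<sigma>3 7 = rk" "fst \<sigma>3 8 0 = N" "fst \<sigma>3 9 0 = height m"
            using frame frame3 rk1 J1 by (simp_all add: refresh_frame_def advance_frame_def c_def)
          have b4: "base n m D \<sigma>4" using b2 frame3 by (simp add: base_def advance_frame_def \<sigma>4_def)
          have S4: "search_state ratio n m rk Ds p' q' \<sigma>4" using S3 by (simp add: search_state_def \<sigma>4_def)
          have L4: "levels_ok n m rk p' q' (Suc c) (height m) \<sigma>4"
            by (rule levels_ok_next[OF L2]) (use move frame3 in \<open>auto simp: advance_frame_def \<sigma>4_def\<close>)
          have q': "q' \<le> m" using S3 by (simp add: search_state_def searching_def)
          have progress4: "p' + q' = Suc c \<or> q' = m \<and> \<not> feasible_window n rk p' m"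
          proof (cases "p + q = c")
            case True
            then show ?thesis using move by auto
          next
            case False
            then have stuck: "q = m" "\<not> feasible_window n rk p m" using progress by (auto simp: c_def)
            moreover from this have "\<not> feasible_window n rk (p + 1) m"
              using feasible_window_mono[OF n, of rk "p + 1" m p m] by auto
            ultimately show ?thesis using move q' by auto
          qed
          have "I (pot (Suc c)) \<sigma>4"
            unfolding I_def using b4 S4 L4 progress4 vars3 c by (auto simp: \<sigma>4_def)
          then show ?thesis using vars3 c N lin by (simp add: \<sigma>4_def)
        qed
        show ?thesis
          by (rule runs_Seq[OF runs_advance[OF W n b2 S2 start sorted nonneg] run3]) simp_all
      qed
      have "runs W ?p \<sigma>1
          (80 * height m + work c + 20 + 110) (I (pot (Suc c)))"
        by (rule runs_Seq[OF run1 run2 order_refl])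
      moreover have "1 + bcost ?c + (80 * height m + work c + 20 + 110) + pot (Suc c) \<le> t"
      proof -
        have "N - c = Suc (N - Suc c)" using c by simp
        then have "pot c = (80 * height m + 150) + work c + pot (Suc c)"
          using c by (simp add: pot_def sum.atLeast_Suc_lessThan)
        then show ?thesis using t by (simp add: c_def)
      qed
      ultimately show ?thesis by blast
    qed
  qed
qed


section \<open>Correctness of the optimal window\<close>

lemma walk_cong:
  assumes "\<And>x. x < n * n \<Longrightarrow> f x \<longleftrightarrow> f' x"
  shows "walk n f x = walk n f' x"
proof (induction "n * n - x" arbitrary: x rule: less_induct)
  case less
  show ?case
  proof (cases "x < n * n")
    case True
    have y: "x < (if f x then next_valid n x else next_invalid n x)"
      using next_valid_bounds[OF True] next_invalid_bounds[OF True] by simp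
    show ?thesis
      unfolding walk_step[OF True] assms[OF True, symmetric]
      by (rule less) (use y True in linarith)
  qed (simp add: walk_terminal)
qed

lemma walk_mono_on:
  assumes n: "1 \<le> n" and f: "walk n f 0 = n * n" and sub: "\<And>x. x < n * n \<Longrightarrow> f x \<Longrightarrow> f' x"
  shows "walk n f' 0 = n * n"
proof -
  have "walk n (\<lambda>x. x < n * n \<and> f x) 0 = n * n" using f walk_cong[of n f "\<lambda>x. x < n * n \<and> f x" 0] by simp
  then show ?thesis by (rule walk_mono[OF n]) (use sub in blast)
qed

lemma walk_all_valid:
  assumes "\<And>x. x < n * n \<Longrightarrow> f x" "x < n * n"
  shows "walk n f x = n * n"
  using assms(2)
proof (induction "n * n - x" arbitrary: x rule: less_induct)
  case less
  have step: "walk n f x = walk n f (next_valid n x)"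
    unfolding walk_step[OF less.prems] using assms(1)[OF less.prems] by simp
  show ?case
  proof (cases "x = n * n - 1")
    case True
    then have "next_valid n x = n * n" by (simp add: next_valid_def)
    then show ?thesis unfolding step by (simp add: walk_terminal)
  next
    case False
    show ?thesis
      unfolding step using next_valid_arc(1)[OF less.prems False] next_valid_bounds[OF less.prems]
      by (intro less.hyps) linarith+
  qed
qed

lemma walk_start_valid:
  assumes "1 \<le> n" "walk n f 0 = n * n"
  shows "f 0"
proof (rule ccontr)
  assume "\<not> f 0"
  moreover have 0: "0 < n * n" using assms(1) by simp
  ultimately have "walk n f 0 = n * n + 1"
    by (simp add: walk_step[OF 0] next_invalid_def walk_terminal)
  then show False using assms(2) by simp
qed

definition node_dist :: "nat \<Rightarrow> (nat \<Rightarrow> 'a::metric_space) \<Rightarrow> (nat \<Rightarrow> 'a) \<Rightarrow> nat \<Rightarrow> real" where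
  "node_dist n a b x = dist (a (x mod n + 1)) (b (x div n + 1))"

lemma feasible_range_iff_walk:
  assumes "1 \<le> n"
  shows "feasible_range n a b s t \<longleftrightarrow>
    0 \<le> s \<and> s \<le> t \<and> walk n (\<lambda>x. s \<le> node_dist n a b x \<and> node_dist n a b x \<le> t) 0 = n * n"
proof -
  have "(\<lambda>x. range_indicator a b s t (position_of n x) = 1) =
      (\<lambda>x. s \<le> node_dist n a b x \<and> node_dist n a b x \<le> t)"
    by (rule ext) (simp add: range_indicator_def position_of_def node_dist_def)
  then show ?thesis unfolding feasible_range_def s_reachable_iff_walk[OF assms] by simp
qed

locale ranked_distances =
  fixes n m :: nat and a b :: "nat \<Rightarrow> 'a::metric_space" and D Ds :: "nat \<Rightarrow> real" and rk :: "nat \<Rightarrow> nat"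
  assumes n: "1 \<le> n" and m: "m = n * n" and D: "\<And>x. x < m \<Longrightarrow> D x = node_dist n a b x"
    and ranks: "sorted_ranks D m rk Ds"
begin

lemma rank_less: "x < m \<Longrightarrow> rk x < m"
  using ranks by (auto simp: sorted_ranks_def bij_betw_def)

lemma rank_inj: "inj_on rk {..<m}"
  using ranks by (auto simp: sorted_ranks_def bij_betw_def)

lemma Ds_rank: "x < m \<Longrightarrow> Ds (rk x) = node_dist n a b x"
  using ranks D by (simp add: sorted_ranks_def)

lemma rank_surj: "r < m \<Longrightarrow> \<exists>x<m. rk x = r"
  using ranks unfolding sorted_ranks_def bij_betw_def by (metis imageE lessThan_iff)

lemma Ds_sorted: "i \<le> j \<Longrightarrow> j < m \<Longrightarrow> Ds i \<le> Ds j"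
proof -
  assume ij: "i \<le> j" "j < m"
  then obtain x y where "x < m" "rk x = i" "y < m" "rk y = j"
    using rank_surj[of i] rank_surj[of j] by auto
  then show ?thesis using ranks ij unfolding sorted_ranks_def by auto
qed

lemma Ds_nonneg: "i < m \<Longrightarrow> 0 \<le> Ds i"
proof -
  assume "i < m"
  then obtain x where "x < m" "rk x = i" using rank_surj by auto
  then show ?thesis using Ds_rank[of x] by (simp add: node_dist_def)
qed

lemma feasible_window_imp_range:
  assumes F: "feasible_window n rk p q" and q: "q \<le> m"
  shows "feasible_range n a b (Ds p) (Ds (q - 1))"
proof -
  have pq: "p < q" by (rule feasible_window_nonempty[OF n F])
  have "walk n (\<lambda>x. Ds p \<le> node_dist n a b x \<and> node_dist n a b x \<le> Ds (q - 1)) 0 = n * n"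
  proof (rule walk_mono_on[OF n F[unfolded feasible_window_def]])
    fix x assume "x < n * n" "in_window rk p q x"
    then show "Ds p \<le> node_dist n a b x \<and> node_dist n a b x \<le> Ds (q - 1)"
      using Ds_sorted[of p "rk x"] Ds_sorted[of "rk x" "q - 1"] Ds_rank[of x] rank_less[of x] q m
      by (auto simp: in_window_def)
  qed
  then show ?thesis
    unfolding feasible_range_iff_walk[OF n] using Ds_sorted[of p "q - 1"] Ds_nonneg[of p] pq q by simp
qed

text \<open>A range can be shrunk to the smallest and the largest distance that lie in it without
  losing a valid position. There are such distances since the start must be valid.\<close>

lemma feasible_range_imp_window:
  assumes F: "feasible_range n a b s t"
  shows "\<exists>p q. q \<le> m \<and> feasible_window n rk p q \<and> p < m \<and> s \<le> Ds p \<and> Ds (q - 1) \<le> t \<and> 0 \<le> Ds (q - 1)"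
proof -
  have walk: "walk n (\<lambda>x. s \<le> node_dist n a b x \<and> node_dist n a b x \<le> t) 0 = n * n"
    using F feasible_range_iff_walk[OF n] by blast
  define R where "R = {r. r < m \<and> s \<le> Ds r \<and> Ds r \<le> t}"
  have in_R: "rk x \<in> R" if "x < m" "s \<le> node_dist n a b x \<and> node_dist n a b x \<le> t" for x
    using that Ds_rank rank_less by (simp add: R_def)
  have fin: "finite R" by (rule finite_subset[of _ "{..<m}"]) (auto simp: R_def)
  have "0 < m" using n m by simp
  then have ne: "R \<noteq> {}" using in_R[OF _ walk_start_valid[OF n walk]] by blast
  define p where "p = Min R"
  define q where "q = Suc (Max R)"
  have p: "p \<in> R" and q: "Max R \<in> R" using fin ne by (simp_all add: p_def)
  have "walk n (in_window rk p q) 0 = n * n"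
    by (rule walk_mono_on[OF n walk]) (use in_R fin m in \<open>auto simp: in_window_def p_def q_def less_Suc_eq_le\<close>)
  then show ?thesis
    using p q Ds_nonneg by (intro exI[of _ p] exI[of _ q]) (auto simp: feasible_window_def R_def q_def)
qed

lemma optimal_range:
  assumes O: "optimal ratio n m rk Ds found best"
  shows "feasible_range n a b s t \<Longrightarrow> admissible ratio s \<Longrightarrow> found \<noteq> 0 \<and> best \<le> range_value ratio s t"
    and "found \<noteq> 0 \<Longrightarrow> \<exists>s t. feasible_range n a b s t \<and> admissible ratio s \<and> best = range_value ratio s t"
proof -
  assume F: "feasible_range n a b s t" and s: "admissible ratio s"
  obtain p q where pq: "q \<le> m" "feasible_window n rk p q" "s \<le> Ds p" "Ds (q - 1) \<le> t" "0 \<le> Ds (q - 1)"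
    using feasible_range_imp_window[OF F] by blast
  have adm: "admissible ratio (Ds p)" using s pq(3) by (auto simp: admissible_def split: if_splits)
  have "found \<noteq> 0 \<and> best \<le> range_value ratio (Ds p) (Ds (q - 1))"
    using O pq adm unfolding optimal_def by blast
  moreover have "range_value ratio (Ds p) (Ds (q - 1)) \<le> range_value ratio s t"
    using adm s pq by (intro range_value_mono) auto
  ultimately show "found \<noteq> 0 \<and> best \<le> range_value ratio s t" by linarith
next
  assume "found \<noteq> 0"
  then obtain p q where "q \<le> m" "feasible_window n rk p q" "admissible ratio (Ds p)"
    "best = range_value ratio (Ds p) (Ds (q - 1))" using O unfolding optimal_def by blast
  then show "\<exists>s t. feasible_range n a b s t \<and> admissible ratio s \<and> best = range_value ratio s t"
    using feasible_window_imp_range by blast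
qed

text \<open>The window of all ranks is feasible and every distance is an admissible lower end, so a
  value is always found.\<close>

lemma optimal_gap:
  assumes O: "optimal False n m rk Ds found best"
  shows "found \<noteq> 0 \<and> is_frechet_gap n a b best"
proof -
  have F: "feasible_window n rk 0 m"
    unfolding feasible_window_def
    by (rule walk_all_valid) (use n m rank_less in \<open>auto simp: in_window_def\<close>)
  have "found \<noteq> 0"
    using optimal_range(1)[OF O feasible_window_imp_range[OF F order_refl]] Ds_nonneg[of 0] n m
    by (simp add: admissible_def)
  then show ?thesis
    using optimal_range[OF O] unfolding is_frechet_gap_def
    by (auto simp: admissible_def range_value_def feasible_range_def)
qed

lemma optimal_ratio:
  assumes O: "optimal True n m rk Ds found best"
  shows "if found = 0 then \<not> (\<exists>s t. feasible_range n a b s t \<and> 0 < s) else is_frechet_ratio n a b best"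
  using optimal_range[OF O] unfolding is_frechet_ratio_def
  by (auto simp: admissible_def range_value_def)

end

section \<open>Distances from coordinates\<close>

fun square_dist_exp :: "nat \<Rightarrow> nat \<Rightarrow> rexp" where
  "square_dist_exp d 0 = RConst 0"
| "square_dist_exp d (Suc c) = RPlus (square_dist_exp d c)
     (RTimes (RMinus (RCell 0 (NPlus (NTimes (var 4) (NConst d)) (NConst c))) (RCell 1 (NPlus (NTimes (var 5) (NConst d)) (NConst c))))
        (RMinus (RCell 0 (NPlus (NTimes (var 4) (NConst d)) (NConst c))) (RCell 1 (NPlus (NTimes (var 5) (NConst d)) (NConst c)))))"

lemma rval_square_dist_exp:
  "rval \<sigma> (square_dist_exp d c) =
     (\<Sum>i<c. (snd \<sigma> 0 (fst \<sigma> 4 0 * d + i) - snd \<sigma> (Suc 0) (fst \<sigma> 5 0 * d + i))\<^sup>2)"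
  by (induction c) (simp_all add: power2_eq_square)

text \<open>The dimension \<open>d\<close> is part of the program text, so the sum is unrolled into
  one expression whose cost does not depend on \<open>n\<close>.\<close>

lemma rcost_square_dist_exp: "rcost (square_dist_exp d c) = 1 + 32 * c"
  by (induction c) simp_all

lemma rfits_square_dist_exp:
  assumes "fst \<sigma> 4 0 * d + d \<le> W" "fst \<sigma> 5 0 * d + d \<le> W" "fst \<sigma> 4 0 \<le> W" "fst \<sigma> 5 0 \<le> W"
  shows "c \<le> d \<Longrightarrow> rfits W \<sigma> (square_dist_exp d c)"
  using assms by (induction c) auto

lemma dist_coordinates:
  fixes bs :: "'a::euclidean_space list"
  assumes "distinct bs" "set bs = Basis" "i < n" "j < n"
  shows "sqrt (\<Sum>c<length bs. (coordinates bs n a (i * length bs + c) - coordinates bs n b (j * length bs + c))\<^sup>2)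
    = dist (a (i + 1)) (b (j + 1))"
proof -
  have coord: "coordinates bs n f (k * length bs + c) = f (k + 1) \<bullet> bs ! c" if "k < n" "c < length bs" for f k c
  proof -
    have "k * length bs + c < Suc k * length bs" using that by simp
    also have "\<dots> \<le> n * length bs" using that by (intro mult_le_mono1) simp
    finally have "k * length bs + c < n * length bs" .
    moreover have "(k * length bs + c) div length bs = k"
      using that(2) by (subst div_mult_self3) auto
    ultimately show ?thesis using that(2) by (simp add: coordinates_def)
  qed
  have bij: "bij_betw ((!) bs) {..<length bs} Basis"
    using assms(1,2) bij_betw_nth[OF assms(1) refl, of Basis] by simp
  have "(dist (a (i + 1)) (b (j + 1))) = sqrt (\<Sum>u\<in>Basis. (a (i + 1) \<bullet> u - b (j + 1) \<bullet> u)\<^sup>2)"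
    by (subst euclidean_dist_l2) (simp add: L2_set_def dist_real_def)
  also have "(\<Sum>u\<in>Basis. (a (i + 1) \<bullet> u - b (j + 1) \<bullet> u)\<^sup>2)
      = (\<Sum>c<length bs. (a (i + 1) \<bullet> bs ! c - b (j + 1) \<bullet> bs ! c)\<^sup>2)"
    by (rule sum.reindex_bij_betw[OF bij, symmetric])
  finally show ?thesis using coord assms(3,4) by simp
qed

text \<open>Real cell \<open>m\<close> grows by each distance plus 1. Distances are nonnegative, so
  it stays above all of them and ends up as the value of the absent player.\<close>

definition dist_step :: "nat \<Rightarrow> program" where
  "dist_step d = set_var 5 (NDiv (var 3) (var 1)) ;; set_var 4 (NMinus (var 3) (NTimes (var 5) (var 1))) ;;
     RAssign 2 (var 3) (RSqrt (square_dist_exp d d)) ;;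
     RAssign 2 (var 2) (RPlus (RCell 2 (var 2)) (RPlus (RCell 2 (var 3)) (RConst 1))) ;;
     NAssign 6 (NPlus (var 2) (var 3)) (var 3) ;; set_var 3 (NPlus (var 3) (NConst 1))"

definition dist_loop :: "nat \<Rightarrow> program" where
  "dist_loop d = Loop (NLess (var 3) (var 2)) (dist_step d)"

lemma runs_dist_loop:
  fixes bs :: "'a::euclidean_space list" and a b :: "nat \<Rightarrow> 'a"
  assumes bs: "distinct bs" "set bs = Basis"
  assumes W: "fits_word m W" and Wd: "n * length bs + length bs \<le> W" and n: "1 \<le> n" and m: "m = n * n"
    and \<sigma>: "fst \<sigma> 0 0 = 0" "fst \<sigma> (Suc 0) 0 = n" "fst \<sigma> 2 0 = m" "fst \<sigma> 3 0 = 0"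
    and R: "snd \<sigma> 0 = coordinates bs n a" "snd \<sigma> (Suc 0) = coordinates bs n b" "snd \<sigma> 2 m = 0"
  shows "runs W (dist_loop (length bs)) \<sigma> (m * (32 * length bs + 120) + 10) (\<lambda>\<sigma>'. base n m (snd \<sigma>' 2) \<sigma>' \<and>
    (\<forall>x<m. snd \<sigma>' 2 x = node_dist n a b x \<and> snd \<sigma>' 2 x < snd \<sigma>' 2 m \<and> fst \<sigma>' 6 (m + x) = x))"
proof -
  define d where "d = length bs"
  define I where "I t \<sigma> \<longleftrightarrow> fst \<sigma> 0 0 = 0 \<and> fst \<sigma> (Suc 0) 0 = n \<and> fst \<sigma> 2 0 = m \<and> fst \<sigma> 3 0 \<le> m \<and>
    snd \<sigma> 0 = coordinates bs n a \<and> snd \<sigma> (Suc 0) = coordinates bs n b \<and> 0 \<le> snd \<sigma> 2 m \<and>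
    (\<forall>x<fst \<sigma> 3 0. snd \<sigma> 2 x = node_dist n a b x \<and> snd \<sigma> 2 x < snd \<sigma> 2 m \<and> fst \<sigma> 6 (m + x) = x) \<and>
    (m - fst \<sigma> 3 0) * (32 * d + 120) + 10 \<le> t" for t and \<sigma> :: store
  note lin = fits_word_linear[OF W]
  show ?thesis
    unfolding dist_loop_def d_def[symmetric]
  proof (rule runs_Loop[where I = I])
    show "I (m * (32 * d + 120) + 10) \<sigma>" using \<sigma> R by (simp add: I_def)
    fix t and \<sigma>1 :: store assume I: "I t \<sigma>1"
    let ?c = "NLess (var 3) (var 2)"
    let ?p = "dist_step d"
    show "bfits W \<sigma>1 ?c" using I lin by (simp add: I_def)
    show "1 + bcost ?c \<le> t \<and> base n m (snd \<sigma>1 2) \<sigma>1 \<and>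
      (\<forall>x<m. snd \<sigma>1 2 x = node_dist n a b x \<and> snd \<sigma>1 2 x < snd \<sigma>1 2 m \<and> fst \<sigma>1 6 (m + x) = x)"
      if "\<not> bval \<sigma>1 ?c"
    proof -
      have eq: "fst \<sigma>1 3 0 = m" using that I by (simp add: I_def)
      have "\<forall>x<fst \<sigma>1 3 0. snd \<sigma>1 2 x = node_dist n a b x \<and> snd \<sigma>1 2 x < snd \<sigma>1 2 m \<and> fst \<sigma>1 6 (m + x) = x"
        using I unfolding I_def by (elim conjE)
      moreover have "1 + bcost ?c \<le> t \<and> base n m (snd \<sigma>1 2) \<sigma>1"
        using I by (simp add: I_def base_def)
      ultimately show ?thesis unfolding eq by (intro conjI) auto
    qed
    show "\<exists>u t'. runs W ?p \<sigma>1 u (I t') \<and> 1 + bcost ?c + u + t' \<le> t"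
      if "bval \<sigma>1 ?c"
    proof (intro exI conjI)
      define x where "x = fst \<sigma>1 3 0"
      have x: "x < m" using that I by (simp add: I_def x_def)
      define i where "i = x mod n"
      define j where "j = x div n"
      have ij: "i < n" "j < n" using x n m by (simp_all add: i_def j_def less_mult_imp_div_less)
      have i_eq: "x - j * n = i" by (simp add: i_def j_def minus_div_mult_eq_mod)
      define v where "v = node_dist n a b x"
      have v: "0 \<le> v" by (simp add: v_def node_dist_def)
      define big where "big = snd \<sigma>1 2 m"
      define \<sigma>2 where "\<sigma>2 = nupdate (nupdate \<sigma>1 5 0 j) 4 0 i"
      define \<sigma>3 where "\<sigma>3 = nupdate (nupdate (rupdate (rupdate \<sigma>2 2 x v) 2 m (big + (v + 1))) 6 (m + x) x) 3 0 (Suc x)"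
      have vars: "fst \<sigma>1 (Suc 0) 0 = n" "fst \<sigma>1 2 0 = m" "fst \<sigma>1 3 0 = x" "snd \<sigma>1 0 = coordinates bs n a"
          "snd \<sigma>1 (Suc 0) = coordinates bs n b"
        using I by (simp_all add: I_def x_def)
      have "rval \<sigma>2 (RSqrt (square_dist_exp d d)) = v"
        using dist_coordinates[OF bs ij, of a b]
        by (simp add: rval_square_dist_exp \<sigma>2_def vars d_def v_def node_dist_def i_def j_def)
      then have val: "sqrt (rval \<sigma>2 (square_dist_exp d d)) = v" by simp
      have W1: "n \<le> W" "m \<le> W" "x \<le> W" "j \<le> W" "i \<le> W" "j * n \<le> W" "m + x \<le> W" "Suc x \<le> W" "Suc 0 \<le> W"
      proof -
        have "n * 1 \<le> n * n" using n by (intro mult_le_mono2)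
        moreover have "j * n \<le> x" by (simp add: j_def)
        ultimately show "n \<le> W" "m \<le> W" "x \<le> W" "j \<le> W" "i \<le> W" "j * n \<le> W" "m + x \<le> W" "Suc x \<le> W" "Suc 0 \<le> W"
          using lin x ij m by linarith+
      qed
      have "i * d \<le> n * d" "j * d \<le> n * d" using ij by (simp_all add: mult_le_mono1)
      then have "i * d + d \<le> W" "j * d + d \<le> W" using Wd unfolding d_def by linarith+
      then have fits: "rfits W \<sigma>2 (square_dist_exp d d)"
        using W1 by (intro rfits_square_dist_exp) (simp_all add: \<sigma>2_def)
      have inv: "I ((m - Suc x) * (32 * d + 120) + 10) \<sigma>3"
        using I x v by (auto simp: I_def \<sigma>3_def \<sigma>2_def x_def[symmetric] v_def[symmetric] big_def less_Suc_eq)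
      have part2: "runs W (RAssign 2 (var 3) (RSqrt (square_dist_exp d d)) ;;
         RAssign 2 (var 2) (RPlus (RCell 2 (var 2)) (RPlus (RCell 2 (var 3)) (RConst 1))) ;;
         NAssign 6 (NPlus (var 2) (var 3)) (var 3) ;; set_var 3 (NPlus (var 3) (NConst 1))) \<sigma>2 (32 * d + 70)
         (\<lambda>\<sigma>'. \<sigma>' = \<sigma>3)"
      proof -
        have "fst \<sigma>2 2 0 = m" "fst \<sigma>2 3 0 = x" "snd \<sigma>2 2 = snd \<sigma>1 2" by (simp_all add: \<sigma>2_def vars)
        then show ?thesis
          using W1 x fits by (simp add: val rcost_square_dist_exp \<sigma>3_def big_def)
      qed
      have part1: "runs W (set_var 5 (NDiv (var 3) (var 1)) ;; set_var 4 (NMinus (var 3) (NTimes (var 5) (var 1)))) \<sigma>1 30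
          (\<lambda>\<sigma>'. \<sigma>' = \<sigma>2)"
        using W1 by (simp add: vars \<sigma>2_def j_def[symmetric] i_eq)
      have "runs W ((set_var 5 (NDiv (var 3) (var 1)) ;; set_var 4 (NMinus (var 3) (NTimes (var 5) (var 1)))) ;;
         (RAssign 2 (var 3) (RSqrt (square_dist_exp d d)) ;;
         RAssign 2 (var 2) (RPlus (RCell 2 (var 2)) (RPlus (RCell 2 (var 3)) (RConst 1))) ;;
         NAssign 6 (NPlus (var 2) (var 3)) (var 3) ;; set_var 3 (NPlus (var 3) (NConst 1)))) \<sigma>1 (32 * d + 100)
         (I ((m - Suc x) * (32 * d + 120) + 10))"
        by (rule runs_Seq_exact[OF part1 runs_mono[OF part2 order_refl]]) (use inv in simp_all)
      then show "runs W ?p \<sigma>1 (32 * d + 100) (I ((m - Suc x) * (32 * d + 120) + 10))"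
        unfolding dist_step_def by (simp only: runs_Seq_Seq)
      show "1 + bcost ?c + (32 * d + 100) + ((m - Suc x) * (32 * d + 120) + 10) \<le> t"
      proof -
        have "(m - x) * (32 * d + 120) = (m - Suc x) * (32 * d + 120) + (32 * d + 120)"
          using x by (simp add: Suc_diff_Suc[symmetric])
        then show ?thesis using I by (simp add: I_def x_def[symmetric])
      qed
    qed
  qed
qed

section \<open>The complete program\<close>

definition prepare :: "nat \<Rightarrow> program" where
  "prepare d = set_var 1 (NCell 0 (NConst 0)) ;; set_var 2 (NTimes (var 1) (var 1)) ;; set_var 0 (NConst 0) ;;
     set_var 3 (NConst 0) ;; dist_loop d"

definition frechet_program :: "bool \<Rightarrow> nat \<Rightarrow> program" where
  "frechet_program ratio d = prepare d ;; build_tree ;; (set_var 4 (NConst 0) ;; select_loop) ;; compute_height ;; init_level ;;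
     search_loop ratio ;; set_var 0 (var 24)"

definition frechet_time :: "nat \<Rightarrow> nat \<Rightarrow> nat" where
  "frechet_time d m = (m * (32 * d + 120) + 40) + ((60 * m + 10) + ((m * (60 * height m + 100) + 20) +
     ((40 * height m + 40) + ((130 * m + 100) + (search_time m + 10)))))"

lemma runs_prepare:
  fixes bs :: "'a::euclidean_space list" and a b :: "nat \<Rightarrow> 'a"
  assumes bs: "distinct bs" "set bs = Basis"
  assumes W: "fits_word m W" and Wd: "n * length bs + length bs \<le> W" and n: "1 \<le> n" and m: "m = n * n"
  shows "runs W (prepare (length bs)) (input_store bs n a b) (m * (32 * length bs + 120) + 40) (\<lambda>\<sigma>'. base n m (snd \<sigma>' 2) \<sigma>' \<and>
    (\<forall>x<m. snd \<sigma>' 2 x = node_dist n a b x \<and> snd \<sigma>' 2 x < snd \<sigma>' 2 m \<and> fst \<sigma>' 6 (m + x) = x))" (is "runs W _ ?\<sigma> _ ?Q")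
proof -
  define \<sigma>1 where "\<sigma>1 = nupdate (nupdate (nupdate (nupdate ?\<sigma> 1 0 n) 2 0 m) 0 0 0) 3 0 0"
  have "n * 1 \<le> n * n" using n by (intro mult_le_mono2)
  then have W1: "n \<le> W" "m \<le> W" using fits_word_linear[OF W] m by linarith+
  have "runs W (dist_loop (length bs)) \<sigma>1 (m * (32 * length bs + 120) + 10) ?Q"
    by (rule runs_dist_loop[OF bs W Wd n m]) (simp_all add: \<sigma>1_def input_store_def)
  then show ?thesis
    using W1 m unfolding prepare_def
    by (auto simp: \<sigma>1_def input_store_def elim!: runs_mono)
qed

lemma runs_frechet_program:
  fixes bs :: "'a::euclidean_space list" and a b :: "nat \<Rightarrow> 'a"
  assumes bs: "distinct bs" "set bs = Basis"
  assumes W: "fits_word m W" and Wd: "n * length bs + length bs \<le> W" and n: "1 \<le> n" and m: "m = n * n"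
  shows "runs W (frechet_program ratio (length bs)) (input_store bs n a b) (frechet_time (length bs) m)
    (\<lambda>\<sigma>'. \<exists>D rk Ds. ranked_distances n m a b D Ds rk \<and> optimal ratio n m rk Ds (fst \<sigma>' 0 0) (snd \<sigma>' 0 0))"
    (is "runs W _ _ _ ?Q")
proof -
  let ?search = "search_loop ratio ;; set_var 0 (var 24)"
  let ?init = "init_level ;; ?search"
  let ?height = "compute_height ;; ?init"
  let ?select = "(set_var 4 (NConst 0) ;; select_loop) ;; ?height"
  let ?t1 = "(130 * m + 100) + (search_time m + 10)"
  let ?t2 = "(40 * height m + 40) + ?t1"
  let ?t3 = "(m * (60 * height m + 100) + 20) + ?t2"
  note lin = fits_word_linear[OF W]
  have m1: "1 \<le> m" using W by (simp add: fits_word_def)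
  have search: "runs W ?search \<sigma> (search_time m + 10) ?Q"
    if r: "ranked_distances n m a b D Ds rk" and b: "base n m D \<sigma>" and \<sigma>: "fst \<sigma> 7 = rk" "snd \<sigma> 3 = Ds"
      "fst \<sigma> 8 0 = 2 ^ height m" "fst \<sigma> 9 0 = height m" "\<forall>rk p q K. level_ok n m rk p q K (height m) \<sigma>"
      "fst \<sigma> 13 (height m) = m" "fst \<sigma> 15 m = m" "fst \<sigma> 15 (Suc m) = Suc m"
      "fst \<sigma> 16 0 = 0" "fst \<sigma> 17 0 = 0" "fst \<sigma> 18 0 = 0" "fst \<sigma> 24 0 = 0" for D Ds rk \<sigma>
  proof -
    interpret ranked_distances n m a b D Ds rk by (fact r)
    have "search_state ratio n m rk Ds 0 0 \<sigma>" using \<sigma> by (simp add: search_state_def searching_def)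
    \<comment> \<open>Every \<open>2 ^ j\<close> divides the step number 0, so no level below the
      top has to be right yet.\<close>
    moreover have "levels_ok n m rk 0 0 0 (height m) \<sigma>" using \<sigma> by (simp add: levels_ok_def)
    ultimately have run1: "runs W (search_loop ratio) \<sigma> (search_time m)
        (\<lambda>\<sigma>'. fst \<sigma>' 24 0 \<le> 1 \<and> optimal ratio n m rk Ds (fst \<sigma>' 24 0) (snd \<sigma>' 0 0))"
      using rank_less rank_inj Ds_sorted Ds_nonneg by (intro runs_search_loop[OF W m n b \<sigma>(1) _ \<sigma>(3,4,11)])
    have run2: "runs W (set_var 0 (var 24)) \<sigma>' 10 ?Q"
      if "fst \<sigma>' 24 0 \<le> 1 \<and> optimal ratio n m rk Ds (fst \<sigma>' 24 0) (snd \<sigma>' 0 0)" for \<sigma>'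
      using that r lin by auto
    show ?thesis by (rule runs_Seq[OF run1 run2 order_refl])
  qed
  have init: "runs W ?init \<sigma> ?t1 ?Q"
    if r: "ranked_distances n m a b D (snd \<sigma> 3) (fst \<sigma> 7)" and b: "base n m D \<sigma>"
      and J: "fst \<sigma> 8 0 = 2 ^ height m" "fst \<sigma> 9 0 = height m" for D \<sigma>
    by (rule runs_Seq[OF runs_init_level[OF W m b J(2) height_le_linear[OF m1]]
        search[of D "snd \<sigma> 3" "fst \<sigma> 7"] order_refl])
      (use r J in \<open>simp_all\<close>)
  have height: "runs W ?height \<sigma>
      ?t2 ?Q"
    if r: "ranked_distances n m a b D (snd \<sigma> 3) (fst \<sigma> 7)" and b: "base n m D \<sigma>" for D \<sigma>
    by (rule runs_Seq[OF runs_compute_height[OF W b] init[of D] order_refl]) (use r in \<open>simp_all\<close>)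
  have select: "runs W ?select \<sigma>
      ?t3 ?Q"
    if b: "base n m D \<sigma>" and tree: "\<forall>x<m. fst \<sigma> 6 (m + x) = x" "tree_ok D m (fst \<sigma> 6) {}"
      and D: "\<And>x. x < m \<Longrightarrow> D x = node_dist n a b x" "\<And>x. x < m \<Longrightarrow> D x < D m" for D \<sigma>
  proof -
    define \<sigma>1 where "\<sigma>1 = nupdate \<sigma> 4 0 0"
    have "m < 2 ^ height m" using less_height[of m] by linarith
    then have "runs W select_loop \<sigma>1 (m * (60 * height m + 100) + 10)
        (\<lambda>\<sigma>'. base n m D \<sigma>' \<and> sorted_ranks D m (fst \<sigma>' 7) (snd \<sigma>' 3))"
      using b tree D(2) by (intro runs_select_loop[OF W]) (simp_all add: \<sigma>1_def base_def)
    then have "runs W (set_var 4 (NConst 0) ;; select_loop) \<sigma> (m * (60 * height m + 100) + 20)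
        (\<lambda>\<sigma>'. base n m D \<sigma>' \<and> sorted_ranks D m (fst \<sigma>' 7) (snd \<sigma>' 3))"
      by (auto simp: \<sigma>1_def elim!: runs_mono)
    then show ?thesis
      by (rule runs_Seq[OF _ height[of D] order_refl]) (use n m D in \<open>auto simp: ranked_distances_def\<close>)
  qed
  have build: "runs W (build_tree ;; ?select) \<sigma>
      ((60 * m + 10) + ?t3) ?Q"
    if b: "base n m (snd \<sigma> 2) \<sigma> \<and>
      (\<forall>x<m. snd \<sigma> 2 x = node_dist n a b x \<and> snd \<sigma> 2 x < snd \<sigma> 2 m \<and> fst \<sigma> 6 (m + x) = x)" for \<sigma>
    by (rule runs_Seq[OF runs_build_tree[OF W b[THEN conjunct1]] select[of "snd \<sigma> 2"] order_refl])
      (use b in \<open>auto\<close>)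
  show ?thesis
    unfolding frechet_program_def frechet_time_def
    by (rule runs_Seq[OF runs_prepare[OF bs W Wd n m] build order_refl])
qed

section \<open>Word size and asymptotic running time\<close>

lemma word_size:
  assumes "1 \<le> n"
  shows "fits_word (n * n) ((n + 1) ^ (9 + d))" and "n * d + d \<le> (n + 1) ^ (9 + d)"
proof -
  have two: "(2::nat) ^ k \<le> (n + 1) ^ k" for k using assms by (intro power_mono) auto
  have "d \<le> 2 ^ d" using less_exp[of d] by simp
  then have d: "d \<le> (n + 1) ^ d" using two[of d] by linarith
  have pos: "1 \<le> (n + 1) ^ k" for k by simp
  \<comment> \<open>The exponent 9 is 5 for the factor \<open>32 = 2 ^ 5 \<le> (n + 1) ^ 5\<close>
    plus 4 for the term of degree four. The summand \<open>d\<close> of the exponent is for the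
    addresses of coordinates.\<close>
  have "30 * ((n * n) * (n * n)) + 30 \<le> 32 * ((n * n) * (n * n) + 1)" by simp
  also have "(n * n) * (n * n) + 1 \<le> (n + 1) ^ 4"
    by (simp add: numeral_eq_Suc algebra_simps)
  also have "32 * (n + 1) ^ 4 \<le> (n + 1) ^ 5 * (n + 1) ^ 4" using two[of 5] by (intro mult_le_mono1) simp
  also have "\<dots> = (n + 1) ^ 9" by (simp flip: power_add)
  also have "\<dots> \<le> (n + 1) ^ (9 + d)" by (intro power_increasing) auto
  finally show "fits_word (n * n) ((n + 1) ^ (9 + d))" using assms by (simp add: fits_word_def)
  have "n * d + d = (n + 1) * d" by simp
  also have "\<dots> \<le> (n + 1) ^ 9 * (n + 1) ^ d"
    using d power_increasing[of 1 9 "n + 1"] by (intro mult_le_mono) auto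
  finally show "n * d + d \<le> (n + 1) ^ (9 + d)" by (simp add: power_add)
qed

text \<open>All terms are compared with \<open>m\<close> and \<open>m * h\<close>, where
  \<open>h\<close> is the height: \<open>2 ^ h \<le> 4 * m\<close> leads to less than
  \<open>5000 * (m * h)\<close> and, apart from \<open>32 * d * m\<close>, to less than
  \<open>1300 * m\<close>, so 10000 is generous.\<close>

lemma frechet_time_bound:
  assumes "1 \<le> m"
  shows "frechet_time d m \<le> (32 * d + 10000) * (m * (height m + 1))"
proof -
  define h where "h = height m"
  define P where "P = (2::nat) ^ h"
  define X where "X = h * P"
  define Y where "Y = h * m"
  have P: "P \<le> 4 * m" unfolding P_def h_def by (rule power_height_le[OF assms])
  have "h * P \<le> h * (4 * m)" by (rule mult_le_mono2[OF P])
  then have X: "X \<le> 4 * Y" by (simp add: X_def Y_def)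
  have "h * 1 \<le> h * m" using assms by (intro mult_le_mono2)
  then have h: "h \<le> Y" by (simp add: Y_def)
  have search: "search_time m = 1180 * X + 150 * P + 20"
    unfolding search_time_def h_def[symmetric] P_def[symmetric] X_def by (simp add: algebra_simps)
  have "frechet_time d m = 32 * (d * m) + 410 * m + 60 * Y + 40 * h + 220 + search_time m"
    unfolding frechet_time_def h_def[symmetric] Y_def by (simp add: algebra_simps)
  moreover have "(32 * d + 10000) * (m * (height m + 1)) = 32 * (d * Y) + 32 * (d * m) + 10000 * Y + 10000 * m"
    unfolding h_def[symmetric] Y_def by (simp add: algebra_simps)
  ultimately show ?thesis using P X h search assms by linarith
qed

text \<open>The height is logarithmic, so the time is even \<open>O(n ^ 2 * ln n)\<close>. The
  square of the logarithm enters through \<open>ln n \<ge> 1\<close>, which holds from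
  \<open>n = 3\<close> on because \<open>exp 1 \<le> 3\<close>.\<close>

lemma height_bigo:
  "(\<lambda>n. real (K * (n * n * (height (n * n) + 1)))) \<in> O(\<lambda>n. real n ^ 2 * (ln (real n)) ^ 2)"
proof (rule bigoI[where c = "9 * real K"])
  show "\<forall>\<^sub>F n in at_top. norm (real (K * (n * n * (height (n * n) + 1)))) \<le> 9 * real K * norm (real n ^ 2 * (ln (real n)) ^ 2)"
    using eventually_ge_at_top[of 3]
  proof eventually_elim
    case (elim n)
    define h where "h = height (n * n)"
    have "1 \<le> n * n" using elim by (cases n) auto
    then have "real (2 ^ h) \<le> real (4 * (n * n))" unfolding h_def of_nat_le_iff by (rule power_height_le)
    then have "ln (2 ^ h :: real) \<le> ln (4 * (real n * real n))" using elim by (subst ln_le_cancel_iff) auto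
    then have h: "real h * ln 2 \<le> ln 4 + 2 * ln (real n)"
      using elim by (simp add: ln_realpow ln_mult)
    have "exp 1 \<le> (3::real)" by (rule exp_le)
    then have "exp 1 \<le> real n" using elim by linarith
    then have l1: "1 \<le> ln (real n)" using elim by (subst ln_ge_iff) auto
    have "ln (4::real) = 2 * ln 2" using ln_realpow[of 2 2] by simp
    then have "real h * ln 2 \<le> 4 * ln (real n)" using h l1 ln_2_less_1 by linarith
    \<comment> \<open>With \<open>ln 2 \<ge> 1 / 2\<close> the height is at most
      \<open>8 * ln n\<close>, and the added 1 is at most \<open>ln n\<close>; this gives the
      constant 9.\<close>
    moreover have "real h * (1 / 2) \<le> real h * ln 2" using ln2_ge_two_thirds by (intro mult_left_mono) auto
    ultimately have "real h + 1 \<le> 9 * ln (real n)" using l1 by linarith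
    also have "\<dots> \<le> 9 * (ln (real n))\<^sup>2" using l1 by (simp add: power2_eq_square)
    finally have "real K * (real n ^ 2) * (real h + 1) \<le> real K * (real n ^ 2) * (9 * (ln (real n))\<^sup>2)"
      by (intro mult_left_mono) auto
    then have "real K * (real n ^ 2) * (real h + 1) \<le> 9 * real K * norm (real n ^ 2 * (ln (real n)) ^ 2)"
      by simp
    moreover have "norm (real (K * (n * n * (height (n * n) + 1)))) = real K * (real n ^ 2) * (real h + 1)"
      unfolding h_def by (simp add: power2_eq_square algebra_simps)
    ultimately show ?case by (simp only:)
  qed
qed

text \<open>Gap and ratio share the program scheme, the time bound and the proof; only the meaning
  of an optimal result is left to \<open>spec\<close>.\<close>

lemma frechet_computable:
  fixes bs :: "'a::euclidean_space list"
  assumes bs: "distinct bs" "set bs = Basis"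
    and spec: "\<And>n m a b D Ds rk \<sigma>. ranked_distances n m a b D Ds rk \<Longrightarrow>
      optimal ratio n m rk Ds (fst \<sigma> 0 0) (snd \<sigma> 0 0) \<Longrightarrow> spec n a b (output_of \<sigma>)"
  shows "computable_in_time bs spec (\<lambda>n. real n ^ 2 * (ln (real n)) ^ 2)"
proof -
  define d where "d = length bs"
  let ?T = "\<lambda>n. (32 * d + 10000) * (n * n * (height (n * n) + 1))"
  show ?thesis
    unfolding computable_in_time_def
  proof (rule exI[of _ "frechet_program ratio d"], rule exI[of _ "9 + d"], rule exI[of _ ?T], intro conjI allI impI)
  show "(\<lambda>n. real (?T n)) \<in> O(\<lambda>n. real n ^ 2 * (ln (real n)) ^ 2)" by (rule height_bigo)
  fix n :: nat and a b :: "nat \<Rightarrow> 'a" assume n: "1 \<le> n"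
  have "1 \<le> n * n" using n by simp
  note run = runs_mono[OF runs_frechet_program[OF bs word_size(1)[OF n] word_size(2)[OF n] n refl, of ratio a b, folded d_def]
    frechet_time_bound[OF this]]
  have "runs ((n + 1) ^ (9 + d)) (frechet_program ratio d) (input_store bs n a b) (?T n) (\<lambda>\<sigma>. spec n a b (output_of \<sigma>))"
    by (rule run) (use spec in blast)
  then show "\<exists>\<tau> \<sigma>. exec ((n + 1) ^ (9 + d)) (frechet_program ratio d) (input_store bs n a b) \<tau> \<sigma> \<and>
      \<tau> \<le> ?T n \<and> spec n a b (output_of \<sigma>)"
    unfolding runs_def .
  qed
qed

theorem theorem1:
  fixes bs :: "'a::euclidean_space list"
  assumes "distinct bs" and "set bs = Basis"
  shows "computable_in_time bs
           (\<lambda>n a b r. \<exists>\<delta>. r = Some \<delta> \<and> is_frechet_gap n a b \<delta>)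
           (\<lambda>n. real n ^ 2 * (ln (real n)) ^ 2)
       \<and> computable_in_time bs
           (\<lambda>n a b r. case r of
              Some \<delta> \<Rightarrow> is_frechet_ratio n a b \<delta>
            | None \<Rightarrow> \<not> (\<exists>s t. feasible_range n a b s t \<and> 0 < s))
           (\<lambda>n. real n ^ 2 * (ln (real n)) ^ 2)"
proof
  show "computable_in_time bs (\<lambda>n a b r. \<exists>\<delta>. r = Some \<delta> \<and> is_frechet_gap n a b \<delta>)
      (\<lambda>n. real n ^ 2 * (ln (real n)) ^ 2)"
  proof (rule frechet_computable[OF assms, where ratio = False])
    fix n m a b D Ds rk and \<sigma> :: store
    assume "ranked_distances n m a b D Ds rk" "optimal False n m rk Ds (fst \<sigma> 0 0) (snd \<sigma> 0 0)"
    from ranked_distances.optimal_gap[OF this]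
    show "\<exists>\<delta>. output_of \<sigma> = Some \<delta> \<and> is_frechet_gap n a b \<delta>"
      by (simp add: output_of_def)
  qed
  show "computable_in_time bs
      (\<lambda>n a b r. case r of Some \<delta> \<Rightarrow> is_frechet_ratio n a b \<delta>
        | None \<Rightarrow> \<not> (\<exists>s t. feasible_range n a b s t \<and> 0 < s))
      (\<lambda>n. real n ^ 2 * (ln (real n)) ^ 2)"
  proof (rule frechet_computable[OF assms, where ratio = True])
    fix n m a b D Ds rk and \<sigma> :: store
    assume "ranked_distances n m a b D Ds rk" "optimal True n m rk Ds (fst \<sigma> 0 0) (snd \<sigma> 0 0)"
    from ranked_distances.optimal_ratio[OF this]
    show "case output_of \<sigma> of Some \<delta> \<Rightarrow> is_frechet_ratio n a b \<delta>
        | None \<Rightarrow> \<not> (\<exists>s t. feasible_range n a b s t \<and> 0 < s)"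
      by (simp add: output_of_def split: if_splits)
  qed
qed

end
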